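(* Let $Y=(Y(t))_{t\ge0}$ be a pure-jump subordinator with infinite L\'evy measure $\sigma$ on $(0,\infty)$. For $\varepsilon>0$, let $Y_\varepsilon$ be the process obtained from $Y$ by removing the jumps of size larger than $\varepsilon$ in its L\'evy--It\^o decomposition, and for $t>0$ let $\Pi_t$ be the point process on $(0,\infty)$ of the jump sizes of $Y$ occurring in the time interval $[0,t]$. If $\varepsilon^{-1}\int_0^\varepsilon x\,\sigma(dx)\to c$ as $\varepsilon\to0$ for some $c>0$, then for any $t>0$, $$T_{1/\varepsilon}\Pi_t\to\eta_{ct}\ \text{ vaguely in distribution on }(0,\infty)\text{ as }\varepsilon\to0.$$ Moreover, $$\varepsilon^{-1}Y_\varepsilon(t)\to D_{ct}\ \text{ in distribution as }\varepsilon\to0.$$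
   Context: A pure-jump subordinator is a L\'evy process with nondecreasing paths and no drift, so that $Y(t)$ is the sum of its jumps up to time $t$; thus $Y_\varepsilon(t)$ is the sum of the jumps of size at most $\varepsilon$ in $[0,t]$. For a measure $\nu$ on $(0,\infty)$ and $s>0$, $T_s\nu(A)=\nu(s^{-1}A)$, so $T_{1/\varepsilon}\Pi_t(A)=\Pi_t(\varepsilon A)$. For $c>0$, $\eta_c$ is the Poisson process on $(0,\infty)$ with intensity measure $cx^{-1}\,dx$, and $D_c$ is the generalized Dickman random variable with parameter $c$, whose law is that of the sum of the points of $\eta_c$ in $(0,1)$. Vague convergence in distribution of point processes means convergence in distribution as random elements of the space of locally finite measures on $(0,\infty)$ with the vague topology (generated by integration against bounded non-negative continuous functions with relatively compact support in $(0,\infty)$). *)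

theory Defs
  imports "HOL-Probability.Probability"
begin

section \<open>Levy processes and subordinators\<close>

text \<open>Only the values at times \<open>t \<ge> 0\<close> are relevant.\<close>

definition cadlag :: "(real \<Rightarrow> real) \<Rightarrow> bool" where
  "cadlag y \<longleftrightarrow>
     (\<forall>t\<ge>0. (y \<longlongrightarrow> y t) (at_right t)) \<and>
     (\<forall>t>0. \<exists>l. (y \<longlongrightarrow> l) (at_left t))"

text \<open>Stochastic continuity follows from right continuity and stationarity of the increments.\<close>

definition levy_process :: "'a measure \<Rightarrow> (real \<Rightarrow> 'a \<Rightarrow> real) \<Rightarrow> bool" where
  "levy_process M Y \<longleftrightarrow>
     prob_space M \<and>
     (\<forall>t\<ge>0. Y t \<in> borel_measurable M) \<and>
     (AE \<omega> in M. Y 0 \<omega> = 0) \<and>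
     (\<forall>\<omega>\<in>space M. cadlag (\<lambda>t. Y t \<omega>)) \<and>
     (\<forall>(n::nat) \<tau>. 0 \<le> \<tau> 0 \<longrightarrow> (\<forall>i<n. \<tau> i \<le> \<tau> (Suc i)) \<longrightarrow>
        prob_space.indep_vars M (\<lambda>_. borel) (\<lambda>i \<omega>. Y (\<tau> (Suc i)) \<omega> - Y (\<tau> i) \<omega>) {..<n}) \<and>
     (\<forall>s\<ge>0. \<forall>h\<ge>0. distr M borel (\<lambda>\<omega>. Y (s + h) \<omega> - Y s \<omega>) = distr M borel (Y h))"

definition jump :: "(real \<Rightarrow> real) \<Rightarrow> real \<Rightarrow> real" where
  "jump y t = y t - Lim (at_left t) y"

definition pure_jump_subordinator :: "'a measure \<Rightarrow> (real \<Rightarrow> 'a \<Rightarrow> real) \<Rightarrow> bool" where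
  "pure_jump_subordinator M Y \<longleftrightarrow>
     levy_process M Y \<and>
     (\<forall>\<omega>\<in>space M. mono_on {0..} (\<lambda>t. Y t \<omega>)) \<and>
     (AE \<omega> in M. \<forall>t\<ge>0. (jump (\<lambda>s. Y s \<omega>) has_sum Y t \<omega>) {0<..t})"

abbreviation pos_borel :: "real measure" where
  "pos_borel \<equiv> restrict_space borel {0<..}"

text \<open>The counting measure of the sizes of the jumps of a nondecreasing path, with multiplicities:
  the value on \<open>A\<close> is the number of \<open>s\<close> in \<open>(0, t]\<close> with \<open>jump y s \<in> A\<close>.\<close>

definition jump_measure :: "(real \<Rightarrow> real) \<Rightarrow> real \<Rightarrow> real measure" where
  "jump_measure y t = distr (count_space {s. 0 < s \<and> s \<le> t \<and> 0 < jump y s}) pos_borel (jump y)"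

text \<open>The Levy measure of a process with nondecreasing paths: the expected number, per unit of
  time, of jumps with size in a given set.\<close>

definition levy_measure_of :: "'a measure \<Rightarrow> (real \<Rightarrow> 'a \<Rightarrow> real) \<Rightarrow> real measure \<Rightarrow> bool" where
  "levy_measure_of M Y \<sigma> \<longleftrightarrow>
     sets \<sigma> = sets pos_borel \<and>
     (\<forall>A\<in>sets pos_borel.
        emeasure \<sigma> A = (\<integral>\<^sup>+\<omega>. emeasure (jump_measure (\<lambda>s. Y s \<omega>) 1) A \<partial>M))"

text \<open>For a cadlag path only finitely many jumps are removed.\<close>

definition remove_jumps :: "real \<Rightarrow> (real \<Rightarrow> real) \<Rightarrow> real \<Rightarrow> real" where
  "remove_jumps \<epsilon> y t = y t - (\<Sum>s\<in>{s. 0 < s \<and> s \<le> t \<and> \<epsilon> < jump y s}. jump y s)"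


section \<open>Locally finite measures and the vague topology\<close>

definition lf_measures :: "real measure set" where
  "lf_measures = {\<mu>. sets \<mu> = sets pos_borel \<and>
     (\<forall>K. compact K \<and> K \<subseteq> {0<..} \<longrightarrow> emeasure \<mu> K < \<infinity>)}"

definition vague_test :: "(real \<Rightarrow> real) set" where
  "vague_test = {f. continuous_on {0<..} f \<and> bounded (f ` {0<..}) \<and> (\<forall>x>0. 0 \<le> f x) \<and>
     (\<exists>K. compact K \<and> K \<subseteq> {0<..} \<and> (\<forall>x>0. x \<notin> K \<longrightarrow> f x = 0))}"

definition vague_topology :: "real measure topology" where
  "vague_topology = topology_generated_by
     {{\<mu>\<in>lf_measures. (\<integral>x. f x \<partial>\<mu>) \<in> U} | f U. f \<in> vague_test \<and> open U}"

text \<open>\<open>T\<^sub>s \<nu> (A) = \<nu> (s\<^sup>-\<^sup>1 A)\<close>, the image of \<open>\<nu>\<close> under multiplication by \<open>s\<close>.\<close>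

definition dilate :: "real \<Rightarrow> real measure \<Rightarrow> real measure" where
  "dilate s \<nu> = distr \<nu> pos_borel (\<lambda>x. s * x)"


section \<open>Convergence in distribution\<close>

definition borel_of :: "'x topology \<Rightarrow> 'x measure" where
  "borel_of X = sigma (topspace X) {U. openin X U}"

text \<open>The approximating random elements live on \<open>M\<close>, the limit \<open>\<zeta>\<close> on a possibly different
  probability space \<open>N\<close>.\<close>

definition converges_in_distribution ::
  "'x topology \<Rightarrow> 'a measure \<Rightarrow> ('i \<Rightarrow> 'a \<Rightarrow> 'x) \<Rightarrow> 'b measure \<Rightarrow> ('b \<Rightarrow> 'x) \<Rightarrow> 'i filter \<Rightarrow> bool" where
  "converges_in_distribution X M \<xi> N \<zeta> F \<longleftrightarrow>
     (\<forall>\<^sub>F i in F. \<xi> i \<in> M \<rightarrow>\<^sub>M borel_of X) \<and>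
     \<zeta> \<in> N \<rightarrow>\<^sub>M borel_of X \<and>
     (\<forall>g. continuous_map X euclideanreal g \<and> bounded (g ` topspace X) \<longrightarrow>
        ((\<lambda>i. \<integral>\<omega>. g (\<xi> i \<omega>) \<partial>M) \<longlongrightarrow> (\<integral>\<omega>. g (\<zeta> \<omega>) \<partial>N)) F)"


section \<open>Poisson processes and the generalized Dickman distribution\<close>

definition poisson_process :: "'b measure \<Rightarrow> ('b \<Rightarrow> real measure) \<Rightarrow> real measure \<Rightarrow> bool" where
  "poisson_process N \<eta> \<Lambda> \<longleftrightarrow>
     prob_space N \<and>
     \<eta> \<in> N \<rightarrow>\<^sub>M borel_of vague_topology \<and>
     (\<forall>A\<in>sets pos_borel. emeasure \<Lambda> A < \<infinity> \<longrightarrow>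
        (\<forall>k::nat. measure N {\<omega>\<in>space N. emeasure (\<eta> \<omega>) A = of_nat k}
                    = exp (- measure \<Lambda> A) * measure \<Lambda> A ^ k / fact k)) \<and>
     (\<forall>(n::nat) A. (\<forall>i<n. A i \<in> sets pos_borel) \<longrightarrow> disjoint_family_on A {..<n} \<longrightarrow>
        prob_space.indep_vars N (\<lambda>_. borel) (\<lambda>i \<omega>. emeasure (\<eta> \<omega>) (A i)) {..<n})"

definition dickman_intensity :: "real \<Rightarrow> real measure" where
  "dickman_intensity c = density (restrict_space lborel {0<..}) (\<lambda>x. ennreal (c / x))"

text \<open>\<open>D\<close>, defined on \<open>N'\<close>, is distributed as the sum of the points in \<open>(0, 1)\<close> of \<open>\<eta>\<close>.  When \<open>\<eta>\<close> is
  a Poisson process with intensity \<^term>\<open>dickman_intensity c\<close>, this says that \<open>D\<close> is a generalized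
  Dickman random variable with parameter \<open>c\<close>.\<close>

definition has_law_of_point_sum ::
  "'d measure \<Rightarrow> ('d \<Rightarrow> real) \<Rightarrow> 'b measure \<Rightarrow> ('b \<Rightarrow> real measure) \<Rightarrow> bool" where
  "has_law_of_point_sum N' D N \<eta> \<longleftrightarrow>
     prob_space N' \<and> D \<in> borel_measurable N' \<and>
     distr N' borel D = distr N borel (\<lambda>\<omega>. LINT x:{0<..<1}|\<eta> \<omega>. x)"

end

theory Submission
  imports Defs
begin

text \<open>Both limits are read off from Laplace functionals.  For a test function \<open>f \<ge> 0\<close> the two
  point processes satisfy
    \<open>E exp (- \<integral> f d\<Pi>\<^sub>t) = exp (- t \<integral> (1 - exp (- f)) d\<sigma>)\<close>  and
    \<open>E exp (- \<integral> f d\<eta>) = exp (- \<integral> (1 - exp (- f)) d\<Lambda>)\<close>,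
  where \<open>\<Lambda>(dx) = c t dx / x\<close>.  Rescaling \<open>\<Pi>\<^sub>t\<close> by \<open>1 / \<epsilon>\<close> replaces \<open>f\<close> by \<open>f (x / \<epsilon>)\<close>, so that
  everything reduces to the statement that \<open>\<integral> g (x / \<epsilon>) \<sigma>(dx)\<close> tends to \<open>c \<integral> g (x) / x dx\<close>.  The
  hypothesis says that the measure \<open>x \<sigma>(dx)\<close> gives mass asymptotic to \<open>c \<epsilon>\<close> to \<open>(0, \<epsilon>]\<close>; after
  rescaling its distribution function converges to that of \<open>c\<close> times Lebesgue measure, which is this
  limit (\<open>tendsto_integral_small_jumps\<close>).

  The Laplace functional of the jumps (\<open>Laplace_functional_levy_measure\<close>) is obtained without the
  Levy-Ito decomposition.  Along a nondecreasing right-continuous path with left limits, the sum of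
  \<open>f\<close> over the increments of a fine partition converges to the sum of \<open>f\<close> over the jumps, for
  continuous \<open>f\<close> that vanish near \<open>0\<close>.  The increments over a partition are independent and identically
  distributed, so the Laplace functional is the limit of an \<open>n\<close>-th power, hence \<open>exp (- a)\<close> with
  \<open>a\<close> the limit of \<open>n E (1 - exp (- f (Y (t / n))))\<close>.  Thinning the jumps shows that \<open>a\<close> is the
  expected value of \<open>\<integral> (1 - exp (- f)) d\<Pi>\<^sub>t\<close>; stationarity of the increments makes it linear in
  \<open>t\<close>, and at time \<open>1\<close> it is an integral with respect to the Levy measure.

  The passage from Laplace functionals to convergence in distribution needs neither tightness nor
  compactness (\<open>converges_in_distribution_by_test_functions\<close>).  The functions \<open>exp (- \<integral> f d\<mu>)\<close> are closed
  under products, and countably many of them generate the vague topology.  Uniform limits of their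
  linear combinations form a lattice for which the convergence of expectations holds, and every
  nonnegative bounded continuous function is the supremum of a countable family in this lattice.
  Hence the lower limit of its expectations is at least the expectation of the limit, and applying
  this to \<open>B + g\<close> and \<open>B - g\<close> gives convergence.

  The same principle on the half line, with the functions \<open>exp (- k x)\<close>, gives the second limit.  The
  rescaled sum of the small jumps is the integral of \<open>x\<close> over \<open>(0, 1]\<close> with respect to the rescaled jump
  measure, and its Laplace transform is computed from the Laplace functional by approximating this
  discontinuous integrand.\<close>

section \<open>Convergence in distribution by test functions\<close>

text \<open>The initial topology of the sequence \<open>e\<close> is at least as fine as that of \<open>X\<close>, stated by
  basic neighbourhoods that only use an initial segment of the sequence.\<close>

definition generates_topology :: "'x topology \<Rightarrow> (nat \<Rightarrow> 'x \<Rightarrow> real) \<Rightarrow> bool" where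
  "generates_topology X e \<longleftrightarrow> (\<forall>U. openin X U \<longrightarrow> (\<forall>x\<in>U. \<exists>n. \<exists>\<delta>>0. \<forall>y\<in>topspace X.
     (\<forall>k<n. \<bar>e k y - e k x\<bar> < \<delta>) \<longrightarrow> y \<in> U))"

text \<open>Functions of \<open>e 0, e 1, \<dots>\<close> concentrated near a point.  The parameters, among them the centre of the
  bump, range over a countable type, so that there are only countably many such functions.\<close>

definition bump :: "(nat \<Rightarrow> 'x \<Rightarrow> real) \<Rightarrow> nat \<Rightarrow> (nat \<times> rat) list \<Rightarrow> 'x \<Rightarrow> real" where
  "bump e m l x = max 0 (1 - real m * (\<Sum>(k, r)\<leftarrow>l. \<bar>e k x - of_rat r\<bar>))"

lemma bump_nonneg: "0 \<le> bump e m l x" and bump_le_1: "bump e m l x \<le> 1"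
proof -
  have "0 \<le> (\<Sum>(k, r)\<leftarrow>l. \<bar>e k x - of_rat r\<bar>)"
    by (rule sum_list_nonneg) auto
  then show "0 \<le> bump e m l x" "bump e m l x \<le> 1"
    by (auto simp: bump_def)
qed

text \<open>A rational centre close enough to the values of \<open>e\<close> at \<open>x\<close> produces a bump that is almost \<open>1\<close> at \<open>x\<close>
  and lives on \<open>U\<close>.  So the positivity sets of the countably many bumps form a base of the topology.\<close>

lemma bump_localizes:
  assumes gen: "generates_topology X e" and U: "openin X U" "x \<in> U" and \<eta>: "\<eta> > 0"
  obtains m l where "bump e m l x > 1 - \<eta>" "\<And>y. y \<in> topspace X \<Longrightarrow> 0 < bump e m l y \<Longrightarrow> y \<in> U"
proof -
  obtain n \<delta> where \<delta>: "\<delta> > 0" and sub: "\<And>y. y \<in> topspace X \<Longrightarrow> (\<And>k. k < n \<Longrightarrow> \<bar>e k y - e k x\<bar> < \<delta>) \<Longrightarrow> y \<in> U"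
    using gen U unfolding generates_topology_def by meson
  \<comment> \<open>The slope \<open>m\<close> makes the bump vanish at distance \<open>\<delta> / 2\<close> from its centre; the error \<open>\<rho>\<close> of the
    centre costs at most \<open>\<delta> / 2\<close> in distance and at most \<open>\<eta>\<close> in height.\<close>
  obtain m :: nat where m: "2 / \<delta> < real m" using reals_Archimedean2 by blast
  have m0: "0 < real m" using m \<delta> by (smt (verit) divide_pos_pos)
  define \<rho> where "\<rho> = min (\<delta> / 2) (\<eta> / (real m * (real n + 1)))"
  have \<rho>: "\<rho> > 0" using \<delta> \<eta> m0 by (simp add: \<rho>_def)
  have "\<exists>r::rat. \<bar>e k x - of_rat r\<bar> < \<rho>" for k
  proof -
    obtain r where "e k x - \<rho> < of_rat r" "of_rat r < e k x + \<rho>"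
      using of_rat_dense[of "e k x - \<rho>" "e k x + \<rho>"] \<rho> by auto
    then show ?thesis by (intro exI[of _ r]) auto
  qed
  then obtain r :: "nat \<Rightarrow> rat" where r: "\<And>k. \<bar>e k x - of_rat (r k)\<bar> < \<rho>" by metis
  define l where "l = map (\<lambda>k. (k, r k)) [0..<n]"
  have sl: "(\<Sum>(k, r)\<leftarrow>l. \<bar>e k z - of_rat r\<bar>) = (\<Sum>k<n. \<bar>e k z - of_rat (r k)\<bar>)" for z
    by (simp add: l_def o_def interv_sum_list_conv_sum_set_nat atLeast0LessThan)
  show thesis
  proof
    have "(\<Sum>k<n. \<bar>e k x - of_rat (r k)\<bar>) \<le> real n * \<rho>"
      using sum_bounded_above[of "{..<n}" "\<lambda>k. \<bar>e k x - of_rat (r k)\<bar>" \<rho>] r by (simp add: less_imp_le)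
    then have "real m * (\<Sum>k<n. \<bar>e k x - of_rat (r k)\<bar>) \<le> real m * (real n * \<rho>)"
      using m0 by simp
    also have "\<dots> < real m * ((real n + 1) * \<rho>)" using m0 \<rho> by (simp)
    also have "\<dots> \<le> real m * ((real n + 1) * (\<eta> / (real m * (real n + 1))))"
      using m0 by (intro mult_left_mono) (auto simp: \<rho>_def)
    also have "\<dots> = \<eta>"
    proof -
      have "real n + 1 \<noteq> 0" by linarith
      then show ?thesis using m0 by (simp del: of_nat_Suc)
    qed
    finally show "1 - \<eta> < bump e m l x" by (simp add: bump_def sl)
  next
    fix y assume y: "y \<in> topspace X" "0 < bump e m l y"
    then have *: "real m * (\<Sum>k<n. \<bar>e k y - of_rat (r k)\<bar>) < 1" by (simp add: bump_def sl)
    show "y \<in> U"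
    proof (rule sub[OF y(1)])
      fix k assume k: "k < n"
      have "\<bar>e k y - of_rat (r k)\<bar> \<le> (\<Sum>k<n. \<bar>e k y - of_rat (r k)\<bar>)"
        using k by (intro member_le_sum) auto
      then have "real m * \<bar>e k y - of_rat (r k)\<bar> < 1"
        using * m0 by (smt (verit) mult_left_mono)
      then have "\<bar>e k y - of_rat (r k)\<bar> < 1 / real m" using m0 by (simp add: field_simps)
      also have "1 / real m < \<delta> / 2" using m \<delta> m0 by (simp add: field_simps)
      finally show "\<bar>e k y - e k x\<bar> < \<delta>" using r[of k] unfolding \<rho>_def by linarith
    qed
  qed
qed

lemma space_borel_of: "space (borel_of X) = topspace X"
  by (simp add: borel_of_def space_measure_of_conv)

lemma sets_borel_of: "sets (borel_of X) = sigma_sets (topspace X) {U. openin X U}"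
  unfolding borel_of_def by (rule sets_measure_of) (auto dest: openin_subset)

lemma continuous_map_borel_of:
  assumes "continuous_map X euclideanreal f"
  shows "f \<in> borel_measurable (borel_of X)"
proof (rule borel_measurableI)
  fix S :: "real set" assume "open S"
  then have "openin X {x \<in> topspace X. f x \<in> S}"
    using assms by (auto simp: continuous_map_def)
  moreover have "f -` S \<inter> space (borel_of X) = {x \<in> topspace X. f x \<in> S}"
    by (auto simp: space_borel_of)
  ultimately show "f -` S \<inter> space (borel_of X) \<in> sets (borel_of X)"
    by (auto simp: sets_borel_of)
qed

lemma bump_measurable [measurable]:
  assumes [measurable]: "\<And>k. (\<lambda>x. e k (\<xi> x)) \<in> borel_measurable M"
  shows "(\<lambda>x. bump e m l (\<xi> x)) \<in> borel_measurable M"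
proof -
  have "(\<lambda>x. \<Sum>(k, r)\<leftarrow>l. \<bar>e k (\<xi> x) - of_rat r\<bar>) \<in> borel_measurable M"
    by (induction l) auto
  then show ?thesis unfolding bump_def by measurable
qed

text \<open>An open set is a countable union of positivity sets of bumps, so measurability of the
  coordinates suffices for measurability with respect to the Borel sets.\<close>

lemma measurable_borel_of:
  assumes gen: "generates_topology X e"
    and top: "\<And>\<omega>. \<omega> \<in> space M \<Longrightarrow> \<xi> \<omega> \<in> topspace X"
    and meas: "\<And>k. (\<lambda>\<omega>. e k (\<xi> \<omega>)) \<in> borel_measurable M"
  shows "\<xi> \<in> M \<rightarrow>\<^sub>M borel_of X"
  unfolding borel_of_def
proof (rule measurable_measure_of)
  show "\<xi> \<in> space M \<rightarrow> topspace X" using top by auto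
  show "{U. openin X U} \<subseteq> Pow (topspace X)" by (auto dest: openin_subset)
  fix U assume "U \<in> {U. openin X U}"
  then have U: "openin X U" by simp
  define J where "J = {(m, l). \<forall>y\<in>topspace X. 0 < bump e m l y \<longrightarrow> y \<in> U}"
  have "\<xi> -` U \<inter> space M = (\<Union>(m, l)\<in>J. {\<omega>\<in>space M. 0 < bump e m l (\<xi> \<omega>)})"
  proof (intro equalityI subsetI)
    fix \<omega> assume "\<omega> \<in> \<xi> -` U \<inter> space M"
    then obtain m l where "bump e m l (\<xi> \<omega>) > 1 - 1" "\<And>y. y \<in> topspace X \<Longrightarrow> 0 < bump e m l y \<Longrightarrow> y \<in> U"
      using bump_localizes[OF gen U, of "\<xi> \<omega>" 1] by auto
    then show "\<omega> \<in> (\<Union>(m, l)\<in>J. {\<omega>\<in>space M. 0 < bump e m l (\<xi> \<omega>)})"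
      using \<open>\<omega> \<in> _\<close> by (auto simp: J_def)
  qed (auto simp: J_def top)
  also have "\<dots> \<in> sets M"
  proof (rule sets.countable_UN')
    show "countable J" by (rule countableI_type)
    show "(\<lambda>(m, l). {\<omega>\<in>space M. 0 < bump e m l (\<xi> \<omega>)}) ` J \<subseteq> sets M"
      using bump_measurable[where \<xi>=\<xi>, OF meas] by auto
  qed
  finally show "\<xi> -` U \<inter> space M \<in> sets M" .
qed

inductive lin_span :: "('x \<Rightarrow> real) set \<Rightarrow> ('x \<Rightarrow> real) \<Rightarrow> bool" for E where
  base: "f \<in> E \<Longrightarrow> lin_span E f"
| add: "lin_span E f \<Longrightarrow> lin_span E g \<Longrightarrow> lin_span E (\<lambda>x. f x + g x)"
| scale: "lin_span E f \<Longrightarrow> lin_span E (\<lambda>x. a * f x)"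

definition mult_closed :: "('x \<Rightarrow> real) set \<Rightarrow> bool" where
  "mult_closed E \<longleftrightarrow> (\<lambda>_. 1) \<in> E \<and> (\<forall>f\<in>E. \<forall>g\<in>E. (\<lambda>x. f x * g x) \<in> E)"

lemma lin_span_mult:
  assumes E: "mult_closed E" and "lin_span E f" "lin_span E g"
  shows "lin_span E (\<lambda>x. f x * g x)"
  using assms(2)
proof induction
  case (base f)
  show ?case using assms(3)
  proof induction
    case (base g) with \<open>f \<in> E\<close> E show ?case by (auto simp: mult_closed_def intro: lin_span.base)
  next
    case (add g h) then show ?case by (auto simp: distrib_left intro: lin_span.add)
  next
    case (scale g a)
    have "lin_span E (\<lambda>x. a * (f x * g x))" by (rule lin_span.scale[OF scale.IH])
    then show ?case by (simp add: mult.left_commute)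
  qed
next
  case (add f h) then show ?case by (auto simp: distrib_right intro: lin_span.add)
next
  case (scale f a)
  have "lin_span E (\<lambda>x. a * (f x * g x))" by (rule lin_span.scale[OF scale.IH])
  then show ?case by (simp add: mult.assoc)
qed

lemma lin_span_const: "mult_closed E \<Longrightarrow> lin_span E (\<lambda>_. a)"
  using lin_span.scale[OF lin_span.base, of "\<lambda>_. 1" E a] by (simp add: mult_closed_def)

text \<open>A linear span that contains \<open>1\<close> and is closed under products is an algebra.\<close>

lemma lin_span_polynomial:
  assumes E: "mult_closed E" and p: "lin_span E p" and q: "real_polynomial_function q"
  shows "lin_span E (\<lambda>x. q (p x))"
  using q
proof induction
  case (linear q)
  then obtain a where "q = (\<lambda>x. x * a)" using real_bounded_linear by metis
  then show ?case using lin_span.scale[OF p, of a] by (simp add: mult.commute)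
qed (auto intro: lin_span_const lin_span.add lin_span_mult E)

definition approximable :: "('x \<Rightarrow> real) set \<Rightarrow> 'x set \<Rightarrow> ('x \<Rightarrow> real) \<Rightarrow> bool" where
  "approximable E S f \<longleftrightarrow> (\<forall>\<delta>>0. \<exists>p. lin_span E p \<and> (\<forall>x\<in>S. \<bar>f x - p x\<bar> \<le> \<delta>))"

lemma approximable_lin_span: "lin_span E f \<Longrightarrow> approximable E S f"
  unfolding approximable_def by (intro allI impI exI[of _ f]) auto

lemma approximable_add:
  assumes "approximable E S f" "approximable E S g"
  shows "approximable E S (\<lambda>x. f x + g x)"
  unfolding approximable_def
proof (intro allI impI)
  fix \<delta> :: real assume "\<delta> > 0"
  then have "\<delta> / 2 > 0" by simp
  then obtain p q where "lin_span E p" "lin_span E q" "\<And>x. x \<in> S \<Longrightarrow> \<bar>f x - p x\<bar> \<le> \<delta>/2" "\<And>x. x \<in> S \<Longrightarrow> \<bar>g x - q x\<bar> \<le> \<delta>/2"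
    using assms unfolding approximable_def by meson
  then show "\<exists>p. lin_span E p \<and> (\<forall>x\<in>S. \<bar>f x + g x - p x\<bar> \<le> \<delta>)"
    by (intro exI[of _ "\<lambda>x. p x + q x"] conjI lin_span.add ballI) (auto, smt (verit) field_sum_of_halves)
qed

lemma approximable_scale:
  assumes "approximable E S f"
  shows "approximable E S (\<lambda>x. a * f x)"
  unfolding approximable_def
proof (intro allI impI)
  fix \<delta> :: real assume "\<delta> > 0"
  then have "\<delta> / (\<bar>a\<bar> + 1) > 0" by simp
  then obtain p where p: "lin_span E p" "\<And>x. x \<in> S \<Longrightarrow> \<bar>f x - p x\<bar> \<le> \<delta> / (\<bar>a\<bar> + 1)"
    using assms unfolding approximable_def by meson
  have "\<bar>a * f x - a * p x\<bar> \<le> \<delta>" if "x \<in> S" for x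
  proof -
    have "\<bar>a * f x - a * p x\<bar> = \<bar>a\<bar> * \<bar>f x - p x\<bar>" by (simp add: abs_mult flip: right_diff_distrib)
    also have "\<dots> \<le> (\<bar>a\<bar> + 1) * (\<delta> / (\<bar>a\<bar> + 1))" using p(2)[OF that] by (intro mult_mono) auto
    finally show ?thesis by (simp split: if_splits)
  qed
  with p show "\<exists>p. lin_span E p \<and> (\<forall>x\<in>S. \<bar>a * f x - p x\<bar> \<le> \<delta>)"
    by (intro exI[of _ "\<lambda>x. a * p x"] conjI lin_span.scale) auto
qed

lemma lin_span_bounded:
  assumes "lin_span E p" "\<forall>f\<in>E. \<forall>x\<in>S. \<bar>f x\<bar> \<le> 1"
  shows "\<exists>B. \<forall>x\<in>S. \<bar>p x\<bar> \<le> B"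
  using assms(1)
proof induction
  case (base f) then show ?case using assms(2) by blast
next
  case (add f g)
  then obtain B C where "\<forall>x\<in>S. \<bar>f x\<bar> \<le> B" "\<forall>x\<in>S. \<bar>g x\<bar> \<le> C" by blast
  then show ?case by (intro exI[of _ "B + C"]) force
next
  case (scale f a)
  then obtain B where "\<forall>x\<in>S. \<bar>f x\<bar> \<le> B" by blast
  then show ?case by (intro exI[of _ "\<bar>a\<bar> * B"]) (auto simp: abs_mult mult_left_mono)
qed

text \<open>Weierstrass approximation in one variable is enough here: \<open>\<phi>\<close> is uniformly close to a polynomial
  on the bounded range of \<open>f\<close>, and polynomials stay in the algebra.  In particular the uniform closure
  is closed under absolute values and maxima, without a Stone-Weierstrass theorem on \<open>S\<close>.\<close>

lemma approximable_continuous: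
  assumes E: "mult_closed E" and bdd: "\<forall>f\<in>E. \<forall>x\<in>S. \<bar>f x\<bar> \<le> 1"
    and f: "approximable E S f" and \<phi>: "continuous_on UNIV (\<phi> :: real \<Rightarrow> real)"
  shows "approximable E S (\<lambda>x. \<phi> (f x))"
  unfolding approximable_def
proof (intro allI impI)
  fix \<delta> :: real assume "\<delta> > 0"
  obtain p1 where p1: "lin_span E p1" "\<And>x. x \<in> S \<Longrightarrow> \<bar>f x - p1 x\<bar> \<le> 1"
    using f unfolding approximable_def by (meson zero_less_one)
  obtain B where B: "\<And>x. x \<in> S \<Longrightarrow> \<bar>p1 x\<bar> \<le> B" using lin_span_bounded[OF p1(1) bdd] by blast
  \<comment> \<open>\<open>f\<close> has values within \<open>1\<close> of \<open>[- B, B]\<close>, and an approximation of \<open>f\<close> within distance \<open>1\<close> has values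
    within \<open>2\<close> of it.\<close>
  define C where "C = {- (B + 2) .. B + 2}"
  have "compact C" by (simp add: C_def)
  then obtain q where q: "real_polynomial_function q" "\<And>x. x \<in> C \<Longrightarrow> \<bar>\<phi> x - q x\<bar> < \<delta> / 2"
    using Stone_Weierstrass_real_polynomial_function[of C \<phi> "\<delta> / 2"] \<phi> \<open>\<delta> > 0\<close>
    by (metis continuous_on_subset half_gt_zero subset_UNIV)
  have "uniformly_continuous_on C q"
    using q(1) \<open>compact C\<close> by (intro compact_uniformly_continuous continuous_on_polymonial_function)
      (simp add: real_polynomial_function_eq)
  then obtain d where d: "d > 0" "\<And>x y. x \<in> C \<Longrightarrow> y \<in> C \<Longrightarrow> \<bar>y - x\<bar> < d \<Longrightarrow> \<bar>q y - q x\<bar> < \<delta> / 2"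
    using \<open>\<delta> > 0\<close> unfolding uniformly_continuous_on_def dist_real_def by (meson half_gt_zero)
  have "min 1 (d / 2) > 0" using d by simp
  then obtain p where p: "lin_span E p" "\<And>x. x \<in> S \<Longrightarrow> \<bar>f x - p x\<bar> \<le> min 1 (d / 2)"
    using f unfolding approximable_def by meson
  have "\<bar>\<phi> (f x) - q (p x)\<bar> \<le> \<delta>" if x: "x \<in> S" for x
  proof -
    have C: "f x \<in> C" "p x \<in> C" using B[OF x] p1(2)[OF x] p(2)[OF x] by (auto simp: C_def)
    have "\<bar>f x - p x\<bar> < d" using p(2)[OF x] d(1) by auto
    then have "\<bar>q (f x) - q (p x)\<bar> < \<delta> / 2" using d(2)[OF C(2) C(1)] by simp
    then show ?thesis using q(2)[OF C(1)] by (smt (verit) field_sum_of_halves)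
  qed
  then show "\<exists>p. lin_span E p \<and> (\<forall>x\<in>S. \<bar>\<phi> (f x) - p x\<bar> \<le> \<delta>)"
    using lin_span_polynomial[OF E p(1) q(1)] by blast
qed

lemma approximable_max:
  assumes E: "mult_closed E" and bdd: "\<forall>f\<in>E. \<forall>x\<in>S. \<bar>f x\<bar> \<le> 1"
    and f: "approximable E S f" and g: "approximable E S g"
  shows "approximable E S (\<lambda>x. max (f x) (g x))"
proof -
  have "approximable E S (\<lambda>x. \<bar>f x + (-1) * g x\<bar>)"
    by (intro approximable_continuous[OF E bdd, where \<phi>=abs] approximable_add approximable_scale f g continuous_intros)
  then have "approximable E S (\<lambda>x. (1/2) * ((f x + g x) + \<bar>f x + (-1) * g x\<bar>))"
    by (intro approximable_add approximable_scale f g)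
  moreover have "(\<lambda>x. (1/2) * ((f x + g x) + \<bar>f x + (-1) * g x\<bar>)) = (\<lambda>x. max (f x) (g x))"
    by (auto simp: fun_eq_iff max_def)
  ultimately show ?thesis by simp
qed

lemma approximable_bump:
  assumes E: "mult_closed E" and bdd: "\<forall>f\<in>E. \<forall>x\<in>S. \<bar>f x\<bar> \<le> 1"
    and e: "\<And>k. e k \<in> E"
  shows "approximable E S (bump e m l)"
proof -
  have const: "approximable E S (\<lambda>_. a)" for a
    by (intro approximable_lin_span lin_span_const E)
  have "approximable E S (\<lambda>x. \<Sum>(k, r)\<leftarrow>l. \<bar>e k x - of_rat r\<bar>)"
  proof (induction l)
    case (Cons kr l)
    obtain k r where kr: "kr = (k, r)" by (cases kr)
    have "approximable E S (\<lambda>x. \<bar>e k x + (-1) * of_rat r\<bar>)"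
      by (intro approximable_continuous[OF E bdd, where \<phi>=abs] approximable_add const continuous_intros
          approximable_lin_span lin_span.base e)
    then show ?case using approximable_add[OF _ Cons.IH] by (simp add: kr)
  qed (simp add: const)
  then have "approximable E S (\<lambda>x. max 0 (1 + (- real m) * (\<Sum>(k, r)\<leftarrow>l. \<bar>e k x - of_rat r\<bar>)))"
    by (intro approximable_max[OF E bdd] approximable_add approximable_scale const)
  then show ?thesis unfolding bump_def by simp
qed

lemma lin_span_measurable:
  assumes "lin_span E p" "\<And>f. f \<in> E \<Longrightarrow> f \<in> borel_measurable B"
  shows "p \<in> borel_measurable B"
  using assms(1) by induction (auto intro: assms(2))

lemma tendsto_integral_lin_span:
  assumes M: "prob_space M" and N: "prob_space N"
    and E_meas: "\<And>f. f \<in> E \<Longrightarrow> f \<in> borel_measurable (borel_of X)"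
    and bdd: "\<forall>f\<in>E. \<forall>x\<in>topspace X. \<bar>f x\<bar> \<le> 1"
    and \<xi>: "\<forall>\<^sub>F i in F. \<xi> i \<in> M \<rightarrow>\<^sub>M borel_of X" and \<zeta>: "\<zeta> \<in> N \<rightarrow>\<^sub>M borel_of X"
    and lim: "\<And>f. f \<in> E \<Longrightarrow> ((\<lambda>i. \<integral>\<omega>. f (\<xi> i \<omega>) \<partial>M) \<longlongrightarrow> (\<integral>\<omega>. f (\<zeta> \<omega>) \<partial>N)) F"
    and p: "lin_span E p"
  shows "((\<lambda>i. \<integral>\<omega>. p (\<xi> i \<omega>) \<partial>M) \<longlongrightarrow> (\<integral>\<omega>. p (\<zeta> \<omega>) \<partial>N)) F"
proof -
  have int: "integrable P (\<lambda>\<omega>. q (z \<omega>))"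
    if q: "lin_span E q" and z: "z \<in> P \<rightarrow>\<^sub>M borel_of X" and "prob_space P" for q and P :: "'p measure" and z
  proof -
    interpret prob_space P by fact
    have [measurable]: "q \<in> borel_measurable (borel_of X)" using q E_meas by (blast intro: lin_span_measurable)
    note z[measurable]
    obtain B where "\<forall>x\<in>topspace X. \<bar>q x\<bar> \<le> B" using lin_span_bounded[OF q bdd] by blast
    then show ?thesis using measurable_space[OF z]
      by (intro integrable_const_bound[of _ B] AE_I2) (auto simp: space_borel_of)
  qed
  show ?thesis using p
  proof induction
    case (base f) then show ?case by (rule lim)
  next
    case (add f g)
    have "\<forall>\<^sub>F i in F. (\<integral>\<omega>. f (\<xi> i \<omega>) \<partial>M) + (\<integral>\<omega>. g (\<xi> i \<omega>) \<partial>M) = (\<integral>\<omega>. f (\<xi> i \<omega>) + g (\<xi> i \<omega>) \<partial>M)"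
      using \<xi> by eventually_elim (simp add: int[OF _ _ M] add)
    then show ?case
      using tendsto_add[OF add.IH] by (simp add: int[OF _ \<zeta> N] add tendsto_cong)
  next
    case (scale f a)
    then show ?case by (simp add: tendsto_mult_left)
  qed
qed

text \<open>Uniform approximation on the whole space commutes with the limit of the expectations.\<close>

lemma tendsto_integral_approximable:
  assumes M: "prob_space M" and N: "prob_space N"
    and E_meas: "\<And>f. f \<in> E \<Longrightarrow> f \<in> borel_measurable (borel_of X)"
    and bdd: "\<forall>f\<in>E. \<forall>x\<in>topspace X. \<bar>f x\<bar> \<le> 1"
    and \<xi>: "\<forall>\<^sub>F i in F. \<xi> i \<in> M \<rightarrow>\<^sub>M borel_of X" and \<zeta>: "\<zeta> \<in> N \<rightarrow>\<^sub>M borel_of X"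
    and lim: "\<And>f. f \<in> E \<Longrightarrow> ((\<lambda>i. \<integral>\<omega>. f (\<xi> i \<omega>) \<partial>M) \<longlongrightarrow> (\<integral>\<omega>. f (\<zeta> \<omega>) \<partial>N)) F"
    and A: "approximable E (topspace X) A" and A_meas: "A \<in> borel_measurable (borel_of X)"
  shows "((\<lambda>i. \<integral>\<omega>. A (\<xi> i \<omega>) \<partial>M) \<longlongrightarrow> (\<integral>\<omega>. A (\<zeta> \<omega>) \<partial>N)) F"
proof (rule tendstoI)
  fix r :: real assume r: "r > 0"
  then obtain p where p: "lin_span E p" "\<And>x. x \<in> topspace X \<Longrightarrow> \<bar>A x - p x\<bar> \<le> r / 4"
    using A unfolding approximable_def by (meson zero_less_divide_iff zero_less_numeral)
  have p_meas: "p \<in> borel_measurable (borel_of X)"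
    using lin_span_measurable[OF p(1)] E_meas by blast
  obtain B where B: "\<forall>x\<in>topspace X. \<bar>p x\<bar> \<le> B" using lin_span_bounded[OF p(1) bdd] by blast
  have close: "\<bar>(\<integral>\<omega>. A (z \<omega>) \<partial>P) - (\<integral>\<omega>. p (z \<omega>) \<partial>P)\<bar> \<le> r / 4"
    if z: "z \<in> P \<rightarrow>\<^sub>M borel_of X" and P: "prob_space P" for P :: "'p measure" and z
  proof -
    interpret prob_space P by fact
    note z[measurable] p_meas[measurable] A_meas[measurable]
    have sp: "z \<omega> \<in> topspace X" if "\<omega> \<in> space P" for \<omega>
      using measurable_space[OF z that] by (simp add: space_borel_of)
    have i1: "integrable P (\<lambda>\<omega>. p (z \<omega>))"
      using sp B by (intro integrable_const_bound[of _ B] AE_I2) auto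
    have i2: "integrable P (\<lambda>\<omega>. A (z \<omega>))"
    proof (intro integrable_const_bound[of _ "B + r / 4"] AE_I2)
      fix \<omega> assume "\<omega> \<in> space P"
      note sp = sp[OF this]
      have "\<bar>p (z \<omega>)\<bar> \<le> B" using B sp by blast
      then show "norm (A (z \<omega>)) \<le> B + r / 4" using p(2)[OF sp] unfolding real_norm_def by linarith
    qed measurable
    have "\<bar>(\<integral>\<omega>. A (z \<omega>) \<partial>P) - (\<integral>\<omega>. p (z \<omega>) \<partial>P)\<bar> = \<bar>\<integral>\<omega>. A (z \<omega>) - p (z \<omega>) \<partial>P\<bar>"
      using i1 i2 by simp
    also have "\<dots> \<le> (\<integral>\<omega>. \<bar>A (z \<omega>) - p (z \<omega>)\<bar> \<partial>P)" by (rule integral_abs_bound)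
    also have "\<dots> \<le> (\<integral>\<omega>. r / 4 \<partial>P)"
      using i1 i2 sp p(2) by (intro integral_mono) auto
    finally show ?thesis by (simp add: prob_space)
  qed
  have "((\<lambda>i. \<integral>\<omega>. p (\<xi> i \<omega>) \<partial>M) \<longlongrightarrow> (\<integral>\<omega>. p (\<zeta> \<omega>) \<partial>N)) F"
    by (rule tendsto_integral_lin_span[OF M N E_meas bdd \<xi> \<zeta> lim p(1)]) auto
  then have "\<forall>\<^sub>F i in F. dist (\<integral>\<omega>. p (\<xi> i \<omega>) \<partial>M) (\<integral>\<omega>. p (\<zeta> \<omega>) \<partial>N) < r / 4"
    using r by (intro tendstoD) auto
  with \<xi> show "\<forall>\<^sub>F i in F. dist (\<integral>\<omega>. A (\<xi> i \<omega>) \<partial>M) (\<integral>\<omega>. A (\<zeta> \<omega>) \<partial>N) < r"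
  proof eventually_elim
    case (elim i)
    from close[OF elim(1) M] close[OF \<zeta> N] elim(2) r show ?case
      unfolding dist_real_def by argo
  qed
qed

text \<open>The multiples \<open>q * bump\<close> with rational \<open>q \<ge> 0\<close> lying below \<open>G\<close> are countably many, and their
  supremum is \<open>G\<close> since some neighbourhood of each point \<open>x\<close> has \<open>G > q\<close> for \<open>q\<close> just below \<open>G x\<close>.
  The running maxima of an enumeration form the required sequence.\<close>

lemma approximable_from_below:
  fixes X :: "'x topology"
  assumes E: "mult_closed E" and bdd: "\<forall>f\<in>E. \<forall>x\<in>topspace X. \<bar>f x\<bar> \<le> 1"
    and E_meas: "\<And>f. f \<in> E \<Longrightarrow> f \<in> borel_measurable (borel_of X)"
    and e: "\<And>k. e k \<in> E" and gen: "generates_topology X e"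
    and G: "continuous_map X euclideanreal G" "\<And>x. x \<in> topspace X \<Longrightarrow> 0 \<le> G x"
  shows "\<exists>A :: nat \<Rightarrow> 'x \<Rightarrow> real.
    (\<forall>n. approximable E (topspace X) (A n) \<and> A n \<in> borel_measurable (borel_of X) \<and>
      (\<forall>x\<in>topspace X. 0 \<le> A n x \<and> A n x \<le> G x)) \<and>
    (\<forall>x\<in>topspace X. (\<lambda>n. A n x) \<longlonglongrightarrow> G x)"
proof -
  define v where "v = (\<lambda>(q :: rat, m, l) x. of_rat q * bump e m l x)"
  define J where "J = {j. \<forall>x\<in>topspace X. v j x \<le> G x}"
  define h where "h n = (if from_nat n \<in> J then v (from_nat n) else (\<lambda>_. 0))" for n
  define A where "A = rec_nat (\<lambda>_::'x. 0::real) (\<lambda>n f x. max (f x) (h n x))"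
  have A_simps: "A 0 = (\<lambda>_. 0)" "A (Suc n) = (\<lambda>x. max (A n x) (h n x))" for n
    by (auto simp: A_def)
  have zero: "approximable E (topspace X) (\<lambda>_. 0)"
    by (intro approximable_lin_span lin_span_const E)
  have happ: "approximable E (topspace X) (h n)" for n
    by (auto simp: h_def v_def zero split: prod.split intro!: approximable_scale approximable_bump E bdd e)
  have [measurable]: "\<And>k. e k \<in> borel_measurable (borel_of X)" using E_meas e by blast
  have [measurable]: "h n \<in> borel_measurable (borel_of X)" for n
    by (auto simp: h_def v_def split: prod.split)
  have 1: "approximable E (topspace X) (A n)" for n
    by (induction n) (auto simp: A_simps zero intro!: approximable_max happ E bdd)
  have 2: "A n \<in> borel_measurable (borel_of X)" for n
    by (induction n) (auto simp: A_simps)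
  have 3: "0 \<le> A n x" for n x by (induction n) (auto simp: A_simps)
  have 4: "A n x \<le> G x" if "x \<in> topspace X" for n x
    using that G(2) by (induction n) (auto simp: A_simps h_def J_def)
  have 5: "(\<lambda>n. A n x) \<longlonglongrightarrow> G x" if x: "x \<in> topspace X" for x
  proof -
    have inc: "incseq (\<lambda>n. A n x)" by (rule incseq_SucI) (simp add: A_simps)
    show ?thesis
    proof (rule LIMSEQ_I)
      fix r :: real assume r: "r > 0"
      have "\<exists>n. A n x > G x - r"
      proof (cases "G x < r")
        case True then show ?thesis using 3[of 0 x] by (intro exI[of _ 0]) simp
      next
        case False
        obtain q :: rat where q: "G x - r / 2 < of_rat q" "of_rat q < G x"
          using of_rat_dense[of "G x - r / 2" "G x"] r by auto
        have q0: "0 < (of_rat q :: real)" using q(1) False r by linarith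
        have U: "openin X {y \<in> topspace X. G y \<in> {of_rat q<..}}"
          by (rule openin_continuous_map_preimage[OF G(1)]) simp
        have xU: "x \<in> {y \<in> topspace X. G y \<in> {of_rat q<..}}" using x q by simp
        have "r / (2 * of_rat q) > 0" using r q0 by simp
        from bump_localizes[OF gen U xU this] obtain m l where
          ml: "bump e m l x > 1 - r / (2 * of_rat q)"
          "\<And>y. y \<in> topspace X \<Longrightarrow> 0 < bump e m l y \<Longrightarrow> y \<in> {y \<in> topspace X. G y \<in> {of_rat q<..}}" by blast
        have J: "(q, m, l) \<in> J"
          unfolding J_def v_def
        proof (clarsimp)
          fix y assume y: "y \<in> topspace X"
          show "of_rat q * bump e m l y \<le> G y"
          proof (cases "bump e m l y > 0")
            case True
            then have "of_rat q < G y" using ml(2)[OF y] by simp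
            moreover have "of_rat q * bump e m l y \<le> of_rat q * 1"
              using q0 bump_le_1 by (intro mult_left_mono) auto
            ultimately show ?thesis by simp
          next
            case False
            then have "bump e m l y = 0" using bump_nonneg[of e m l y] by simp
            then show ?thesis using G(2)[OF y] by simp
          qed
        qed
        define n where "n = to_nat (q, m, l)"
        have "h n = v (q, m, l)" using J by (simp add: h_def n_def)
        then have "A (Suc n) x \<ge> of_rat q * bump e m l x" by (simp add: A_simps v_def)
        moreover have "of_rat q * bump e m l x > of_rat q * (1 - r / (2 * of_rat q))"
          using ml(1) q0 by (intro mult_strict_left_mono)
        moreover have "of_rat q * (1 - r / (2 * of_rat q)) = of_rat q - r / 2" using q0 by (simp add: field_simps)
        ultimately show ?thesis using q(1) by (intro exI[of _ "Suc n"]) argo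
      qed
      then obtain n0 where n0: "A n0 x > G x - r" by blast
      show "\<exists>n0. \<forall>n\<ge>n0. norm (A n x - G x) < r"
      proof (intro exI[of _ n0] allI impI)
        fix n assume "n0 \<le> n"
        then have "A n0 x \<le> A n x" using inc by (simp add: incseq_def)
        with n0 4[OF x, of n] show "norm (A n x - G x) < r" by simp
      qed
    qed
  qed
  show ?thesis using 1 2 3 4 5 by (intro exI[of _ A]) blast
qed

text \<open>The Portmanteau argument with an increasing sequence of test functions: from \<open>A n \<le> G\<close> and
  \<open>A n\<close> increasing to \<open>G\<close> one obtains that the expectations of \<open>G\<close> are lower semicontinuous in the limit,
  for every bounded continuous \<open>G \<ge> 0\<close>.  Applied to \<open>B + g\<close> and \<open>B - g\<close> this is convergence.\<close>

theorem converges_in_distribution_by_test_functions: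
  fixes X :: "'x topology"
  assumes M: "prob_space M" and N: "prob_space N"
    and E: "mult_closed E" and bdd: "\<forall>f\<in>E. \<forall>x\<in>topspace X. \<bar>f x\<bar> \<le> 1"
    and E_cont: "\<And>f. f \<in> E \<Longrightarrow> continuous_map X euclideanreal f"
    and e: "\<And>k. e k \<in> E" and gen: "generates_topology X e"
    and \<xi>: "\<forall>\<^sub>F i in F. (\<forall>\<omega>\<in>space M. \<xi> i \<omega> \<in> topspace X) \<and> (\<forall>k. (\<lambda>\<omega>. e k (\<xi> i \<omega>)) \<in> borel_measurable M)"
    and \<zeta>: "\<zeta> \<in> N \<rightarrow>\<^sub>M borel_of X"
    and lim: "\<And>f. f \<in> E \<Longrightarrow> ((\<lambda>i. \<integral>\<omega>. f (\<xi> i \<omega>) \<partial>M) \<longlongrightarrow> (\<integral>\<omega>. f (\<zeta> \<omega>) \<partial>N)) F"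
  shows "converges_in_distribution X M \<xi> N \<zeta> F"
proof -
  have \<xi>_meas: "\<forall>\<^sub>F i in F. \<xi> i \<in> M \<rightarrow>\<^sub>M borel_of X"
    using \<xi> by eventually_elim (rule measurable_borel_of[OF gen], auto)
  have E_meas: "\<And>f. f \<in> E \<Longrightarrow> f \<in> borel_measurable (borel_of X)"
    by (rule continuous_map_borel_of[OF E_cont])
  have int: "integrable P (\<lambda>\<omega>. H (z \<omega>))"
    if "H \<in> borel_measurable (borel_of X)" "\<And>x. x \<in> topspace X \<Longrightarrow> \<bar>H x\<bar> \<le> B" "z \<in> P \<rightarrow>\<^sub>M borel_of X" "prob_space P"
    for H and B :: real and P :: "'p measure" and z
  proof -
    interpret prob_space P by fact
    note that(1,3)[measurable]
    show ?thesis using measurable_space[OF that(3)] that(2)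
      by (intro integrable_const_bound[of _ B] AE_I2) (auto simp: space_borel_of)
  qed
  have lower: "\<forall>\<^sub>F i in F. (\<integral>\<omega>. G (\<xi> i \<omega>) \<partial>M) > (\<integral>\<omega>. G (\<zeta> \<omega>) \<partial>N) - r"
    if G: "continuous_map X euclideanreal G" "\<And>x. x \<in> topspace X \<Longrightarrow> 0 \<le> G x" "\<And>x. x \<in> topspace X \<Longrightarrow> G x \<le> B"
      and r: "r > 0" for G and B r :: real
  proof -
    obtain A :: "nat \<Rightarrow> 'x \<Rightarrow> real" where
      "(\<forall>n. approximable E (topspace X) (A n) \<and> A n \<in> borel_measurable (borel_of X) \<and>
        (\<forall>x\<in>topspace X. 0 \<le> A n x \<and> A n x \<le> G x)) \<and>
      (\<forall>x\<in>topspace X. (\<lambda>n. A n x) \<longlonglongrightarrow> G x)"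
      using approximable_from_below[OF E bdd E_meas e gen G(1,2)] ..
    then have A: "\<And>n. approximable E (topspace X) (A n)" "\<And>n. A n \<in> borel_measurable (borel_of X)"
      "\<And>n x. x \<in> topspace X \<Longrightarrow> 0 \<le> A n x" "\<And>n x. x \<in> topspace X \<Longrightarrow> A n x \<le> G x"
      "\<And>x. x \<in> topspace X \<Longrightarrow> (\<lambda>n. A n x) \<longlonglongrightarrow> G x"
      by blast+
    have GB: "\<bar>G x\<bar> \<le> B" if "x \<in> topspace X" for x using G(2,3)[OF that] by simp
    have AB: "\<bar>A n x\<bar> \<le> B" if "x \<in> topspace X" for n x using A(3,4)[OF that, of n] G(3)[OF that] by simp
    have Gm: "G \<in> borel_measurable (borel_of X)" by (rule continuous_map_borel_of[OF G(1)])
    have sp: "\<zeta> \<omega> \<in> topspace X" if "\<omega> \<in> space N" for \<omega>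
      using measurable_space[OF \<zeta> that] by (simp add: space_borel_of)
    interpret N: prob_space N by fact
    have "(\<lambda>n. \<integral>\<omega>. A n (\<zeta> \<omega>) \<partial>N) \<longlonglongrightarrow> (\<integral>\<omega>. G (\<zeta> \<omega>) \<partial>N)"
    proof (rule integral_dominated_convergence[where w="\<lambda>_. B"])
      show "(\<lambda>\<omega>. G (\<zeta> \<omega>)) \<in> borel_measurable N" "\<And>n. (\<lambda>\<omega>. A n (\<zeta> \<omega>)) \<in> borel_measurable N"
        by (auto intro: measurable_compose[OF \<zeta>] Gm A(2))
    qed (use A AB sp in \<open>auto intro!: AE_I2\<close>)
    then have "\<forall>\<^sub>F n in sequentially. (\<integral>\<omega>. A n (\<zeta> \<omega>) \<partial>N) > (\<integral>\<omega>. G (\<zeta> \<omega>) \<partial>N) - r"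
      using r by (intro order_tendstoD) auto
    then obtain n where n: "(\<integral>\<omega>. A n (\<zeta> \<omega>) \<partial>N) > (\<integral>\<omega>. G (\<zeta> \<omega>) \<partial>N) - r"
      by (auto simp: eventually_sequentially)
    have "((\<lambda>i. \<integral>\<omega>. A n (\<xi> i \<omega>) \<partial>M) \<longlongrightarrow> (\<integral>\<omega>. A n (\<zeta> \<omega>) \<partial>N)) F"
      by (rule tendsto_integral_approximable[OF M N E_meas bdd \<xi>_meas \<zeta> lim A(1) A(2)]) auto
    then have "\<forall>\<^sub>F i in F. (\<integral>\<omega>. A n (\<xi> i \<omega>) \<partial>M) > (\<integral>\<omega>. G (\<zeta> \<omega>) \<partial>N) - r"
      using n by (rule order_tendstoD)
    with \<xi>_meas show ?thesis
    proof eventually_elim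
      case (elim i)
      have "(\<integral>\<omega>. A n (\<xi> i \<omega>) \<partial>M) \<le> (\<integral>\<omega>. G (\<xi> i \<omega>) \<partial>M)"
        using int[OF A(2) AB elim(1) M] int[OF Gm GB elim(1) M] A(4) measurable_space[OF elim(1)]
        by (intro integral_mono) (auto simp: space_borel_of)
      with elim show ?case by simp
    qed
  qed
  have conv: "((\<lambda>i. \<integral>\<omega>. g (\<xi> i \<omega>) \<partial>M) \<longlongrightarrow> (\<integral>\<omega>. g (\<zeta> \<omega>) \<partial>N)) F"
    if g: "continuous_map X euclideanreal g" "bounded (g ` topspace X)" for g
  proof -
    obtain B where B: "\<And>x. x \<in> topspace X \<Longrightarrow> \<bar>g x\<bar> \<le> B"
      using g(2) by (auto simp: bounded_iff)
    have gm: "g \<in> borel_measurable (borel_of X)" by (rule continuous_map_borel_of[OF g(1)])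
    interpret M: prob_space M by fact
    interpret N: prob_space N by fact
    have gB: "0 \<le> B + g x" "B + g x \<le> 2 * B" "0 \<le> B - g x" "B - g x \<le> 2 * B" if "x \<in> topspace X" for x
      using B[OF that] by linarith+
    have gc: "continuous_map X euclideanreal (\<lambda>x. B + g x)" "continuous_map X euclideanreal (\<lambda>x. B - g x)"
      by (intro continuous_intros g(1))+
    show ?thesis
    proof (rule tendstoI)
      fix r :: real assume r: "r > 0"
      have "\<forall>\<^sub>F i in F. (\<integral>\<omega>. B + g (\<xi> i \<omega>) \<partial>M) > (\<integral>\<omega>. B + g (\<zeta> \<omega>) \<partial>N) - r"
        by (rule lower[OF gc(1) gB(1,2) r])
      moreover have "\<forall>\<^sub>F i in F. (\<integral>\<omega>. B - g (\<xi> i \<omega>) \<partial>M) > (\<integral>\<omega>. B - g (\<zeta> \<omega>) \<partial>N) - r"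
        by (rule lower[OF gc(2) gB(3,4) r])
      ultimately show "\<forall>\<^sub>F i in F. dist (\<integral>\<omega>. g (\<xi> i \<omega>) \<partial>M) (\<integral>\<omega>. g (\<zeta> \<omega>) \<partial>N) < r"
        using \<xi>_meas
      proof eventually_elim
        case (elim i)
        have "integrable M (\<lambda>\<omega>. g (\<xi> i \<omega>))" "integrable N (\<lambda>\<omega>. g (\<zeta> \<omega>))"
          using int[OF gm B elim(3) M] int[OF gm B \<zeta> N] by auto
        then have "(\<integral>\<omega>. B + g (\<xi> i \<omega>) \<partial>M) = B + (\<integral>\<omega>. g (\<xi> i \<omega>) \<partial>M)"
          "(\<integral>\<omega>. B - g (\<xi> i \<omega>) \<partial>M) = B - (\<integral>\<omega>. g (\<xi> i \<omega>) \<partial>M)"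
          "(\<integral>\<omega>. B + g (\<zeta> \<omega>) \<partial>N) = B + (\<integral>\<omega>. g (\<zeta> \<omega>) \<partial>N)"
          "(\<integral>\<omega>. B - g (\<zeta> \<omega>) \<partial>N) = B - (\<integral>\<omega>. g (\<zeta> \<omega>) \<partial>N)"
          by (simp_all add: M.prob_space N.prob_space)
        with elim(1,2) show ?case unfolding dist_real_def by linarith
      qed
    qed
  qed
  show ?thesis unfolding converges_in_distribution_def using \<xi>_meas \<zeta> conv by blast
qed

section \<open>The vague topology\<close>

lemma space_lf: "\<mu> \<in> lf_measures \<Longrightarrow> space \<mu> = {0<..}"
  unfolding lf_measures_def using sets_eq_imp_space_eq[of \<mu> pos_borel] by (auto simp: space_restrict_space)

lemma sets_lf: "\<mu> \<in> lf_measures \<Longrightarrow> sets \<mu> = sets pos_borel"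
  by (simp add: lf_measures_def)

lemma measurable_lf: "\<mu> \<in> lf_measures \<Longrightarrow> borel_measurable \<mu> = borel_measurable pos_borel"
  by (intro measurable_cong_sets sets_lf refl)

lemma vague_test_measurable: "f \<in> vague_test \<Longrightarrow> f \<in> borel_measurable pos_borel"
  unfolding vague_test_def by (auto intro: borel_measurable_continuous_on_restrict)

lemma compact_pos_subset_interval:
  assumes "compact K" "K \<subseteq> {0<..}"
  obtains a b :: real where "0 < a" "a \<le> b" "K \<subseteq> {a..b}"
proof (cases "K = {}")
  case True then show thesis using that[of 1 1] by auto
next
  case False
  obtain a where a: "a \<in> K" "\<forall>x\<in>K. a \<le> x" using compact_attains_inf[OF assms(1) False] by blast
  obtain b where b: "b \<in> K" "\<forall>x\<in>K. x \<le> b" using compact_attains_sup[OF assms(1) False] by blast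
  show thesis by (rule that[of a b]) (use a b assms(2) in auto)
qed

lemma compact_pos_sets: "compact K \<Longrightarrow> K \<subseteq> {0<..} \<Longrightarrow> K \<in> sets pos_borel"
  by (auto simp: sets_restrict_space_iff compact_imp_closed)

lemma vague_test_integrable:
  assumes f: "f \<in> vague_test" and \<mu>: "\<mu> \<in> lf_measures"
  shows "integrable \<mu> f"
proof -
  obtain K where K: "compact K" "K \<subseteq> {0<..}" "\<And>x. x > 0 \<Longrightarrow> x \<notin> K \<Longrightarrow> f x = 0"
    using f by (auto simp: vague_test_def)
  obtain B where B: "\<And>x. x > 0 \<Longrightarrow> \<bar>f x\<bar> \<le> B"
  proof -
    obtain B where "\<forall>y\<in>f ` {0<..}. norm y \<le> B" using f by (auto simp: vague_test_def bounded_iff)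
    then show ?thesis using that[of B] by auto
  qed
  show ?thesis
  proof (rule integrableI_bounded_set[of K])
    show "K \<in> sets \<mu>" using compact_pos_sets[OF K(1,2)] sets_lf[OF \<mu>] by simp
    show "f \<in> borel_measurable \<mu>" unfolding measurable_lf[OF \<mu>] by (rule vague_test_measurable[OF f])
    show "emeasure \<mu> K < \<infinity>" using \<mu> K by (auto simp: lf_measures_def)
    show "AE x in \<mu>. x \<in> K \<longrightarrow> norm (f x) \<le> B" "AE x in \<mu>. x \<notin> K \<longrightarrow> f x = 0"
      using B K(3) by (auto intro!: AE_I2 simp: space_lf[OF \<mu>])
  qed
qed

lemma vague_test_add:
  assumes "f \<in> vague_test" "g \<in> vague_test"
  shows "(\<lambda>x. f x + g x) \<in> vague_test"
proof -
  obtain K L where K: "compact K" "K \<subseteq> {0<..}" "\<And>x. x > 0 \<Longrightarrow> x \<notin> K \<Longrightarrow> f x = 0"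
    and L: "compact L" "L \<subseteq> {0<..}" "\<And>x. x > 0 \<Longrightarrow> x \<notin> L \<Longrightarrow> g x = 0"
    using assms by (auto simp: vague_test_def)
  have "compact (K \<union> L)" "K \<union> L \<subseteq> {0<..}" "\<And>x. x > 0 \<Longrightarrow> x \<notin> K \<union> L \<Longrightarrow> f x + g x = 0"
    using K L by auto
  then show ?thesis using assms unfolding vague_test_def
    by (auto intro!: continuous_intros bounded_plus_comp exI[of _ "K \<union> L"])
qed

lemma vague_testI:
  assumes "continuous_on {0<..} f" "\<And>x. 0 \<le> f x" "0 < a" "\<And>x. x \<notin> {a..b} \<Longrightarrow> f x = 0"
  shows "f \<in> vague_test"
proof -
  have "f ` {0<..} \<subseteq> f ` {a..b} \<union> {0}" using assms(4) by blast
  moreover have "bounded (f ` {a..b})"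
    using assms(1,3) by (intro compact_imp_bounded compact_continuous_image) (auto intro: continuous_on_subset)
  ultimately have "bounded (f ` {0<..})" by (meson bounded_Un bounded_insert bounded_empty bounded_subset)
  then show ?thesis using assms unfolding vague_test_def by (auto intro!: exI[of _ "{a..b}"])
qed

text \<open>A test function only matters on the positive half line.  Extended by \<open>0\<close> it is continuous on the
  whole line, since it vanishes near \<open>0\<close>.\<close>

lemma vague_testE:
  assumes f: "f \<in> vague_test"
  obtains F :: "real \<Rightarrow> real" and a b where "continuous_on UNIV F" "\<And>x. 0 \<le> F x" "0 < a" "a \<le> b"
    "\<And>x. x \<notin> {a..b} \<Longrightarrow> F x = 0" "\<And>x. 0 < x \<Longrightarrow> F x = f x"
proof -
  obtain K where K: "compact K" "K \<subseteq> {0<..}" "\<And>x. x > 0 \<Longrightarrow> x \<notin> K \<Longrightarrow> f x = 0"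
    using f by (auto simp: vague_test_def)
  obtain a b where ab: "0 < a" "a \<le> b" "K \<subseteq> {a..b}" using compact_pos_subset_interval[OF K(1,2)] .
  define F where "F x = (if 0 < x then f x else 0)" for x
  have F0: "F x = 0" if "x < a" for x
  proof -
    have "x \<notin> K" using ab(3) that by auto
    then show ?thesis using K(3) by (simp add: F_def)
  qed
  have "continuous_on ({0<..} \<union> {..<a}) F"
  proof (rule continuous_on_open_Un)
    have "continuous_on {0<..} f" using f by (simp add: vague_test_def)
    then show "continuous_on {0<..} F" by (rule continuous_on_eq) (simp add: F_def)
    show "continuous_on {..<a} F" by (rule continuous_on_eq[of _ "\<lambda>_. 0"]) (auto simp: F0)
  qed auto
  moreover have "{0<..} \<union> {..<a} = UNIV" using ab by auto
  ultimately have "continuous_on UNIV F" by simp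
  then show thesis
    by (rule that[of F a b]) (use f ab K(3) in \<open>force simp: F_def vague_test_def\<close>)+
qed

text \<open>Hat functions on the grid of mesh \<open>1 / n\<close>.  For \<open>i \<ge> 2\<close> their support is a compact subset of
  the open half line, and they form a partition of unity away from \<open>0\<close>.\<close>

definition tent :: "nat \<Rightarrow> nat \<Rightarrow> real \<Rightarrow> real" where
  "tent n i x = max 0 (1 - \<bar>real n * x - real i\<bar>)"

lemma tent_nonneg: "0 \<le> tent n i x"
  by (simp add: tent_def)

lemma tent_eq_0: "1 \<le> \<bar>real n * x - real i\<bar> \<Longrightarrow> tent n i x = 0"
  by (simp add: tent_def)

lemma tent_vague_test:
  assumes "0 < n" "2 \<le> i"
  shows "tent n i \<in> vague_test"
proof (rule vague_testI)
  show "continuous_on {0<..} (tent n i)" unfolding tent_def by (intro continuous_intros)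
  show "0 < 1 / real n" using assms by simp
  fix x assume "x \<notin> {1 / real n .. (real i + 1) / real n}"
  then have "real n * x < 1 \<or> real n * x > real i + 1" using assms by (auto simp: field_simps)
  then show "tent n i x = 0" using assms by (intro tent_eq_0) auto
qed (rule tent_nonneg)

lemma sum_tent:
  assumes "2 \<le> real n * x" "real n * x \<le> real I"
  shows "(\<Sum>i\<in>{2..I}. tent n i x) = 1"
proof -
  define j where "j = nat \<lfloor>real n * x\<rfloor>"
  have j: "real j \<le> real n * x" "real n * x < real j + 1" "2 \<le> j"
    using assms by (auto simp: j_def) (linarith+)
  have jI: "j \<le> I" using j assms by linarith
  have 0: "tent n i x = 0" if "i \<noteq> j" "i \<noteq> Suc j" for i
  proof (rule tent_eq_0)
    from that have "real i + 1 \<le> real j \<or> real j + 2 \<le> real i" by linarith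
    then show "1 \<le> \<bar>real n * x - real i\<bar>" using j by linarith
  qed
  show ?thesis
  proof (cases "j = I")
    case True
    then have "real n * x = real j" using j assms by linarith
    moreover have "(\<Sum>i\<in>{2..I}. tent n i x) = (\<Sum>i\<in>{j}. tent n i x)"
      using True j by (intro sum.mono_neutral_right) (auto intro!: 0)
    ultimately show ?thesis by (simp add: tent_def)
  next
    case False
    then have "(\<Sum>i\<in>{2..I}. tent n i x) = (\<Sum>i\<in>{j, Suc j}. tent n i x)"
      using jI j by (intro sum.mono_neutral_right) (auto intro!: 0)
    also have "\<dots> = tent n j x + tent n (Suc j) x" by simp
    also have "\<dots> = 1" using j by (auto simp: tent_def max_def)
    finally show ?thesis .
  qed
qed

text \<open>Piecewise linear interpolation.  The error is measured against a fixed finite sum of tents instead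
  of a constant, so that the bound remains useful after integration against measures of infinite mass.\<close>

lemma tent_approximation:
  assumes f: "f \<in> vague_test"
  obtains n0 I0 where "0 < n0"
    "\<And>\<delta>. \<delta> > 0 \<Longrightarrow> \<exists>n I a. 0 < n \<and> (\<forall>x>0. \<bar>f x - (\<Sum>i\<in>{2..I}. a i * tent n i x)\<bar> \<le> \<delta> * (\<Sum>i\<in>{2..I0}. tent n0 i x))"
proof -
  obtain F :: "real \<Rightarrow> real" and a b where F: "continuous_on UNIV F" "\<And>x. 0 \<le> F x" and ab: "0 < a" "a \<le> b"
    and F0: "\<And>x. x \<notin> {a..b} \<Longrightarrow> F x = 0" and Ff: "\<And>x. 0 < x \<Longrightarrow> F x = f x"
    by (rule vague_testE[OF f]) (erule that; blast)
  have level: "\<exists>n I. r < real n \<and> 0 < n \<and> (\<forall>x\<in>{a/2..b+1}. (\<Sum>i\<in>{2..I}. tent n i x) = 1)" for r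
  proof -
    obtain n where n: "max (max 0 r) (4 / a) < real n" using reals_Archimedean2 by blast
    obtain I where I: "real n * (b + 1) < real I" using reals_Archimedean2 by blast
    have "(\<Sum>i\<in>{2..I}. tent n i x) = 1" if x: "x \<in> {a/2..b+1}" for x
    proof (rule sum_tent)
      have "real n * (a / 2) \<le> real n * x" using x by (intro mult_left_mono) auto
      moreover have "4 < real n * a" using n ab by (simp add: field_simps)
      ultimately show "2 \<le> real n * x" by simp
      have "real n * x \<le> real n * (b + 1)" using x by (intro mult_left_mono) auto
      then show "real n * x \<le> real I" using I by simp
    qed
    then show ?thesis using n by (intro exI[of _ n] exI[of _ I]) auto
  qed
  obtain n0 I0 where n0: "0 < n0" "\<And>x. x \<in> {a/2..b+1} \<Longrightarrow> (\<Sum>i\<in>{2..I0}. tent n0 i x) = 1"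
    using level by blast
  show thesis
  proof (rule that[of n0 I0], fact)
    fix \<delta> :: real assume \<delta>: "\<delta> > 0"
    have "uniformly_continuous_on {0..b+2} F"
      using F(1) by (intro compact_uniformly_continuous) (auto intro: continuous_on_subset)
    then obtain d where d: "d > 0" "\<And>x y. x \<in> {0..b+2} \<Longrightarrow> y \<in> {0..b+2} \<Longrightarrow> \<bar>y - x\<bar> < d \<Longrightarrow> \<bar>F y - F x\<bar> < \<delta>"
      using \<delta> unfolding uniformly_continuous_on_def dist_real_def by meson
    obtain n I where n: "max (max 1 (1/d)) (2 / a) < real n" "0 < n"
      and one: "\<And>x. x \<in> {a/2..b+1} \<Longrightarrow> (\<Sum>i\<in>{2..I}. tent n i x) = 1" using level by blast
    have n1: "1 / real n < d" "1 / real n < 1" "1 / real n < a / 2"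
      using n d ab by (auto simp: field_simps)
    have supp: "\<bar>x - real i / real n\<bar> < 1 / real n" if "tent n i x \<noteq> 0" for i x
    proof -
      have "\<bar>real n * x - real i\<bar> < 1" using that tent_eq_0 by (meson not_less)
      moreover have "real n * x - real i = real n * (x - real i / real n)" using n by (simp add: field_simps)
      ultimately show ?thesis using n by (simp add: abs_mult field_simps)
    qed
    have "\<bar>f x - (\<Sum>i\<in>{2..I}. F (real i / real n) * tent n i x)\<bar> \<le> \<delta> * (\<Sum>i\<in>{2..I0}. tent n0 i x)"
      if x: "x > 0" for x
    \<comment> \<open>On \<open>[a / 2, b + 1]\<close> both sums of tents are \<open>1\<close>; elsewhere \<open>f\<close> and its interpolation vanish, since
      the mesh is smaller than \<open>a / 2\<close> and than \<open>1\<close>.\<close>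
    proof (cases "x \<in> {a/2..b+1}")
      case True
      have "F x - (\<Sum>i\<in>{2..I}. F (real i / real n) * tent n i x)
          = (\<Sum>i\<in>{2..I}. (F x - F (real i / real n)) * tent n i x)"
        using one[OF True] by (simp add: left_diff_distrib sum_subtractf flip: sum_distrib_left)
      also have "\<bar>\<dots>\<bar> \<le> (\<Sum>i\<in>{2..I}. \<bar>(F x - F (real i / real n)) * tent n i x\<bar>)" by (rule sum_abs)
      also have "\<dots> \<le> (\<Sum>i\<in>{2..I}. \<delta> * tent n i x)"
      proof (rule sum_mono)
        fix i
        show "\<bar>(F x - F (real i / real n)) * tent n i x\<bar> \<le> \<delta> * tent n i x"
        proof (cases "tent n i x = 0")
          case False
          have "\<bar>F x - F (real i / real n)\<bar> < \<delta>"
            using supp[OF False] n1 True x by (intro d(2)) auto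
          then show ?thesis by (simp add: abs_mult tent_nonneg mult_right_mono)
        qed simp
      qed
      also have "\<dots> = \<delta>" using one[OF True] by (simp flip: sum_distrib_left)
      finally show ?thesis using n0(2)[OF True] Ff[OF x] by simp
    next
      case False
      have "F (real i / real n) * tent n i x = 0" for i
      proof (cases "tent n i x = 0")
        case nz: False
        have "real i / real n \<notin> {a..b}" using supp[OF nz] n1(2,3) False by (auto simp: abs_less_iff)
        then show ?thesis using F0 by simp
      qed simp
      then have "(\<Sum>i\<in>{2..I}. F (real i / real n) * tent n i x) = 0" by (intro sum.neutral) blast
      moreover have "f x = 0" using False F0[of x] Ff[OF x] ab by auto
      moreover have "0 \<le> (\<Sum>i\<in>{2..I0}. tent n0 i x)" by (intro sum_nonneg tent_nonneg)
      ultimately show ?thesis using \<delta> by simp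
    qed
    then show "\<exists>n I a. 0 < n \<and> (\<forall>x>0. \<bar>f x - (\<Sum>i\<in>{2..I}. a i * tent n i x)\<bar> \<le> \<delta> * (\<Sum>i\<in>{2..I0}. tent n0 i x))"
      using n(2) by (intro exI[of _ n] exI[of _ I] exI[of _ "\<lambda>i. F (real i / real n)"]) auto
  qed
qed

text \<open>The integrals of the dominating sum of tents converge as well, hence are bounded, and this
  controls the interpolation error uniformly along the sequence.\<close>

lemma tents_determine_vague_limits:
  assumes f: "f \<in> vague_test" and \<mu>: "\<mu> \<in> lf_measures" and \<nu>: "\<And>k::nat. \<nu> k \<in> lf_measures"
    and lim: "\<And>n i. 0 < n \<Longrightarrow> 2 \<le> i \<Longrightarrow> (\<lambda>k. \<integral>x. tent n i x \<partial>\<nu> k) \<longlonglongrightarrow> (\<integral>x. tent n i x \<partial>\<mu>)"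
  shows "(\<lambda>k. \<integral>x. f x \<partial>\<nu> k) \<longlonglongrightarrow> (\<integral>x. f x \<partial>\<mu>)"
proof (rule tendstoI)
  fix r :: real assume r: "r > 0"
  obtain n0 I0 where n0: "0 < n0" and app:
    "\<And>\<delta>. \<delta> > 0 \<Longrightarrow> \<exists>n I a. 0 < n \<and> (\<forall>x>0. \<bar>f x - (\<Sum>i\<in>{2..I}. a i * tent n i x)\<bar> \<le> \<delta> * (\<Sum>i\<in>{2..I0}. tent n0 i x))"
    by (rule tent_approximation[OF f]) (erule that; blast)
  define h where "h x = (\<Sum>i\<in>{2..I0}. tent n0 i x)" for x
  have lin: "integrable m (\<lambda>x. \<Sum>i\<in>{2..I}. a i * tent n i x)"
      "(\<integral>x. (\<Sum>i\<in>{2..I}. a i * tent n i x) \<partial>m) = (\<Sum>i\<in>{2..I}. a i * (\<integral>x. tent n i x \<partial>m))"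
    if "0 < n" "m \<in> lf_measures" for n a I m
    using that by (auto intro!: Bochner_Integration.integrable_sum simp: vague_test_integrable tent_vague_test)
  have h: "integrable m h" if "m \<in> lf_measures" for m
    using lin(1)[OF n0 that, where a="\<lambda>_. 1"] by (simp add: h_def[abs_def])
  have hlim: "(\<lambda>k. \<integral>x. h x \<partial>\<nu> k) \<longlonglongrightarrow> (\<integral>x. h x \<partial>\<mu>)"
    using lin(2)[OF n0 \<mu>, where a="\<lambda>_. 1"] lin(2)[OF n0 \<nu>, where a="\<lambda>_. 1"] n0
    by (auto simp: h_def intro!: tendsto_sum lim)
  have h0: "0 \<le> (\<integral>x. h x \<partial>\<mu>)" by (rule integral_nonneg_AE) (auto simp: h_def intro!: sum_nonneg tent_nonneg)
  define C where "C = (\<integral>x. h x \<partial>\<mu>) + 1"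
  have C: "C > 0" using h0 by (simp add: C_def)
  have "r / (4 * C) > 0" using r C by simp
  then obtain n I a where n: "0 < n" and na: "\<And>x. x > 0 \<Longrightarrow> \<bar>f x - (\<Sum>i\<in>{2..I}. a i * tent n i x)\<bar> \<le> r / (4 * C) * h x"
    using app[of "r / (4 * C)"] unfolding h_def by blast
  define g where "g x = (\<Sum>i\<in>{2..I}. a i * tent n i x)" for x
  have g: "integrable m g" if "m \<in> lf_measures" for m
    using lin(1)[OF n that] by (simp add: g_def[abs_def])
  have glim: "(\<lambda>k. \<integral>x. g x \<partial>\<nu> k) \<longlonglongrightarrow> (\<integral>x. g x \<partial>\<mu>)"
    using lin(2)[OF n \<mu>] lin(2)[OF n \<nu>] n by (auto simp: g_def intro!: tendsto_sum tendsto_mult_left lim)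
  have near: "\<bar>(\<integral>x. f x \<partial>m) - (\<integral>x. g x \<partial>m)\<bar> \<le> r / 4"
    if m: "m \<in> lf_measures" "(\<integral>x. h x \<partial>m) \<le> C" for m
  proof -
    note i = vague_test_integrable[OF f m(1)] g[OF m(1)] h[OF m(1)]
    have "\<bar>(\<integral>x. f x \<partial>m) - (\<integral>x. g x \<partial>m)\<bar> = \<bar>\<integral>x. f x - g x \<partial>m\<bar>" using i by simp
    also have "\<dots> \<le> (\<integral>x. \<bar>f x - g x\<bar> \<partial>m)" by (rule integral_abs_bound)
    also have "\<dots> \<le> (\<integral>x. r / (4 * C) * h x \<partial>m)"
    proof (rule integral_mono)
      show "integrable m (\<lambda>x. \<bar>f x - g x\<bar>)" "integrable m (\<lambda>x. r / (4 * C) * h x)" using i by auto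
      show "\<bar>f x - g x\<bar> \<le> r / (4 * C) * h x" if "x \<in> space m" for x
        using na[of x] that by (simp add: space_lf[OF m(1)] g_def)
    qed
    also have "\<dots> = r / (4 * C) * (\<integral>x. h x \<partial>m)" by simp
    also have "\<dots> \<le> r / (4 * C) * C" using m(2) r C by (intro mult_left_mono) auto
    finally show ?thesis using C by simp
  qed
  have "\<forall>\<^sub>F k in sequentially. (\<integral>x. h x \<partial>\<nu> k) < C" using hlim by (rule order_tendstoD) (simp add: C_def)
  moreover have "\<forall>\<^sub>F k in sequentially. dist (\<integral>x. g x \<partial>\<nu> k) (\<integral>x. g x \<partial>\<mu>) < r / 4"
    using glim r by (intro tendstoD) auto
  ultimately show "\<forall>\<^sub>F k in sequentially. dist (\<integral>x. f x \<partial>\<nu> k) (\<integral>x. f x \<partial>\<mu>) < r"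
  proof eventually_elim
    case (elim k)
    have "(\<integral>x. h x \<partial>\<mu>) \<le> C" by (simp add: C_def)
    from near[OF \<mu> this] near[OF \<nu> less_imp_le[OF elim(1)]] elim(2) r show ?case
      unfolding dist_real_def by linarith
  qed
qed

text \<open>The exponential makes the coordinates bounded, so that they can serve as test functions themselves.  The
  shifts avoid mesh \<open>1 / 0\<close> and the tents whose support reaches \<open>0\<close>.\<close>

definition tent_coord :: "nat \<Rightarrow> real measure \<Rightarrow> real" where
  "tent_coord k \<mu> = (case prod_decode k of (n, i) \<Rightarrow> exp (- (\<integral>x. tent (Suc n) (i + 2) x \<partial>\<mu>)))"

lemma topspace_vague_topology: "topspace vague_topology = lf_measures"
proof -
  have "(\<lambda>_. 0) \<in> vague_test" by (rule vague_testI[of _ 1 1]) auto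
  then have "{\<mu>\<in>lf_measures. (\<integral>x. (\<lambda>_. 0) x \<partial>\<mu>) \<in> UNIV} \<in> {{\<mu>\<in>lf_measures. (\<integral>x. f x \<partial>\<mu>) \<in> U} | f U. f \<in> vague_test \<and> open U}"
    by blast
  then show ?thesis unfolding vague_topology_def topology_generated_by_topspace by blast
qed

lemma continuous_map_vague_integral:
  assumes "f \<in> vague_test"
  shows "continuous_map vague_topology euclideanreal (\<lambda>\<mu>. \<integral>x. f x \<partial>\<mu>)"
proof -
  have "openin vague_topology {\<mu>\<in>lf_measures. (\<integral>x. f x \<partial>\<mu>) \<in> U}" if "open U" for U
    unfolding vague_topology_def using assms that by (intro topology_generated_by_Basis) blast
  then show ?thesis by (simp add: continuous_map_def topspace_vague_topology)
qed

text \<open>The vague topology has a countable system of coordinates.  For a subbasic set this is shown by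
  contradiction: otherwise there is a sequence outside the set all of whose coordinates converge to those
  of \<open>\<mu>\<close>, and then the integrals of every test function converge.\<close>

lemma generates_vague_topology: "generates_topology vague_topology tent_coord"
  unfolding generates_topology_def topspace_vague_topology
proof (intro allI impI)
  fix U assume "openin vague_topology U"
  then have "generate_topology_on {{\<mu>\<in>lf_measures. (\<integral>x. f x \<partial>\<mu>) \<in> U} | f U. f \<in> vague_test \<and> open U} U"
    unfolding vague_topology_def by (rule openin_topology_generated_by)
  then show "\<forall>\<mu>\<in>U. \<exists>n. \<exists>\<delta>>0. \<forall>\<nu>\<in>lf_measures. (\<forall>k<n. \<bar>tent_coord k \<nu> - tent_coord k \<mu>\<bar> < \<delta>) \<longrightarrow> \<nu> \<in> U"
  proof induction
    case Empty then show ?case by simp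
  next
    case (Int a b)
    show ?case
    proof
      fix \<mu> assume "\<mu> \<in> a \<inter> b"
      then obtain n \<delta> m \<gamma> where "\<delta> > 0" "\<forall>\<nu>\<in>lf_measures. (\<forall>k<n. \<bar>tent_coord k \<nu> - tent_coord k \<mu>\<bar> < \<delta>) \<longrightarrow> \<nu> \<in> a"
        "\<gamma> > 0" "\<forall>\<nu>\<in>lf_measures. (\<forall>k<m. \<bar>tent_coord k \<nu> - tent_coord k \<mu>\<bar> < \<gamma>) \<longrightarrow> \<nu> \<in> b"
        using Int.IH by blast
      then show "\<exists>n. \<exists>\<delta>>0. \<forall>\<nu>\<in>lf_measures. (\<forall>k<n. \<bar>tent_coord k \<nu> - tent_coord k \<mu>\<bar> < \<delta>) \<longrightarrow> \<nu> \<in> a \<inter> b"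
        by (intro exI[of _ "max n m"] exI[of _ "min \<delta> \<gamma>"]) auto
    qed
  next
    case (UN K)
    show ?case
    proof
      fix \<mu> assume "\<mu> \<in> \<Union>K"
      then obtain k where k: "k \<in> K" "\<mu> \<in> k" by blast
      from UN.IH[OF k(1)] k(2) obtain n \<delta> where "\<delta> > 0"
        "\<forall>\<nu>\<in>lf_measures. (\<forall>j<n. \<bar>tent_coord j \<nu> - tent_coord j \<mu>\<bar> < \<delta>) \<longrightarrow> \<nu> \<in> k" by blast
      then show "\<exists>n. \<exists>\<delta>>0. \<forall>\<nu>\<in>lf_measures. (\<forall>k<n. \<bar>tent_coord k \<nu> - tent_coord k \<mu>\<bar> < \<delta>) \<longrightarrow> \<nu> \<in> \<Union>K"
        using k(1) by (intro exI[of _ n] exI[of _ \<delta>]) blast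
    qed
  next
    case (Basis s)
    then obtain f V where f: "f \<in> vague_test" and V: "open V" and s: "s = {\<mu>\<in>lf_measures. (\<integral>x. f x \<partial>\<mu>) \<in> V}" by blast
    show ?case
    proof (rule ballI, rule ccontr)
      fix \<mu> assume \<mu>: "\<mu> \<in> s" and no: "\<not> (\<exists>n. \<exists>\<delta>>0. \<forall>\<nu>\<in>lf_measures. (\<forall>k<n. \<bar>tent_coord k \<nu> - tent_coord k \<mu>\<bar> < \<delta>) \<longrightarrow> \<nu> \<in> s)"
      have "\<exists>\<nu>\<in>lf_measures. (\<forall>k<n. \<bar>tent_coord k \<nu> - tent_coord k \<mu>\<bar> < 1 / real (Suc n)) \<and> \<nu> \<notin> s" for n
      proof -
        have "1 / real (Suc n) > 0" by simp
        with no show ?thesis by blast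
      qed
      then obtain \<nu> where \<nu>: "\<And>n. \<nu> n \<in> lf_measures" "\<And>n k. k < n \<Longrightarrow> \<bar>tent_coord k (\<nu> n) - tent_coord k \<mu>\<bar> < 1 / real (Suc n)"
        "\<And>n. \<nu> n \<notin> s" by metis
      have coord: "(\<lambda>n. tent_coord k (\<nu> n)) \<longlonglongrightarrow> tent_coord k \<mu>" for k
      proof (rule Lim_transform_bound[of _ "\<lambda>n. 1 / real (Suc n)", THEN LIM_zero_cancel])
        show "\<forall>\<^sub>F n in sequentially. norm (tent_coord k (\<nu> n) - tent_coord k \<mu>) \<le> norm (1 / real (Suc n))"
          using eventually_gt_at_top[of k] by eventually_elim (use \<nu>(2) in \<open>force intro: less_imp_le\<close>)
        show "(\<lambda>n. 1 / real (Suc n)) \<longlonglongrightarrow> 0" by (rule LIMSEQ_Suc[OF lim_1_over_n])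
      qed
      have "(\<lambda>k. \<integral>x. f x \<partial>\<nu> k) \<longlonglongrightarrow> (\<integral>x. f x \<partial>\<mu>)"
      proof (rule tents_determine_vague_limits[OF f _ \<nu>(1)])
        show "\<mu> \<in> lf_measures" using \<mu> s by simp
        fix n i :: nat assume n: "0 < n" "2 \<le> i"
        define k where "k = prod_encode (n - 1, i - 2)"
        have "Suc (n - 1) = n" "i - 2 + 2 = i" using n by auto
        then have k: "tent_coord k m = exp (- (\<integral>x. tent n i x \<partial>m))" for m
          by (simp only: tent_coord_def k_def prod_encode_inverse prod.case)
        have "(\<lambda>k'. - ln (tent_coord k (\<nu> k'))) \<longlonglongrightarrow> - ln (tent_coord k \<mu>)"
          using coord[of k] by (intro tendsto_intros) (auto simp: k)
        then show "(\<lambda>k. \<integral>x. tent n i x \<partial>\<nu> k) \<longlonglongrightarrow> (\<integral>x. tent n i x \<partial>\<mu>)" by (simp add: k)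
      qed
      then have "\<forall>\<^sub>F k in sequentially. (\<integral>x. f x \<partial>\<nu> k) \<in> V"
        using V \<mu> s by (intro topological_tendstoD) auto
      then show False using \<nu>(1,3) s by (auto simp: eventually_sequentially)
    qed
  qed
qed

text \<open>The exponentials \<open>exp (- \<integral> f d\<mu>)\<close> are closed under products because test functions are closed
  under sums, and they contain the coordinates that generate the topology.\<close>

theorem vague_convergence_by_Laplace_functionals:
  assumes M: "prob_space M" and N: "prob_space N"
    and \<xi>: "\<forall>\<^sub>F i in F. (\<forall>\<omega>\<in>space M. \<xi> i \<omega> \<in> lf_measures) \<and>
      (\<forall>f\<in>vague_test. (\<lambda>\<omega>. \<integral>x. f x \<partial>\<xi> i \<omega>) \<in> borel_measurable M)"
    and \<zeta>: "\<zeta> \<in> N \<rightarrow>\<^sub>M borel_of vague_topology"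
    and lim: "\<And>f. f \<in> vague_test \<Longrightarrow>
      ((\<lambda>i. \<integral>\<omega>. exp (- (\<integral>x. f x \<partial>\<xi> i \<omega>)) \<partial>M) \<longlongrightarrow> (\<integral>\<omega>. exp (- (\<integral>x. f x \<partial>\<zeta> \<omega>)) \<partial>N)) F"
  shows "converges_in_distribution vague_topology M \<xi> N \<zeta> F"
proof -
  define E :: "(real measure \<Rightarrow> real) set" where
    "E = {A. \<exists>f\<in>vague_test. \<forall>\<mu>\<in>lf_measures. A \<mu> = exp (- (\<integral>x. f x \<partial>\<mu>))}"
  have \<zeta>lf: "\<zeta> \<omega> \<in> lf_measures" if "\<omega> \<in> space N" for \<omega>
    using measurable_space[OF \<zeta> that] by (simp add: space_borel_of topspace_vague_topology)
  show ?thesis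
  proof (rule converges_in_distribution_by_test_functions[OF M N _ _ _ _ generates_vague_topology _ \<zeta>])
    show "mult_closed E"
      unfolding mult_closed_def
    proof (intro conjI ballI)
      show "(\<lambda>_. 1) \<in> E" unfolding E_def
        by (auto intro!: bexI[of _ "\<lambda>_. 0"] vague_testI[of _ 1 1])
      fix A B assume "A \<in> E" "B \<in> E"
      then obtain f g where f: "f \<in> vague_test" "\<And>\<mu>. \<mu> \<in> lf_measures \<Longrightarrow> A \<mu> = exp (- (\<integral>x. f x \<partial>\<mu>))"
        and g: "g \<in> vague_test" "\<And>\<mu>. \<mu> \<in> lf_measures \<Longrightarrow> B \<mu> = exp (- (\<integral>x. g x \<partial>\<mu>))" unfolding E_def by blast
      have "A \<mu> * B \<mu> = exp (- (\<integral>x. f x + g x \<partial>\<mu>))" if "\<mu> \<in> lf_measures" for \<mu>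
        using that f g by (simp add: vague_test_integrable exp_add [symmetric] add.commute)
      then show "(\<lambda>\<mu>. A \<mu> * B \<mu>) \<in> E" using vague_test_add[OF f(1) g(1)] by (auto simp: E_def)
    qed
    show "\<forall>A\<in>E. \<forall>\<mu>\<in>topspace vague_topology. \<bar>A \<mu>\<bar> \<le> 1"
    proof (intro ballI)
      fix A \<mu> assume "A \<in> E" "\<mu> \<in> topspace vague_topology"
      then obtain f where f: "f \<in> vague_test" and \<mu>: "\<mu> \<in> lf_measures" and A: "A \<mu> = exp (- (\<integral>x. f x \<partial>\<mu>))"
        by (auto simp: E_def topspace_vague_topology)
      have "0 \<le> (\<integral>x. f x \<partial>\<mu>)"
        using f by (intro integral_nonneg_AE AE_I2) (auto simp: space_lf[OF \<mu>] vague_test_def)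
      then show "\<bar>A \<mu>\<bar> \<le> 1" using A by simp
    qed
    show "continuous_map vague_topology euclideanreal A" if AE: "A \<in> E" for A
    proof -
      obtain f where f: "f \<in> vague_test" "\<And>\<mu>. \<mu> \<in> lf_measures \<Longrightarrow> A \<mu> = exp (- (\<integral>x. f x \<partial>\<mu>))" using AE unfolding E_def by blast
      have "continuous_map vague_topology euclideanreal (exp \<circ> (\<lambda>\<mu>. - (\<integral>x. f x \<partial>\<mu>)))"
        by (rule continuous_map_compose) (auto intro!: continuous_intros continuous_map_vague_integral f)
      then show ?thesis by (rule continuous_map_eq) (auto simp: f topspace_vague_topology)
    qed
    show coord: "tent_coord k \<in> E" for k
      unfolding E_def tent_coord_def
      by (cases "prod_decode k") (auto intro!: bexI[of _ "tent _ _"] tent_vague_test)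
    show "\<forall>\<^sub>F i in F. (\<forall>\<omega>\<in>space M. \<xi> i \<omega> \<in> topspace vague_topology) \<and> (\<forall>k. (\<lambda>\<omega>. tent_coord k (\<xi> i \<omega>)) \<in> borel_measurable M)"
      using \<xi>
    proof eventually_elim
      case (elim i)
      have "(\<lambda>\<omega>. tent_coord k (\<xi> i \<omega>)) \<in> borel_measurable M" for k
      proof -
        obtain f where f: "f \<in> vague_test" "\<And>\<mu>. \<mu> \<in> lf_measures \<Longrightarrow> tent_coord k \<mu> = exp (- (\<integral>x. f x \<partial>\<mu>))"
          using coord unfolding E_def by blast
        have [measurable]: "(\<lambda>\<omega>. \<integral>x. f x \<partial>\<xi> i \<omega>) \<in> borel_measurable M" using elim f(1) by blast
        have "(\<lambda>\<omega>. exp (- (\<integral>x. f x \<partial>\<xi> i \<omega>))) \<in> borel_measurable M" by measurable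
        then show ?thesis by (rule measurable_cong[THEN iffD1, rotated]) (use elim f in auto)
      qed
      then show ?case using elim by (simp add: topspace_vague_topology)
    qed
    show "((\<lambda>i. \<integral>\<omega>. A (\<xi> i \<omega>) \<partial>M) \<longlongrightarrow> (\<integral>\<omega>. A (\<zeta> \<omega>) \<partial>N)) F" if AE: "A \<in> E" for A
    proof -
      obtain f where f: "f \<in> vague_test" "\<And>\<mu>. \<mu> \<in> lf_measures \<Longrightarrow> A \<mu> = exp (- (\<integral>x. f x \<partial>\<mu>))" using AE unfolding E_def by blast
      have 1: "(\<integral>\<omega>. A (\<zeta> \<omega>) \<partial>N) = (\<integral>\<omega>. exp (- (\<integral>x. f x \<partial>\<zeta> \<omega>)) \<partial>N)"
        by (intro Bochner_Integration.integral_cong) (auto simp: f \<zeta>lf)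
      have "\<forall>\<^sub>F i in F. (\<integral>\<omega>. exp (- (\<integral>x. f x \<partial>\<xi> i \<omega>)) \<partial>M) = (\<integral>\<omega>. A (\<xi> i \<omega>) \<partial>M)"
        using \<xi> by eventually_elim (intro Bochner_Integration.integral_cong, auto simp: f)
      then show ?thesis unfolding 1 by (rule Lim_transform_eventually[OF lim[OF f(1)]])
    qed
  qed
qed

section \<open>Jumps of a nondecreasing path\<close>

lemma space_pos_borel: "space pos_borel = {0<..}"
  by (simp add: space_restrict_space)

text \<open>The jumps in an arbitrary interval \<open>(s, t]\<close> are needed for the additivity in time.\<close>

definition jump_measure_on :: "(real \<Rightarrow> real) \<Rightarrow> real \<Rightarrow> real \<Rightarrow> real measure" where
  "jump_measure_on y s t = distr (count_space {u. s < u \<and> u \<le> t \<and> 0 < jump y u}) pos_borel (jump y)"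

lemma jump_measure_conv_on: "jump_measure y t = jump_measure_on y 0 t"
  by (simp add: jump_measure_def jump_measure_on_def)

lemma jump_measurable_count_space [measurable]:
  "jump y \<in> count_space {u. s < u \<and> u \<le> t \<and> 0 < jump y u} \<rightarrow>\<^sub>M pos_borel"
  by (auto simp: space_restrict_space)

locale nondecreasing_path =
  fixes y :: "real \<Rightarrow> real"
  assumes cadlag: "cadlag y" and mono: "mono_on {0..} y"
begin

lemma mono_path: "0 \<le> u \<Longrightarrow> u \<le> v \<Longrightarrow> y u \<le> y v"
  using mono by (auto simp: mono_on_def)

lemma right_limit: "0 \<le> t \<Longrightarrow> (y \<longlongrightarrow> y t) (at_right t)"
  using cadlag by (simp add: cadlag_def)

lemma left_limit:
  assumes "0 < t" shows "(y \<longlongrightarrow> y t - jump y t) (at_left t)"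
proof -
  obtain l where l: "(y \<longlongrightarrow> l) (at_left t)" using cadlag assms by (auto simp: cadlag_def)
  have "Lim (at_left t) y = l" by (rule tendsto_Lim[OF _ l]) (rule trivial_limit_at_left_real)
  then show ?thesis using l by (simp add: jump_def)
qed

lemma le_left_limit:
  assumes "0 \<le> u" "u < t" shows "y u \<le> y t - jump y t"
proof (rule tendsto_lowerbound[OF left_limit])
  show "\<forall>\<^sub>F x in at_left t. y u \<le> y x"
    unfolding eventually_at_left[OF assms(2)] using assms(1) by (intro exI[of _ u]) (auto intro!: mono_path assms)
qed (use assms in auto)

lemma left_limit_le:
  assumes "0 < t" shows "y t - jump y t \<le> y t"
proof (rule tendsto_upperbound[OF left_limit[OF assms]])
  show "\<forall>\<^sub>F x in at_left t. y x \<le> y t"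
    unfolding eventually_at_left[OF assms] using assms by (intro exI[of _ 0]) (auto intro!: mono_path)
qed auto

lemma jump_nonneg: "0 < t \<Longrightarrow> 0 \<le> jump y t"
  using left_limit_le[of t] by simp

text \<open>Jumps at different times contribute separately to the increase of the path.  The proof removes the last
  jump first.\<close>

lemma sum_jumps_le:
  assumes "finite A" "0 \<le> s" "s \<le> t" "A \<subseteq> {s<..t}"
  shows "(\<Sum>u\<in>A. jump y u) \<le> y t - y s"
  using assms(1,3,4)
proof (induction A arbitrary: t rule: finite_linorder_max_induct)
  case empty then show ?case using mono_path assms by simp
next
  case (insert b A)
  define m where "m = Max (insert s A)"
  have m: "s \<le> m" "m < b" "A \<subseteq> {s<..m}" using insert by (auto simp: m_def)
  have "(\<Sum>u\<in>A. jump y u) \<le> y m - y s" using m by (intro insert.IH) auto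
  moreover have "y m \<le> y b - jump y b" using m assms(2) by (intro le_left_limit) auto
  moreover have "y b \<le> y t" using insert.prems assms(2) by (intro mono_path) auto
  moreover have "b \<notin> A" using insert.hyps by auto
  ultimately show ?case using insert.hyps(1) by simp
qed

lemma finite_large_jumps:
  assumes "0 < a" "0 \<le> s"
  shows "finite {u. s < u \<and> u \<le> t \<and> a \<le> jump y u}" (is "finite ?A")
proof (rule ccontr)
  assume inf: "infinite ?A"
  then have st: "s \<le> t" using infinite_imp_nonempty[OF inf] by force
  obtain n where n: "(y t - y s) / a < real n" using reals_Archimedean2 by blast
  obtain B where B: "finite B" "card B = n" "B \<subseteq> ?A" using infinite_arbitrarily_large[OF inf] by blast
  have "real n * a = (\<Sum>u\<in>B. a)" using B by simp
  also have "\<dots> \<le> (\<Sum>u\<in>B. jump y u)" using B by (intro sum_mono) auto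
  also have "\<dots> \<le> y t - y s" using B assms st by (intro sum_jumps_le) auto
  finally show False using n assms by (simp add: field_simps)
qed

text \<open>An interval that is short and contains no jump of size at least \<open>a\<close> carries an increment less than \<open>2 * a\<close>.
  Every point has a neighbourhood with this property, by the one-sided limits there; a Lebesgue number of
  the resulting cover makes it uniform.\<close>

lemma small_increments:
  assumes s: "0 \<le> s" and a: "0 < a"
  shows "\<exists>\<delta>>0. \<forall>u v. s \<le> u \<longrightarrow> u < v \<longrightarrow> v \<le> t \<longrightarrow> v - u < \<delta> \<longrightarrow> (\<forall>p. u < p \<longrightarrow> p \<le> v \<longrightarrow> jump y p < a) \<longrightarrow> y v - y u < 2 * a"
proof -
  define \<G> where "\<G> = {G. open G \<and> (\<forall>u v. s \<le> u \<longrightarrow> u < v \<longrightarrow> u \<in> G \<longrightarrow> v \<in> G \<longrightarrow>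
      (\<forall>p. u < p \<longrightarrow> p \<le> v \<longrightarrow> jump y p < a) \<longrightarrow> y v - y u < 2 * a)}"
  have "\<exists>G\<in>\<G>. p \<in> G" if p: "s \<le> p" for p
  proof -
    have "\<forall>\<^sub>F v in at_right p. y v < y p + a / 2"
      using right_limit[of p] p s a by (intro order_tendstoD(2)) auto
    then obtain r where r: "p < r" "\<And>v. p < v \<Longrightarrow> v < r \<Longrightarrow> y v < y p + a / 2"
      unfolding eventually_at_right[OF less_add_one[of p]] by blast
    have "\<exists>l<p. \<forall>u. s \<le> u \<longrightarrow> l < u \<longrightarrow> u < p \<longrightarrow> y p - jump y p - a / 2 < y u"
    proof (cases "p = s")
      case True then show ?thesis by (intro exI[of _ "p - 1"]) auto
    next
      case False
      then have sp: "s < p" using p by simp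
      have "\<forall>\<^sub>F u in at_left p. y p - jump y p - a / 2 < y u"
        using left_limit[of p] sp s a by (intro order_tendstoD(1)) auto
      then show ?thesis unfolding eventually_at_left[OF sp] by blast
    qed
    then obtain l where l: "l < p" "\<And>u. s \<le> u \<Longrightarrow> l < u \<Longrightarrow> u < p \<Longrightarrow> y p - jump y p - a / 2 < y u" by blast
    have "{l<..<r} \<in> \<G>" unfolding \<G>_def
    proof (intro CollectI conjI allI impI)
      fix u v assume u: "s \<le> u" "u < v" "u \<in> {l<..<r}" and v: "v \<in> {l<..<r}" and small: "\<forall>q. u < q \<longrightarrow> q \<le> v \<longrightarrow> jump y q < a"
      consider "v < p" | "p \<le> u" | "u < p" "p \<le> v" by linarith
      then show "y v - y u < 2 * a"
      proof cases
        case 1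
        then have "y v \<le> y p - jump y p" using u s by (intro le_left_limit) auto
        moreover have "y p - jump y p - a / 2 < y u" using l(2)[of u] 1 u by auto
        ultimately show ?thesis using a by linarith
      next
        case 2
        then have "y p \<le> y u" using s p by (intro mono_path) auto
        moreover have "y v < y p + a / 2" using r(2)[of v] 2 u v by auto
        ultimately show ?thesis using a by linarith
      next
        case 3
        then have "jump y p < a" using small by blast
        moreover have "y v < y p + a / 2" using r(2)[of v] 3 v a by (cases "v = p") auto
        moreover have "y p - jump y p - a / 2 < y u" using l(2)[of u] 3 u by auto
        ultimately show ?thesis using a by linarith
      qed
    qed simp
    then show ?thesis using l(1) r(1) by (intro bexI[of _ "{l<..<r}"]) auto
  qed
  then have cover: "{s..t} \<subseteq> \<Union>\<G>" by fastforce
  have op: "open G" if "G \<in> \<G>" for G using that by (simp add: \<G>_def)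
  obtain \<delta> where \<delta>: "0 < \<delta>" "\<And>x. x \<in> {s..t} \<Longrightarrow> \<exists>G\<in>\<G>. ball x \<delta> \<subseteq> G"
    by (rule Heine_Borel_lemma[OF compact_Icc cover op]) auto
  show ?thesis
  proof (intro exI[of _ \<delta>] conjI allI impI)
    fix u v assume uv: "s \<le> u" "u < v" "v \<le> t" "v - u < \<delta>" "\<forall>p. u < p \<longrightarrow> p \<le> v \<longrightarrow> jump y p < a"
    then obtain G where G: "G \<in> \<G>" "ball u \<delta> \<subseteq> G" using \<delta>(2)[of u] by auto
    have "u \<in> G" "v \<in> G" using G(2) uv \<delta>(1) by (auto simp: subset_eq dist_real_def)
    then show "y v - y u < 2 * a" using G(1) uv unfolding \<G>_def by blast
  qed fact
qed

text \<open>On a fine partition each large jump lies in an interval of its own, whose increment converges to the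
  jump, while all other increments are below \<open>2 * a\<close> and are not seen by \<open>f\<close>.\<close>

lemma tendsto_riemann_sums:
  assumes s: "0 \<le> s" and h: "0 < h" and a: "0 < a"
    and f: "continuous_on UNIV (f :: real \<Rightarrow> real)" and f0: "\<And>x. x < 2 * a \<Longrightarrow> f x = 0"
  shows "(\<lambda>n. \<Sum>i<Suc n. f (y (s + h * real (Suc i) / real (Suc n)) - y (s + h * real i / real (Suc n))))
    \<longlonglongrightarrow> (\<Sum>u | s < u \<and> u \<le> s + h \<and> a \<le> jump y u. f (jump y u))"
proof -
  define J where "J = {u. s < u \<and> u \<le> s + h \<and> a \<le> jump y u}"
  have finJ: "finite J" unfolding J_def by (rule finite_large_jumps[OF a s])
  define \<tau> where "\<tau> n i = s + h * real i / real (Suc n)" for n i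
  \<comment> \<open>The index of the interval \<open>(\<tau> n i, \<tau> n (i + 1)]\<close> that contains \<open>u\<close>.\<close>
  define idx where "idx n u = nat \<lceil>(u - s) * real (Suc n) / h\<rceil> - 1" for n u
  define w where "w n = h / real (Suc n)" for n
  have w0: "w \<longlonglongrightarrow> 0" unfolding w_def using LIMSEQ_Suc[OF lim_const_over_n[of h]] by simp
  have \<tau>_Suc: "\<tau> n (Suc i) = \<tau> n i + w n" for n i by (simp add: \<tau>_def w_def add_divide_distrib distrib_left)
  have idx: "\<tau> n (idx n u) < u" "u \<le> \<tau> n (Suc (idx n u))" "idx n u < Suc n" if u: "s < u" "u \<le> s + h" for n u
  proof -
    define z where "z = (u - s) * real (Suc n) / h"
    have z: "0 < z" "u = s + h * z / real (Suc n)" using u h by (auto simp: z_def simp del: of_nat_Suc)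
    have "(u - s) * real (Suc n) \<le> h * real (Suc n)" using u by (intro mult_right_mono) auto
    then have zn: "z \<le> real (Suc n)" using h by (simp add: z_def field_simps)
    define k where "k = nat \<lceil>z\<rceil>"
    have k: "1 \<le> k" "real k - 1 < z" "z \<le> real k" "k \<le> Suc n"
      using z zn by (auto simp: k_def) (linarith+)
    have ik: "idx n u = k - 1" by (simp add: idx_def k_def z_def)
    show "idx n u < Suc n" using k ik by simp
    have "h * real (k - 1) / real (Suc n) < h * z / real (Suc n)"
      using k h by (intro divide_strict_right_mono mult_strict_left_mono) auto
    then show "\<tau> n (idx n u) < u" using z(2) unfolding \<tau>_def ik by linarith
    have "h * z / real (Suc n) \<le> h * real k / real (Suc n)"
      using k h by (intro divide_right_mono mult_left_mono) auto
    moreover have "Suc (k - 1) = k" using k(1) by simp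
    ultimately show "u \<le> \<tau> n (Suc (idx n u))" using z(2) unfolding \<tau>_def ik by simp
  qed
  have idx_unique: "idx n u = i" if "\<tau> n i < u" "u \<le> \<tau> n (Suc i)" for n u i
  proof -
    have "real i < (u - s) * real (Suc n) / h" "(u - s) * real (Suc n) / h \<le> real (Suc i)"
      using that h by (auto simp: \<tau>_def field_simps simp del: of_nat_Suc)
    then have "\<lceil>(u - s) * real (Suc n) / h\<rceil> = int (Suc i)" by (intro ceiling_unique) auto
    then show ?thesis by (simp add: idx_def)
  qed
  obtain \<delta> where \<delta>: "\<delta> > 0" and small: "\<And>u v. s \<le> u \<Longrightarrow> u < v \<Longrightarrow> v \<le> s + h \<Longrightarrow> v - u < \<delta> \<Longrightarrow>
      (\<And>p. u < p \<Longrightarrow> p \<le> v \<Longrightarrow> jump y p < a) \<Longrightarrow> y v - y u < 2 * a"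
    using small_increments[OF s a] by meson
  have ev_small: "\<forall>\<^sub>F n in sequentially. w n < r" if "r > 0" for r
    using w0 that by (rule order_tendstoD)
  have "\<forall>\<^sub>F n in sequentially. \<forall>u\<in>J. \<forall>v\<in>J. u \<noteq> v \<longrightarrow> w n < \<bar>u - v\<bar>"
  proof (intro eventually_ball_finite finJ ballI)
    fix u v show "\<forall>\<^sub>F n in sequentially. u \<noteq> v \<longrightarrow> w n < \<bar>u - v\<bar>"
      using ev_small[of "\<bar>u - v\<bar>"] by (cases "u = v") auto
  qed
  then have eq: "\<forall>\<^sub>F n in sequentially. (\<Sum>u\<in>J. f (y (\<tau> n (Suc (idx n u))) - y (\<tau> n (idx n u))))
      = (\<Sum>i<Suc n. f (y (\<tau> n (Suc i)) - y (\<tau> n i)))"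
    using ev_small[OF \<delta>]
  proof eventually_elim
    case (elim n)
    have inj: "inj_on (idx n) J"
    proof (rule inj_onI, rule ccontr)
      fix u v assume uv: "u \<in> J" "v \<in> J" "idx n u = idx n v" "u \<noteq> v"
      then have "\<bar>u - v\<bar> \<le> w n"
        using idx[of u n] idx[of v n] \<tau>_Suc[of n "idx n v"] by (auto simp: J_def)
      with elim(1) uv show False by force
    qed
    have zero: "f (y (\<tau> n (Suc i)) - y (\<tau> n i)) = 0" if i: "i < Suc n" "i \<notin> idx n ` J" for i
    proof (intro f0 small)
      show "s \<le> \<tau> n i" using h by (simp add: \<tau>_def)
      have "0 < w n" using h by (simp add: w_def)
      then show "\<tau> n i < \<tau> n (Suc i)" by (simp add: \<tau>_Suc)
      have "h * real (Suc i) / real (Suc n) \<le> h * real (Suc n) / real (Suc n)"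
        using h i by (intro divide_right_mono mult_left_mono) auto
      then show "\<tau> n (Suc i) \<le> s + h" by (simp add: \<tau>_def del: of_nat_Suc)
      then have up: "\<tau> n (Suc i) \<le> s + h" .
      show "\<tau> n (Suc i) - \<tau> n i < \<delta>" using elim by (simp add: \<tau>_Suc)
      fix p assume p: "\<tau> n i < p" "p \<le> \<tau> n (Suc i)"
      then have "p \<notin> J" using idx_unique i(2) by blast
      then show "jump y p < a" using p up \<open>s \<le> \<tau> n i\<close> by (auto simp: J_def)
    qed
    have "(\<Sum>i<Suc n. f (y (\<tau> n (Suc i)) - y (\<tau> n i))) = (\<Sum>i\<in>idx n ` J. f (y (\<tau> n (Suc i)) - y (\<tau> n i)))"
      using idx(3) zero by (intro sum.mono_neutral_right) (auto simp: J_def)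
    then show ?case using inj by (simp add: sum.reindex)
  qed
  have "(\<lambda>n. \<Sum>u\<in>J. f (y (\<tau> n (Suc (idx n u))) - y (\<tau> n (idx n u)))) \<longlonglongrightarrow> (\<Sum>u\<in>J. f (jump y u))"
  proof (rule tendsto_sum)
    fix u assume u: "u \<in> J"
    then have u': "s < u" "u \<le> s + h" "0 < u" using s by (auto simp: J_def)
    note ix = idx[OF u'(1,2)]
    have lw: "(\<lambda>n. u - w n) \<longlonglongrightarrow> u" "(\<lambda>n. u + w n) \<longlonglongrightarrow> u"
      using tendsto_diff[OF tendsto_const w0, of u] tendsto_add[OF tendsto_const w0, of u] by auto
    have l: "(\<lambda>n. \<tau> n (idx n u)) \<longlonglongrightarrow> u"
      using ix(1,2) by (intro tendsto_sandwich[OF _ _ lw(1) tendsto_const]) (auto simp: \<tau>_Suc less_imp_le diff_le_eq)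
    have r: "(\<lambda>n. \<tau> n (Suc (idx n u))) \<longlonglongrightarrow> u"
      using ix(1,2) by (intro tendsto_sandwich[OF _ _ tendsto_const lw(2)]) (auto simp: \<tau>_Suc less_imp_le)
    have "filterlim (\<lambda>n. \<tau> n (idx n u)) (at_left u) sequentially"
      using l ix(1) by (auto simp: filterlim_at less_imp_neq)
    then have L: "(\<lambda>n. y (\<tau> n (idx n u))) \<longlonglongrightarrow> y u - jump y u"
      by (rule filterlim_compose[OF left_limit[OF u'(3)]])
    have "continuous (at u within {u..}) y"
      using right_limit[of u] u' by (simp add: continuous_within at_within_Ici_at_right)
    then have R: "(\<lambda>n. y (\<tau> n (Suc (idx n u)))) \<longlonglongrightarrow> y u"
      using r ix(2) unfolding continuous_within_sequentially o_def by auto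
    have "(\<lambda>n. y (\<tau> n (Suc (idx n u))) - y (\<tau> n (idx n u))) \<longlonglongrightarrow> jump y u"
      using tendsto_diff[OF R L] by simp
    moreover have "isCont f (jump y u)" using f by (simp add: continuous_on_eq_continuous_at)
    ultimately show "(\<lambda>n. f (y (\<tau> n (Suc (idx n u))) - y (\<tau> n (idx n u)))) \<longlonglongrightarrow> f (jump y u)"
      by (intro isCont_tendsto_compose[of "jump y u" f])
  qed
  then show ?thesis using Lim_transform_eventually[OF _ eq] by (simp add: J_def \<tau>_def)
qed

lemma integral_jump_measure_on:
  assumes "0 \<le> s" "0 < a" "f \<in> borel_measurable pos_borel" "\<And>x. 0 < x \<Longrightarrow> x < a \<Longrightarrow> f x = (0::real)"
  shows "(\<integral>x. f x \<partial>jump_measure_on y s t) = (\<Sum>u | s < u \<and> u \<le> t \<and> a \<le> jump y u. f (jump y u))"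
proof -
  let ?A = "{u. s < u \<and> u \<le> t \<and> 0 < jump y u}" and ?J = "{u. s < u \<and> u \<le> t \<and> a \<le> jump y u}"
  have fin: "finite ?J" by (rule finite_large_jumps) fact+
  have sub: "{u\<in>?A. f (jump y u) \<noteq> 0} \<subseteq> ?J" using assms(4) by force
  have "(\<integral>x. f x \<partial>jump_measure_on y s t) = (\<integral>u. f (jump y u) \<partial>count_space ?A)"
    unfolding jump_measure_on_def using assms(3) by (intro integral_distr) auto
  also have "\<dots> = (\<Sum>u\<in>{u\<in>?A. f (jump y u) \<noteq> 0}. f (jump y u))"
    using lebesgue_integral_count_space_finite_support[OF finite_subset[OF sub fin]] by simp
  also have "\<dots> = (\<Sum>u\<in>?J. f (jump y u))"
    using sub fin assms(2) by (intro sum.mono_neutral_left) auto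
  finally show ?thesis .
qed

lemma jump_measure_on_lf:
  assumes "0 \<le> s"
  shows "jump_measure_on y s t \<in> lf_measures"
  unfolding lf_measures_def
proof (intro CollectI conjI allI impI)
  show "sets (jump_measure_on y s t) = sets pos_borel" by (simp add: jump_measure_on_def)
  fix K :: "real set" assume K: "compact K \<and> K \<subseteq> {0<..}"
  let ?A = "{u. s < u \<and> u \<le> t \<and> 0 < jump y u}"
  show "emeasure (jump_measure_on y s t) K < \<infinity>"
  proof (cases "K = {}")
    case False
    obtain a where a: "a \<in> K" "\<forall>x\<in>K. a \<le> x" using compact_attains_inf[OF _ False] K by blast
    have sets: "K \<in> sets pos_borel" using K by (auto simp: sets_restrict_space_iff compact_imp_closed)
    have "0 < a" using K a by auto
    have sub: "jump y -` K \<inter> ?A \<subseteq> {u. s < u \<and> u \<le> t \<and> a \<le> jump y u}" using a by auto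
    have "emeasure (jump_measure_on y s t) K = emeasure (count_space ?A) (jump y -` K \<inter> ?A)"
      unfolding jump_measure_on_def using sets by (subst emeasure_distr) auto
    also have "\<dots> < \<infinity>"
      using finite_subset[OF sub finite_large_jumps[OF \<open>0 < a\<close> assms]] by (subst emeasure_count_space_finite) (auto simp: of_nat_less_top)
    finally show ?thesis .
  qed simp
qed

lemma riemann_sums_tendsto_jump_integral:
  assumes s: "0 \<le> s" and h: "0 < h" and a: "0 < a"
    and f: "continuous_on UNIV (f :: real \<Rightarrow> real)" and f0: "\<And>x. x < a \<Longrightarrow> f x = 0"
  shows "(\<lambda>n. \<Sum>i<Suc n. f (y (s + h * real (Suc i) / real (Suc n)) - y (s + h * real i / real (Suc n))))
    \<longlonglongrightarrow> (\<integral>x. f x \<partial>jump_measure_on y s (s + h))"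
proof -
  have "f \<in> borel_measurable pos_borel"
    using borel_measurable_continuous_onI[OF f] by (rule measurable_restrict_space1)
  then show ?thesis
    using tendsto_riemann_sums[OF s h _ f, of "a / 2"] integral_jump_measure_on[OF s, of "a / 2" f] a f0 by simp
qed

end

section \<open>The Laplace functional of the jumps of a subordinator\<close>

lemma tendsto_difference_quotient_exp:
  "(\<lambda>n. (1 - exp (- (1 / real (n + 2)) * x)) / (1 / real (n + 2))) \<longlonglongrightarrow> x"
proof -
  have "((\<lambda>h. 1 - exp (- h * x)) has_field_derivative x) (at 0)"
    by (auto intro!: derivative_eq_intros)
  then have d: "((\<lambda>h. (1 - exp (- h * x)) / h) \<longlongrightarrow> x) (at 0)"
    by (simp add: DERIV_def)
  have "(\<lambda>n. 1 / real (n + 2)) \<longlonglongrightarrow> 0"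
    using LIMSEQ_ignore_initial_segment[OF lim_1_over_n, of 2] by simp
  then have "filterlim (\<lambda>n. 1 / real (n + 2)) (at 0) sequentially"
    by (auto simp: filterlim_at)
  from filterlim_compose[OF d this] show ?thesis by simp
qed

text \<open>Because the limit is positive, \<open>x n\<close> tends to \<open>0\<close>, and then \<open>x n\<close> and \<open>- ln (1 - x n)\<close> are
  asymptotically equal by \<open>x \<le> - ln (1 - x) \<le> x / (1 - x)\<close>.\<close>

lemma tendsto_rate_of_power_limit:
  assumes x: "\<And>n. 0 \<le> x n" "\<And>n. x n \<le> 1" and L: "0 < L"
    and lim: "(\<lambda>n. (1 - x n) ^ Suc n) \<longlonglongrightarrow> (L :: real)"
  shows "(\<lambda>n. real (Suc n) * x n) \<longlonglongrightarrow> - ln L"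
proof -
  have pos: "\<forall>\<^sub>F n in sequentially. 0 < (1 - x n) ^ Suc n"
    using lim L by (rule order_tendstoD)
  then have lt1: "\<forall>\<^sub>F n in sequentially. x n < 1"
  proof eventually_elim
    case (elim n)
    then have "1 - x n \<noteq> 0" by auto
    then show ?case using x(2)[of n] by simp
  qed
  have "(\<lambda>n. ln ((1 - x n) ^ Suc n)) \<longlonglongrightarrow> ln L"
    using L by (intro tendsto_ln lim) auto
  moreover have "\<forall>\<^sub>F n in sequentially. ln ((1 - x n) ^ Suc n) = real (Suc n) * ln (1 - x n)"
    using lt1 by eventually_elim (simp add: ln_realpow del: power_Suc of_nat_Suc)
  ultimately have l: "(\<lambda>n. real (Suc n) * ln (1 - x n)) \<longlonglongrightarrow> ln L" by (rule Lim_transform_eventually)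
  have "(\<lambda>n. real (Suc n) * ln (1 - x n) * (1 / real (Suc n))) \<longlonglongrightarrow> ln L * 0"
    by (intro tendsto_mult l LIMSEQ_Suc[OF lim_1_over_n])
  then have "(\<lambda>n. ln (1 - x n)) \<longlonglongrightarrow> 0" by (simp del: of_nat_Suc)
  then have "(\<lambda>n. exp (ln (1 - x n))) \<longlonglongrightarrow> exp 0" by (rule tendsto_exp)
  moreover have "\<forall>\<^sub>F n in sequentially. exp (ln (1 - x n)) = 1 - x n" using lt1 by eventually_elim simp
  ultimately have p: "(\<lambda>n. 1 - x n) \<longlonglongrightarrow> 1" using Lim_transform_eventually by fastforce
  have low: "(\<lambda>n. (1 - x n) * - (real (Suc n) * ln (1 - x n))) \<longlonglongrightarrow> 1 * - ln L"
    by (intro tendsto_mult p tendsto_minus l)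
  show ?thesis
  proof (rule tendsto_sandwich[OF _ _ _ tendsto_minus[OF l]])
    show "(\<lambda>n. (1 - x n) * - (real (Suc n) * ln (1 - x n))) \<longlonglongrightarrow> - ln L" using low by simp
    show "\<forall>\<^sub>F n in sequentially. real (Suc n) * x n \<le> - (real (Suc n) * ln (1 - x n))"
      using lt1
    proof eventually_elim
      case (elim n)
      have "x n \<le> - ln (1 - x n)" using ln_le_minus_one[of "1 - x n"] elim by simp
      then have "real (Suc n) * x n \<le> real (Suc n) * - ln (1 - x n)" by (intro mult_left_mono) auto
      then show ?case by simp
    qed
    show "\<forall>\<^sub>F n in sequentially. (1 - x n) * - (real (Suc n) * ln (1 - x n)) \<le> real (Suc n) * x n"
      using lt1
    proof eventually_elim
      case (elim n)
      have "ln (1 / (1 - x n)) \<le> 1 / (1 - x n) - 1" using elim by (intro ln_le_minus_one) simp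
      then have "- ln (1 - x n) \<le> 1 / (1 - x n) - 1" using elim by (simp add: ln_div)
      then have "(1 - x n) * - ln (1 - x n) \<le> (1 - x n) * (1 / (1 - x n) - 1)"
        using elim by (intro mult_left_mono) auto
      also have "\<dots> = x n" using elim by (simp add: right_diff_distrib)
      finally have "real (Suc n) * ((1 - x n) * - ln (1 - x n)) \<le> real (Suc n) * x n" by (intro mult_left_mono) auto
      then show ?case by (simp only: mult_ac minus_mult_right)
    qed
  qed
qed

text \<open>Cauchy's functional equation: nonnegativity gives monotonicity, and \<open>t\<close> is enclosed between
  neighbouring multiples of \<open>1 / n\<close>.\<close>

lemma nonneg_additive_linear:
  fixes a :: "real \<Rightarrow> real"
  assumes add: "\<And>s t. 0 < s \<Longrightarrow> 0 < t \<Longrightarrow> a (s + t) = a s + a t" and nonneg: "\<And>t. 0 < t \<Longrightarrow> 0 \<le> a t"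
    and t: "0 < t"
  shows "a t = t * a 1"
proof -
  have mult: "a (real (Suc k) * s) = real (Suc k) * a s" if "0 < s" for k s
  proof (induction k)
    case (Suc k)
    have "real (Suc (Suc k)) * s = real (Suc k) * s + s" by (simp add: distrib_right)
    then have "a (real (Suc (Suc k)) * s) = a (real (Suc k) * s + s)" by simp
    also have "\<dots> = a (real (Suc k) * s) + a s" using that by (intro add) auto
    also have "\<dots> = real (Suc (Suc k)) * a s" unfolding Suc by (simp add: distrib_right)
    finally show ?case .
  qed simp
  have mono: "a s \<le> a u" if "0 < s" "s \<le> u" for s u
    using add[of s "u - s"] nonneg[of "u - s"] that by (cases "s = u") auto
  have bound: "\<bar>a t - t * a 1\<bar> \<le> 2 * a 1 / real (Suc n)" for n
  proof -
    define s where "s = 1 / real (Suc n)"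
    have s: "0 < s" by (simp add: s_def)
    have as: "a s = a 1 / real (Suc n)" using mult[OF s, of n] by (simp add: s_def field_simps del: of_nat_Suc)
    define k where "k = nat \<lfloor>t / s\<rfloor>"
    have k: "real k \<le> t / s" "t / s < real (Suc k)" using t s by (auto simp: k_def) linarith
    then have k': "real k * s \<le> t" "t \<le> real (Suc k) * s" using s by (auto simp: field_simps)
    have up: "a t \<le> real (Suc k) * a s" using mono[OF t k'(2)] mult[OF s] by simp
    have low: "real k * a s \<le> a t"
    proof (cases k)
      case 0 then show ?thesis using nonneg[OF t] by simp
    next
      case (Suc j)
      have "0 < real k * s" using Suc s by simp
      from mono[OF this k'(1)] show ?thesis using mult[OF s, of j] Suc by simp
    qed
    have "t / s = t * real (Suc n)" by (simp add: s_def)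
    then have ta: "t * a 1 = (t / s) * a s" by (simp only: as) simp
    have "0 \<le> a s" using nonneg s by simp
    then have "real k * a s \<le> t * a 1" "t * a 1 \<le> real (Suc k) * a s"
      unfolding ta using k by (auto intro!: mult_right_mono simp del: of_nat_Suc times_divide_eq_left)
    with up low have "\<bar>a t - t * a 1\<bar> \<le> a s" by (simp add: distrib_right)
    also have "\<dots> \<le> 2 * a s" using \<open>0 \<le> a s\<close> by simp
    finally show ?thesis using as by simp
  qed
  have "(\<lambda>n. 2 * a 1 / real (Suc n)) \<longlonglongrightarrow> 0" using LIMSEQ_Suc[OF lim_const_over_n[of "2 * a 1"]] by simp
  then have "\<bar>a t - t * a 1\<bar> \<le> 0"
    by (rule tendsto_lowerbound) (use bound in auto)
  then show ?thesis by simp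
qed

text \<open>Integrands that only see jumps bounded away from \<open>0\<close>.  They may stay positive at infinity, as a path
  has only finitely many jumps above any positive level on a bounded time interval.\<close>

definition jump_test :: "(real \<Rightarrow> real) \<Rightarrow> bool" where
  "jump_test f \<longleftrightarrow> continuous_on UNIV f \<and> (\<forall>x. 0 \<le> f x) \<and> (\<exists>a>0. \<forall>x<a. f x = 0)"

lemma jump_test_measurable: "jump_test f \<Longrightarrow> f \<in> borel_measurable borel"
  by (simp add: jump_test_def borel_measurable_continuous_onI)

text \<open>The integrand of the exponent of a Poisson Laplace functional.\<close>

definition loss :: "(real \<Rightarrow> real) \<Rightarrow> real \<Rightarrow> real" where
  "loss f x = 1 - exp (- f x)"

lemma jump_test_loss: "jump_test f \<Longrightarrow> jump_test (loss f)"
  unfolding jump_test_def loss_def by (auto intro!: continuous_intros)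

locale subordinator =
  fixes M :: "'a measure" and Y :: "real \<Rightarrow> 'a \<Rightarrow> real"
  assumes subordinator: "pure_jump_subordinator M Y"
begin

lemma levy: "levy_process M Y"
  using subordinator by (simp add: pure_jump_subordinator_def)

sublocale prob_space M
  using levy by (simp add: levy_process_def)

lemma nondecreasing_path: "\<omega> \<in> space M \<Longrightarrow> nondecreasing_path (\<lambda>t. Y t \<omega>)"
  using subordinator levy by unfold_locales (auto simp: pure_jump_subordinator_def levy_process_def)

lemma Y_measurable [measurable]: "0 \<le> t \<Longrightarrow> Y t \<in> borel_measurable M"
  using levy by (simp add: levy_process_def)

definition jumps :: "real \<Rightarrow> real \<Rightarrow> 'a \<Rightarrow> real measure" where
  "jumps s t \<omega> = jump_measure_on (\<lambda>u. Y u \<omega>) s t"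

lemma jumps_lf: "0 \<le> s \<Longrightarrow> \<omega> \<in> space M \<Longrightarrow> jumps s t \<omega> \<in> lf_measures"
  unfolding jumps_def by (rule nondecreasing_path.jump_measure_on_lf[OF nondecreasing_path])

lemma riemann_jumps:
  assumes "jump_test f" "0 \<le> s" "0 < h" "\<omega> \<in> space M"
  shows "(\<lambda>n. \<Sum>i<Suc n. f (Y (s + h * real (Suc i) / real (Suc n)) \<omega> - Y (s + h * real i / real (Suc n)) \<omega>))
    \<longlonglongrightarrow> (\<integral>x. f x \<partial>jumps s (s + h) \<omega>)"
  using assms(1) nondecreasing_path.riemann_sums_tendsto_jump_integral[OF nondecreasing_path[OF assms(4)] assms(2,3), of _ f]
  unfolding jumps_def jump_test_def by blast

lemma jump_integral_measurable:
  assumes f: "jump_test f" and s: "0 \<le> s" and h: "0 < h"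
  shows "(\<lambda>\<omega>. \<integral>x. f x \<partial>jumps s (s + h) \<omega>) \<in> borel_measurable M"
proof (rule borel_measurable_LIMSEQ_real[OF riemann_jumps[OF f s h]])
  fix n
  have [measurable]: "f \<in> borel_measurable borel" by (rule jump_test_measurable[OF f])
  have [measurable]: "Y (s + h * real i / real (Suc n)) \<in> borel_measurable M" for i
    using s h by (intro Y_measurable) auto
  show "(\<lambda>\<omega>. \<Sum>i<Suc n. f (Y (s + h * real (Suc i) / real (Suc n)) \<omega> - Y (s + h * real i / real (Suc n)) \<omega>)) \<in> borel_measurable M"
    by measurable
qed

lemma jump_integral_nonneg: "jump_test f \<Longrightarrow> 0 \<le> (\<integral>x. f x \<partial>jumps s t \<omega>)"
  by (rule integral_nonneg_AE) (auto simp: jump_test_def)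

text \<open>The increments over a partition into \<open>n + 1\<close> equal parts are independent and have the law of
  \<open>Y (h / (n + 1))\<close>.\<close>

lemma expectation_riemann:
  assumes f: "jump_test f" and s: "0 \<le> s" and h: "0 < h"
  shows "expectation (\<lambda>\<omega>. exp (- (\<Sum>i<Suc n. f (Y (s + h * real (Suc i) / real (Suc n)) \<omega> - Y (s + h * real i / real (Suc n)) \<omega>))))
    = (1 - expectation (\<lambda>\<omega>. loss f (Y (h / real (Suc n)) \<omega>))) ^ Suc n"
proof -
  define \<tau> where "\<tau> i = s + h * real i / real (Suc n)" for i
  define X where "X i \<omega> = Y (\<tau> (Suc i)) \<omega> - Y (\<tau> i) \<omega>" for i \<omega>
  have fm [measurable]: "f \<in> borel_measurable borel" by (rule jump_test_measurable[OF f])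
  have \<tau>0: "0 \<le> \<tau> i" for i using s h by (simp add: \<tau>_def)
  have Xm [measurable]: "X i \<in> borel_measurable M" for i
    unfolding X_def using \<tau>0 by measurable
  have f0: "0 \<le> f x" for x using f by (simp add: jump_test_def)
  have hn: "0 \<le> h / real (Suc n)" using h by simp
  note Y_measurable[OF hn, measurable]
  have int: "integrable M (\<lambda>\<omega>. exp (- f (Z \<omega>)))" if [measurable]: "Z \<in> borel_measurable M" for Z
    by (rule integrable_const_bound[of _ 1]) (auto simp: f0)
  have "\<tau> i \<le> \<tau> (Suc i)" for i using h by (simp add: \<tau>_def divide_right_mono)
  then have "indep_vars (\<lambda>_. borel) X {..<Suc n}"
    unfolding X_def using levy \<tau>0 by (simp add: levy_process_def)
  then have ind: "indep_vars (\<lambda>_. borel) (\<lambda>i \<omega>. exp (- f (X i \<omega>))) {..<Suc n}"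
    by (rule indep_vars_compose2) measurable
  have "expectation (\<lambda>\<omega>. \<Prod>i<Suc n. exp (- f (X i \<omega>))) = (\<Prod>i<Suc n. expectation (\<lambda>\<omega>. exp (- f (X i \<omega>))))"
    by (rule indep_vars_lebesgue_integral[OF _ ind]) (auto intro: int)
  also have "\<dots> = (\<Prod>i<Suc n. expectation (\<lambda>\<omega>. exp (- f (Y (h / real (Suc n)) \<omega>))))"
  proof (rule prod.cong[OF refl])
    fix i
    have eq: "\<tau> (Suc i) = \<tau> i + h / real (Suc n)" by (simp add: \<tau>_def add_divide_distrib distrib_left)
    have "distr M borel (X i) = distr M borel (Y (h / real (Suc n)))"
      unfolding X_def eq using levy \<tau>0[of i] hn by (simp add: levy_process_def del: of_nat_Suc)
    moreover have "expectation (\<lambda>\<omega>. exp (- f (X i \<omega>))) = integral\<^sup>L (distr M borel (X i)) (\<lambda>x. exp (- f x))"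
      by (subst integral_distr) auto
    moreover have "expectation (\<lambda>\<omega>. exp (- f (Y (h / real (Suc n)) \<omega>))) = integral\<^sup>L (distr M borel (Y (h / real (Suc n)))) (\<lambda>x. exp (- f x))"
      by (rule integral_distr[OF Y_measurable[OF hn], symmetric]) measurable
    ultimately show "expectation (\<lambda>\<omega>. exp (- f (X i \<omega>))) = expectation (\<lambda>\<omega>. exp (- f (Y (h / real (Suc n)) \<omega>)))" by simp
  qed
  also have "\<dots> = (1 - expectation (\<lambda>\<omega>. loss f (Y (h / real (Suc n)) \<omega>))) ^ Suc n"
    unfolding loss_def Bochner_Integration.integral_diff[OF integrable_const int[OF Y_measurable[OF hn]]]
    by (simp add: prob_space del: power_Suc of_nat_Suc)
  finally show ?thesis by (simp add: X_def \<tau>_def exp_sum sum_negf[symmetric] del: of_nat_Suc sum.lessThan_Suc prod.lessThan_Suc)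
qed

text \<open>Since this limit does not involve the left end point \<open>s\<close> of the time interval, the Laplace functional of
  the jumps in \<open>(s, s + h]\<close> only depends on \<open>h\<close>.\<close>

definition exponent :: "(real \<Rightarrow> real) \<Rightarrow> real \<Rightarrow> real" where
  "exponent f h = lim (\<lambda>n. real (Suc n) * expectation (\<lambda>\<omega>. loss f (Y (h / real (Suc n)) \<omega>)))"

lemma
  assumes f: "jump_test f" and s: "0 \<le> s" and h: "0 < h"
  shows exponent_LIMSEQ: "(\<lambda>n. real (Suc n) * expectation (\<lambda>\<omega>. loss f (Y (h / real (Suc n)) \<omega>))) \<longlonglongrightarrow> exponent f h"
    and Laplace_exponent: "expectation (\<lambda>\<omega>. exp (- (\<integral>x. f x \<partial>jumps s (s + h) \<omega>))) = exp (- exponent f h)"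
    and exponent_nonneg: "0 \<le> exponent f h"
proof -
  define L where "L = expectation (\<lambda>\<omega>. exp (- (\<integral>x. f x \<partial>jumps s (s + h) \<omega>)))"
  have [measurable]: "f \<in> borel_measurable borel" by (rule jump_test_measurable[OF f])
  have [measurable]: "(\<lambda>\<omega>. \<integral>x. f x \<partial>jumps s (s + h) \<omega>) \<in> borel_measurable M" by (rule jump_integral_measurable) fact+
  have [measurable]: "Y (s + h * real i / real (Suc n)) \<in> borel_measurable M" for i n
    using s h by (intro Y_measurable) auto
  have f0: "0 \<le> f x" for x using f by (simp add: jump_test_def)
  have "(\<lambda>n. expectation (\<lambda>\<omega>. exp (- (\<Sum>i<Suc n. f (Y (s + h * real (Suc i) / real (Suc n)) \<omega> - Y (s + h * real i / real (Suc n)) \<omega>))))) \<longlonglongrightarrow> L"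
    unfolding L_def
  proof (rule integral_dominated_convergence[where w="\<lambda>_. 1"])
    show "AE \<omega> in M. (\<lambda>n. exp (- (\<Sum>i<Suc n. f (Y (s + h * real (Suc i) / real (Suc n)) \<omega> - Y (s + h * real i / real (Suc n)) \<omega>)))) \<longlonglongrightarrow> exp (- (\<integral>x. f x \<partial>jumps s (s + h) \<omega>))"
      by (intro AE_I2 tendsto_intros riemann_jumps f s h)
    show "AE \<omega> in M. norm (exp (- (\<Sum>i<Suc n. f (Y (s + h * real (Suc i) / real (Suc n)) \<omega> - Y (s + h * real i / real (Suc n)) \<omega>)))) \<le> 1" for n
      by (intro AE_I2) (simp add: sum_nonneg f0 del: sum.lessThan_Suc)
    show "(\<lambda>\<omega>. exp (- (\<integral>x. f x \<partial>jumps s (s + h) \<omega>))) \<in> borel_measurable M"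
      "(\<lambda>\<omega>. exp (- (\<Sum>i<Suc n. f (Y (s + h * real (Suc i) / real (Suc n)) \<omega> - Y (s + h * real i / real (Suc n)) \<omega>)))) \<in> borel_measurable M" for n
      by measurable
  qed simp
  then have lim: "(\<lambda>n. (1 - expectation (\<lambda>\<omega>. loss f (Y (h / real (Suc n)) \<omega>))) ^ Suc n) \<longlonglongrightarrow> L"
    by (simp only: expectation_riemann[OF f s h])
  have Lint: "integrable M (\<lambda>\<omega>. exp (- (\<integral>x. f x \<partial>jumps s (s + h) \<omega>)))"
    by (rule integrable_const_bound[of _ 1]) (auto simp: jump_integral_nonneg[OF f])
  \<comment> \<open>The integrand is positive everywhere, as the sum over the jumps is finite.\<close>
  have L: "0 < L"
  proof -
    have "0 \<le> L" unfolding L_def by (rule integral_nonneg_AE) auto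
    moreover have "L \<noteq> 0"
    proof
      assume "L = 0"
      then have "AE \<omega> in M. exp (- (\<integral>x. f x \<partial>jumps s (s + h) \<omega>)) = 0"
        using integral_nonneg_eq_0_iff_AE[OF Lint] by (auto simp: L_def)
      then show False by simp
    qed
    ultimately show ?thesis by simp
  qed
  have loss01: "0 \<le> loss f x" "loss f x \<le> 1" for x using f0[of x] by (auto simp: loss_def)
  have E01: "0 \<le> expectation (\<lambda>\<omega>. loss f (Y (h / real (Suc n)) \<omega>))" "expectation (\<lambda>\<omega>. loss f (Y (h / real (Suc n)) \<omega>)) \<le> 1" for n
  proof -
    show "0 \<le> expectation (\<lambda>\<omega>. loss f (Y (h / real (Suc n)) \<omega>))" by (rule integral_nonneg_AE) (simp add: loss01)
    have [measurable]: "Y (h / real (Suc n)) \<in> borel_measurable M" using h by (intro Y_measurable) auto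
    have "(\<lambda>\<omega>. loss f (Y (h / real (Suc n)) \<omega>)) \<in> borel_measurable M" unfolding loss_def by measurable
    then have "integrable M (\<lambda>\<omega>. loss f (Y (h / real (Suc n)) \<omega>))"
      by (intro integrable_const_bound[of _ 1]) (auto simp: loss01)
    then show "expectation (\<lambda>\<omega>. loss f (Y (h / real (Suc n)) \<omega>)) \<le> 1"
      using loss01 by (intro integral_le_const) auto
  qed
  have lim': "(\<lambda>n. real (Suc n) * expectation (\<lambda>\<omega>. loss f (Y (h / real (Suc n)) \<omega>))) \<longlonglongrightarrow> - ln L"
    by (rule tendsto_rate_of_power_limit[OF E01 L lim])
  have eq: "exponent f h = - ln L" unfolding exponent_def by (rule limI[OF lim'])
  show "(\<lambda>n. real (Suc n) * expectation (\<lambda>\<omega>. loss f (Y (h / real (Suc n)) \<omega>))) \<longlonglongrightarrow> exponent f h"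
    using lim' eq by simp
  show "expectation (\<lambda>\<omega>. exp (- (\<integral>x. f x \<partial>jumps s (s + h) \<omega>))) = exp (- exponent f h)"
    using eq L by (simp add: L_def)
  show "0 \<le> exponent f h" unfolding eq
    by (rule tendsto_lowerbound[OF lim']) (auto intro!: always_eventually mult_nonneg_nonneg E01 simp del: of_nat_Suc)
qed

text \<open>Keeping each jump with probability \<open>\<theta>\<close> multiplies \<open>loss f\<close> by \<open>\<theta>\<close>.  The function with this loss is
  asymptotically \<open>\<theta> * loss f\<close> for small \<open>\<theta>\<close>, and this is what makes differentiation at \<open>\<theta> = 0\<close>
  possible.\<close>

lemma thinned_test:
  assumes f: "jump_test f" and \<theta>: "0 < \<theta>" "\<theta> < 1"
  defines "f' \<equiv> \<lambda>x. - ln (1 - \<theta> * loss f x)"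
  shows "jump_test f'" "loss f' x = \<theta> * loss f x" "\<theta> * loss f x \<le> f' x" "f' x \<le> \<theta> / (1 - \<theta>) * loss f x"
proof -
  have f0: "0 \<le> f x" for x using f by (simp add: jump_test_def)
  have l: "0 \<le> loss f x" "loss f x < 1" for x using f0[of x] by (auto simp: loss_def)
  have p: "0 \<le> \<theta> * loss f x" "\<theta> * loss f x \<le> \<theta>" for x
    using l[of x] \<theta> by (auto intro: mult_left_le)
  have pos: "0 < 1 - \<theta> * loss f x" for x using p[of x] \<theta> by linarith
  have "continuous_on UNIV f'" unfolding f'_def
    using pos jump_test_loss[OF f] by (intro continuous_intros) (auto simp: jump_test_def less_le)
  moreover have "0 \<le> f' x" for x using p[of x] pos[of x] by (simp add: f'_def)
  moreover obtain a where "a > 0" "\<And>x. x < a \<Longrightarrow> f x = 0" using f by (auto simp: jump_test_def)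
  then have "\<exists>a>0. \<forall>x<a. f' x = 0" by (intro exI[of _ a]) (auto simp: f'_def loss_def)
  ultimately show "jump_test f'" by (simp add: jump_test_def)
  show "loss f' x = \<theta> * loss f x" using pos[of x] unfolding f'_def loss_def[of "\<lambda>x. - ln (1 - \<theta> * loss f x)"] by simp
  show "\<theta> * loss f x \<le> f' x" using ln_le_minus_one[OF pos[of x]] by (simp add: f'_def)
  have "ln (1 / (1 - \<theta> * loss f x)) \<le> 1 / (1 - \<theta> * loss f x) - 1" using pos[of x] by (intro ln_le_minus_one) simp
  then have "f' x \<le> 1 / (1 - \<theta> * loss f x) - 1" using pos[of x] by (simp add: f'_def ln_div)
  also have "\<dots> = \<theta> * loss f x / (1 - \<theta> * loss f x)" using pos[of x] by (simp add: field_simps)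
  also have "\<dots> \<le> \<theta> * loss f x / (1 - \<theta>)" using p[of x] pos[of x] \<theta> by (intro divide_left_mono mult_pos_pos) auto
  finally show "f' x \<le> \<theta> / (1 - \<theta>) * loss f x" by simp
qed

text \<open>The exponent is the expected total loss.  The thinned functions \<open>f' n\<close> have exponent
  \<open>\<theta> n * A\<close>, because the exponent is a limit of expectations that are linear in the loss.  Dividing
  \<open>E (1 - exp (- Z n)) = 1 - exp (- \<theta> n * A)\<close> by \<open>\<theta> n\<close> and letting \<open>\<theta> n\<close> tend to \<open>0\<close> yields
  \<open>E X = A\<close>: Fatou's lemma gives one inequality and also integrability, the bound
  \<open>1 - exp (- z) \<le> z\<close> the other.\<close>

lemma
  assumes f: "jump_test f" and s: "0 \<le> s" and h: "0 < h"
  shows integrable_loss_jumps: "integrable M (\<lambda>\<omega>. \<integral>x. loss f x \<partial>jumps s (s + h) \<omega>)"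
    and expectation_loss_jumps: "expectation (\<lambda>\<omega>. \<integral>x. loss f x \<partial>jumps s (s + h) \<omega>) = exponent f h"
proof -
  define X where "X \<omega> = (\<integral>x. loss f x \<partial>jumps s (s + h) \<omega>)" for \<omega>
  define A where "A = exponent f h"
  define \<theta> where "\<theta> n = 1 / real (n + 2)" for n
  have \<theta>: "0 < \<theta> n" "\<theta> n < 1" for n by (auto simp: \<theta>_def)
  define f' where "f' n = (\<lambda>x. - ln (1 - \<theta> n * loss f x))" for n
  have f': "jump_test (f' n)" "loss (f' n) x = \<theta> n * loss f x" "\<theta> n * loss f x \<le> f' n x"
    "f' n x \<le> \<theta> n / (1 - \<theta> n) * loss f x" for n x
    using thinned_test[OF f \<theta>[of n]] unfolding f'_def by auto
  define Z where "Z n \<omega> = (\<integral>x. f' n x \<partial>jumps s (s + h) \<omega>)" for n \<omega>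
  have X_meas [measurable]: "X \<in> borel_measurable M"
    unfolding X_def by (rule jump_integral_measurable[OF jump_test_loss[OF f] s h])
  have Z_meas [measurable]: "Z n \<in> borel_measurable M" for n
    unfolding Z_def by (rule jump_integral_measurable[OF f'(1) s h])
  have X0: "0 \<le> X \<omega>" for \<omega> unfolding X_def by (rule jump_integral_nonneg[OF jump_test_loss[OF f]])
  have Z0: "0 \<le> Z n \<omega>" for n \<omega> unfolding Z_def by (rule jump_integral_nonneg[OF f'(1)])
  have XZ: "\<theta> n * X \<omega> \<le> Z n \<omega> \<and> Z n \<omega> \<le> \<theta> n / (1 - \<theta> n) * X \<omega>" if \<omega>: "\<omega> \<in> space M" for n \<omega>
  proof -
    obtain a where a: "a > 0" "\<And>x. x < a \<Longrightarrow> f x = 0" using f by (auto simp: jump_test_def)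
    have l0: "loss f x = 0" if "x < a" for x using a(2)[OF that] by (simp add: loss_def)
    have f'0: "f' n x = 0" if "x < a" for x using l0[OF that] by (simp add: f'_def)
    interpret nondecreasing_path "\<lambda>t. Y t \<omega>" by (rule nondecreasing_path[OF \<omega>])
    have X: "X \<omega> = (\<Sum>u | s < u \<and> u \<le> s + h \<and> a \<le> jump (\<lambda>t. Y t \<omega>) u. loss f (jump (\<lambda>t. Y t \<omega>) u))"
      unfolding X_def jumps_def using jump_test_measurable[OF jump_test_loss[OF f]]
      by (intro integral_jump_measure_on[OF s a(1)] measurable_restrict_space1 l0)
    have Z: "Z n \<omega> = (\<Sum>u | s < u \<and> u \<le> s + h \<and> a \<le> jump (\<lambda>t. Y t \<omega>) u. f' n (jump (\<lambda>t. Y t \<omega>) u))"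
      unfolding Z_def jumps_def using jump_test_measurable[OF f'(1)]
      by (intro integral_jump_measure_on[OF s a(1)] measurable_restrict_space1 f'0)
    show ?thesis unfolding X Z sum_distrib_left by (intro conjI sum_mono f'(3,4))
  qed
  have EZ: "expectation (\<lambda>\<omega>. exp (- Z n \<omega>)) = exp (- (\<theta> n * A))" for n
  proof -
    have "(\<lambda>k. \<theta> n * (real (Suc k) * expectation (\<lambda>\<omega>. loss f (Y (h / real (Suc k)) \<omega>)))) \<longlonglongrightarrow> \<theta> n * A"
      unfolding A_def by (intro tendsto_mult_left exponent_LIMSEQ[OF f s h])
    moreover have "(\<lambda>k. \<theta> n * (real (Suc k) * expectation (\<lambda>\<omega>. loss f (Y (h / real (Suc k)) \<omega>)))) \<longlonglongrightarrow> exponent (f' n) h"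
      using exponent_LIMSEQ[OF f'(1) s h, of n] unfolding f'(2) by (simp add: mult.left_commute del: of_nat_Suc)
    ultimately have "exponent (f' n) h = \<theta> n * A" using LIMSEQ_unique by blast
    then show ?thesis using Laplace_exponent[OF f'(1) s h, of n] by (simp add: Z_def)
  qed
  have Zexp: "integrable M (\<lambda>\<omega>. exp (- Z n \<omega>))" for n
    by (rule integrable_const_bound[of _ 1]) (auto simp: Z0)
  have A0: "0 \<le> A" unfolding A_def by (rule exponent_nonneg[OF f s h])
  have le1: "(1 - exp (- (\<theta> n * A))) / \<theta> n \<le> A" for n
  proof -
    have "1 - exp (- (\<theta> n * A)) \<le> \<theta> n * A" using exp_ge_add_one_self[of "- (\<theta> n * A)"] by linarith
    then show ?thesis using \<theta>[of n] by (simp add: field_simps)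
  qed
  have upper: "(\<integral>\<^sup>+\<omega>. ennreal (X \<omega>) \<partial>M) \<le> ennreal A"
  proof -
    have lim: "(\<lambda>n. (1 - exp (- \<theta> n * x)) / \<theta> n) \<longlonglongrightarrow> x" for x
      unfolding \<theta>_def by (rule tendsto_difference_quotient_exp)
    have "(\<integral>\<^sup>+\<omega>. ennreal (X \<omega>) \<partial>M) = (\<integral>\<^sup>+\<omega>. liminf (\<lambda>n. ennreal ((1 - exp (- \<theta> n * X \<omega>)) / \<theta> n)) \<partial>M)"
      by (intro nn_integral_cong lim_imp_Liminf[symmetric] tendsto_ennrealI lim) simp
    also have "\<dots> \<le> liminf (\<lambda>n. \<integral>\<^sup>+\<omega>. ennreal ((1 - exp (- \<theta> n * X \<omega>)) / \<theta> n) \<partial>M)"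
      by (intro nn_integral_liminf) measurable
    also have "\<dots> \<le> liminf (\<lambda>n. ennreal A)"
    proof (intro Liminf_mono always_eventually allI)
      fix n
      have "(\<integral>\<^sup>+\<omega>. ennreal ((1 - exp (- \<theta> n * X \<omega>)) / \<theta> n) \<partial>M) \<le> (\<integral>\<^sup>+\<omega>. ennreal ((1 - exp (- Z n \<omega>)) / \<theta> n) \<partial>M)"
        using XZ \<theta>[of n] by (intro nn_integral_mono ennreal_leI divide_right_mono) (auto simp: less_imp_le)
      also have "\<dots> = ennreal (expectation (\<lambda>\<omega>. (1 - exp (- Z n \<omega>)) / \<theta> n))"
        using Zexp[of n] Z0 \<theta>[of n] by (intro nn_integral_eq_integral) (auto simp: less_imp_le)
      also have "expectation (\<lambda>\<omega>. (1 - exp (- Z n \<omega>)) / \<theta> n) = (1 - exp (- (\<theta> n * A))) / \<theta> n"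
        using Zexp[of n] by (simp add: EZ prob_space)
      finally show "(\<integral>\<^sup>+\<omega>. ennreal ((1 - exp (- \<theta> n * X \<omega>)) / \<theta> n) \<partial>M) \<le> ennreal A"
        using le1[of n] by (meson ennreal_leI order_trans)
    qed
    also have "\<dots> = ennreal A" by (simp add: Liminf_const)
    finally show ?thesis .
  qed
  have Xint: "integrable M X"
    using upper by (intro integrableI_bounded) (auto simp: X0 intro: le_less_trans)
  then show "integrable M (\<lambda>\<omega>. \<integral>x. loss f x \<partial>jumps s (s + h) \<omega>)" by (simp add: X_def[abs_def])
  have EX: "expectation X \<le> A"
    using upper nn_integral_eq_integral[OF Xint] X0 A0 by simp
  have "A \<le> expectation X"
  proof (rule LIMSEQ_le)
    show "(\<lambda>n. (1 - exp (- \<theta> n * A)) / \<theta> n) \<longlonglongrightarrow> A"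
      unfolding \<theta>_def by (rule tendsto_difference_quotient_exp)
    have "\<theta> \<longlonglongrightarrow> 0" unfolding \<theta>_def using LIMSEQ_ignore_initial_segment[OF lim_1_over_n, of 2] by simp
    then have "(\<lambda>n. 1 / (1 - \<theta> n) * expectation X) \<longlonglongrightarrow> 1 / (1 - 0) * expectation X"
      by (intro tendsto_intros) auto
    then show "(\<lambda>n. 1 / (1 - \<theta> n) * expectation X) \<longlonglongrightarrow> expectation X" by simp
    show "\<exists>N. \<forall>n\<ge>N. (1 - exp (- \<theta> n * A)) / \<theta> n \<le> 1 / (1 - \<theta> n) * expectation X"
    proof (intro exI[of _ 0] allI impI)
      fix n
      have "1 - exp (- \<theta> n * A) = expectation (\<lambda>\<omega>. 1 - exp (- Z n \<omega>))"
        using Zexp[of n] by (simp add: EZ prob_space)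
      also have "\<dots> \<le> expectation (\<lambda>\<omega>. \<theta> n / (1 - \<theta> n) * X \<omega>)"
      proof (rule integral_mono)
        fix \<omega> assume "\<omega> \<in> space M"
        then show "1 - exp (- Z n \<omega>) \<le> \<theta> n / (1 - \<theta> n) * X \<omega>"
          using XZ[of \<omega> n] exp_ge_add_one_self[of "- Z n \<omega>"] by linarith
      qed (use Zexp Xint in auto)
      also have "\<dots> = \<theta> n / (1 - \<theta> n) * expectation X" by simp
      finally show "(1 - exp (- \<theta> n * A)) / \<theta> n \<le> 1 / (1 - \<theta> n) * expectation X"
        using \<theta>[of n] by (simp add: field_simps)
    qed
  qed
  with EX show "expectation (\<lambda>\<omega>. \<integral>x. loss f x \<partial>jumps s (s + h) \<omega>) = exponent f h"
    by (simp add: X_def[abs_def] A_def)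
qed

text \<open>Expected losses over adjacent time intervals add up.\<close>

lemma exponent_linear:
  assumes f: "jump_test f" and t: "0 < t"
  shows "exponent f t = t * exponent f 1"
proof (rule nonneg_additive_linear[OF _ _ t])
  fix s t :: real assume s: "0 < s" and t: "0 < t"
  then have s0: "0 \<le> s" by simp
  have "(\<integral>x. loss f x \<partial>jumps 0 (0 + (s + t)) \<omega>) = (\<integral>x. loss f x \<partial>jumps 0 (0 + s) \<omega>) + (\<integral>x. loss f x \<partial>jumps s (s + t) \<omega>)"
    if \<omega>: "\<omega> \<in> space M" for \<omega>
  proof -
    obtain a where a: "a > 0" "\<And>x. x < a \<Longrightarrow> f x = 0" using f by (auto simp: jump_test_def)
    have l0: "loss f x = 0" if "x < a" for x using a(2)[OF that] by (simp add: loss_def)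
    interpret nondecreasing_path "\<lambda>t. Y t \<omega>" by (rule nondecreasing_path[OF \<omega>])
    have eq: "(\<integral>x. loss f x \<partial>jumps p q \<omega>) = (\<Sum>u | p < u \<and> u \<le> q \<and> a \<le> jump (\<lambda>t. Y t \<omega>) u. loss f (jump (\<lambda>t. Y t \<omega>) u))"
      if "0 \<le> p" for p q
      unfolding jumps_def using jump_test_measurable[OF jump_test_loss[OF f]]
      by (intro integral_jump_measure_on[OF that a(1)] measurable_restrict_space1 l0)
    have split: "{u. 0 < u \<and> u \<le> 0 + (s + t) \<and> a \<le> jump (\<lambda>t. Y t \<omega>) u}
      = {u. 0 < u \<and> u \<le> 0 + s \<and> a \<le> jump (\<lambda>t. Y t \<omega>) u} \<union> {u. s < u \<and> u \<le> s + t \<and> a \<le> jump (\<lambda>t. Y t \<omega>) u}"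
      using s t by auto
    show ?thesis unfolding eq[OF s0] eq[OF order_refl] split
      by (rule sum.union_disjoint) (auto intro!: finite_large_jumps a s0)
  qed
  then have "expectation (\<lambda>\<omega>. \<integral>x. loss f x \<partial>jumps 0 (0 + (s + t)) \<omega>)
      = expectation (\<lambda>\<omega>. (\<integral>x. loss f x \<partial>jumps 0 (0 + s) \<omega>) + (\<integral>x. loss f x \<partial>jumps s (s + t) \<omega>))"
    by (intro Bochner_Integration.integral_cong) auto
  also have "\<dots> = expectation (\<lambda>\<omega>. \<integral>x. loss f x \<partial>jumps 0 (0 + s) \<omega>) + expectation (\<lambda>\<omega>. \<integral>x. loss f x \<partial>jumps s (s + t) \<omega>)"
    using s t by (intro Bochner_Integration.integral_add integrable_loss_jumps f) auto
  finally show "exponent f (s + t) = exponent f s + exponent f t"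
    using s t by (simp only: expectation_loss_jumps[OF f] order_refl s0 add_pos_pos)
next
  show "0 \<le> exponent f t" if "0 < t" for t using exponent_nonneg[OF f order_refl that] .
qed

theorem Laplace_functional_jumps:
  assumes f: "jump_test f" and t: "0 < t"
  shows "expectation (\<lambda>\<omega>. exp (- (\<integral>x. f x \<partial>jumps 0 t \<omega>))) = exp (- t * expectation (\<lambda>\<omega>. \<integral>x. loss f x \<partial>jumps 0 1 \<omega>))"
  using Laplace_exponent[OF f order_refl t] expectation_loss_jumps[OF f order_refl zero_less_one] exponent_linear[OF f t]
  by simp

end

section \<open>Intensity measures\<close>

text \<open>Trapezoidal functions decreasing to the indicator of a closed interval.\<close>

lemma measure_Icc_as_limit:
  assumes \<mu>: "\<mu> \<in> lf_measures" and ab: "0 < a" "a \<le> b"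
  defines "f \<equiv> \<lambda>(n::nat) x. max 0 (1 - (2 * real (Suc n) / a) * max 0 (max (a - x) (x - b)))"
  shows "f n \<in> vague_test" "(\<lambda>n. \<integral>x. f n x \<partial>\<mu>) \<longlonglongrightarrow> measure \<mu> {a..b}"
proof -
  define d where "d x = max 0 (max (a - x) (x - b))" for x
  have f: "f n x = max 0 (1 - (2 * real (Suc n) / a) * d x)" for n x by (simp add: f_def d_def)
  have d0: "0 \<le> d x" for x by (simp add: d_def)
  have c: "2 / a \<le> 2 * real (Suc n) / a" for n using ab by (simp add: divide_right_mono)
  show vt: "f n \<in> vague_test" for n
  proof (rule vague_testI[of _ "a / 2" "b + a / 2"])
    show "continuous_on {0<..} (f n)" unfolding f_def by (intro continuous_intros)
    show "0 \<le> f n x" for x by (simp add: f)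
    fix x assume "x \<notin> {a / 2..b + a / 2}"
    then have "a / 2 \<le> d x" unfolding d_def atLeastAtMost_iff by linarith
    then have "2 / a * (a / 2) \<le> 2 * real (Suc n) / a * d x" using ab by (intro mult_mono c) auto
    then show "f n x = 0" using ab by (simp add: f)
  qed (use ab in auto)
  have le: "f n x \<le> f 0 x" for n x
    using mult_right_mono[OF c[of n] d0[of x]] unfolding f by (intro max.mono) auto
  have lim: "(\<lambda>n. f n x) \<longlonglongrightarrow> indicator {a..b} x" for x
  proof (cases "x \<in> {a..b}")
    case True
    then have "f n x = 1" for n by (simp add: f d_def)
    then show ?thesis using True by simp
  next
    case False
    then have d: "d x > 0" by (auto simp: d_def)
    obtain N where N: "a / (2 * d x) < real N" using reals_Archimedean2 by blast
    have "f n x = 0" if "N \<le> n" for n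
    proof -
      have "a / (2 * d x) \<le> real (Suc n)" using N that by simp
      then have "1 \<le> 2 * real (Suc n) / a * d x" using d ab by (simp add: field_simps del: of_nat_Suc)
      then show ?thesis by (simp add: f)
    qed
    then show ?thesis using False by (intro tendsto_eventually) (auto simp: eventually_sequentially)
  qed
  have set: "{a..b} \<in> sets \<mu>" using ab by (auto simp: sets_lf[OF \<mu>] intro!: compact_pos_sets)
  have "(\<lambda>n. \<integral>x. f n x \<partial>\<mu>) \<longlonglongrightarrow> (\<integral>x. indicator {a..b} x \<partial>\<mu>)"
  proof (rule integral_dominated_convergence[where w="f 0"])
    show "indicator {a..b} \<in> borel_measurable \<mu>" using set by simp
    show "f n \<in> borel_measurable \<mu>" for n
      unfolding measurable_lf[OF \<mu>] by (rule vague_test_measurable[OF vt])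
    show "integrable \<mu> (f 0)" by (rule vague_test_integrable[OF vt \<mu>])
    show "AE x in \<mu>. (\<lambda>n. f n x) \<longlonglongrightarrow> indicator {a..b} x" using lim by simp
    show "AE x in \<mu>. norm (f n x) \<le> f 0 x" for n using le by (auto simp: f)
  qed
  moreover have "{a..b} \<inter> space \<mu> = {a..b}" using ab by (auto simp: space_lf[OF \<mu>])
  ultimately show "(\<lambda>n. \<integral>x. f n x \<partial>\<mu>) \<longlonglongrightarrow> measure \<mu> {a..b}" by simp
qed

lemma emeasure_Icc_finite: "\<mu> \<in> lf_measures \<Longrightarrow> 0 < a \<Longrightarrow> emeasure \<mu> {a..b} < \<infinity>"
proof -
  assume "\<mu> \<in> lf_measures" "0 < a"
  moreover have "compact {a..b} \<and> {a..b} \<subseteq> {0<..}" using \<open>0 < a\<close> by auto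
  ultimately show ?thesis unfolding lf_measures_def by blast
qed

text \<open>Measurability of the integrals of test functions extends to the mass of closed intervals by
  approximation, then to Borel subsets of a compact interval by a Dynkin argument, where all masses are
  finite, and finally to all Borel sets by exhaustion.\<close>

lemma emeasure_kernel_measurable:
  assumes lf: "\<And>\<omega>. \<omega> \<in> space M \<Longrightarrow> \<mu> \<omega> \<in> lf_measures"
    and meas: "\<And>f. f \<in> vague_test \<Longrightarrow> (\<lambda>\<omega>. \<integral>x. f x \<partial>\<mu> \<omega>) \<in> borel_measurable M"
    and A: "A \<in> sets pos_borel"
  shows "(\<lambda>\<omega>. emeasure (\<mu> \<omega>) A) \<in> borel_measurable M"
proof -
  have Icc: "(\<lambda>\<omega>. emeasure (\<mu> \<omega>) {a..b}) \<in> borel_measurable M" if "0 < a" for a b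
  proof (cases "a \<le> b")
    case True
    define f where "f \<equiv> \<lambda>(n::nat) x. max 0 (1 - (2 * real (Suc n) / a) * max 0 (max (a - x) (x - b)))"
    have "(\<lambda>\<omega>. measure (\<mu> \<omega>) {a..b}) \<in> borel_measurable M"
    proof (rule borel_measurable_LIMSEQ_real)
      fix \<omega> assume "\<omega> \<in> space M"
      from measure_Icc_as_limit(2)[OF lf[OF this] that True]
      show "(\<lambda>n. \<integral>x. f n x \<partial>\<mu> \<omega>) \<longlonglongrightarrow> measure (\<mu> \<omega>) {a..b}" by (simp only: f_def)
    next
      fix n
      show "(\<lambda>\<omega>. \<integral>x. f n x \<partial>\<mu> \<omega>) \<in> borel_measurable M"
      proof (cases "space M = {}")
        case False
        then obtain \<omega> where "\<omega> \<in> space M" by blast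
        from measure_Icc_as_limit(1)[OF lf[OF this] that True] show ?thesis unfolding f_def by (rule meas)
      qed (simp add: borel_measurable_iff_less)
    qed
    then have "(\<lambda>\<omega>. ennreal (measure (\<mu> \<omega>) {a..b})) \<in> borel_measurable M" by simp
    then show ?thesis
      by (rule measurable_cong[THEN iffD1, rotated])
        (use emeasure_Icc_finite[OF lf that] in \<open>simp add: emeasure_eq_ennreal_measure less_top[symmetric]\<close>)
  qed simp
  have window: "(\<lambda>\<omega>. emeasure (\<mu> \<omega>) (B \<inter> {c..d})) \<in> borel_measurable M" if c: "0 < c" and "B \<in> sets borel" for B c d
    using that(2)
  proof (induction B rule: borel_set_induct)
    case empty then show ?case by simp
  next
    case (interval a b)
    have "{a..b} \<inter> {c..d} = {max a c..min b d}" by auto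
    then show ?case using Icc[of "max a c" "min b d"] c by simp
  next
    case (compl B)
    have "(\<lambda>\<omega>. emeasure (\<mu> \<omega>) {c..d} - emeasure (\<mu> \<omega>) (B \<inter> {c..d})) \<in> borel_measurable M"
      using Icc[OF c] compl by measurable
    then show ?case
    proof (rule measurable_cong[THEN iffD1, rotated])
      fix \<omega> assume \<omega>: "\<omega> \<in> space M"
      have sets: "{c..d} \<in> sets (\<mu> \<omega>)" "B \<inter> {c..d} \<in> sets (\<mu> \<omega>)"
        using compl(1) c by (auto simp: sets_lf[OF lf[OF \<omega>]] sets_restrict_space_iff)
      have "emeasure (\<mu> \<omega>) (B \<inter> {c..d}) \<le> emeasure (\<mu> \<omega>) {c..d}" using sets by (intro emeasure_mono) auto
      then have "emeasure (\<mu> \<omega>) (B \<inter> {c..d}) \<noteq> \<infinity>" using emeasure_Icc_finite[OF lf[OF \<omega>] c, of d] by (auto simp: top_unique)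
      then have "emeasure (\<mu> \<omega>) ({c..d} - B \<inter> {c..d}) = emeasure (\<mu> \<omega>) {c..d} - emeasure (\<mu> \<omega>) (B \<inter> {c..d})"
        using sets by (intro emeasure_Diff) auto
      moreover have "{c..d} - B \<inter> {c..d} = - B \<inter> {c..d}" by auto
      ultimately show "emeasure (\<mu> \<omega>) {c..d} - emeasure (\<mu> \<omega>) (B \<inter> {c..d}) = emeasure (\<mu> \<omega>) (- B \<inter> {c..d})" by simp
    qed
  next
    case (union B)
    have "(\<lambda>\<omega>. \<Sum>i. emeasure (\<mu> \<omega>) (B i \<inter> {c..d})) \<in> borel_measurable M"
      using union by measurable
    then show ?case
    proof (rule measurable_cong[THEN iffD1, rotated])
      fix \<omega> assume \<omega>: "\<omega> \<in> space M"
      have "range (\<lambda>i. B i \<inter> {c..d}) \<subseteq> sets (\<mu> \<omega>)"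
        using union(2) c by (auto simp: sets_lf[OF lf[OF \<omega>]] sets_restrict_space_iff)
      moreover have "disjoint_family (\<lambda>i. B i \<inter> {c..d})" using union(1) by (auto simp: disjoint_family_on_def)
      ultimately have "(\<Sum>i. emeasure (\<mu> \<omega>) (B i \<inter> {c..d})) = emeasure (\<mu> \<omega>) (\<Union>i. B i \<inter> {c..d})"
        by (rule suminf_emeasure)
      moreover have "(\<Union>i. B i \<inter> {c..d}) = (\<Union>i. B i) \<inter> {c..d}" by blast
      ultimately show "(\<Sum>i. emeasure (\<mu> \<omega>) (B i \<inter> {c..d})) = emeasure (\<mu> \<omega>) ((\<Union>i. B i) \<inter> {c..d})" by simp
    qed
  qed
  define W :: "nat \<Rightarrow> real set" where "W n = {1 / real (Suc n)..real (Suc n)}" for n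
  have A': "A \<in> sets borel" "A \<subseteq> {0<..}" using A by (auto simp: sets_restrict_space_iff)
  have "(\<lambda>\<omega>. SUP n. emeasure (\<mu> \<omega>) (A \<inter> W n)) \<in> borel_measurable M"
    using window[OF _ A'(1)] by (intro borel_measurable_SUP) (auto simp: W_def)
  then show ?thesis
  proof (rule measurable_cong[THEN iffD1, rotated])
    fix \<omega> assume \<omega>: "\<omega> \<in> space M"
    have Winc: "W m \<subseteq> W n" if "m \<le> n" for m n
      using that by (auto simp: W_def intro: order_trans[rotated] frac_le)
    have "range (\<lambda>n. A \<inter> W n) \<subseteq> sets (\<mu> \<omega>)"
      using A' by (auto simp: sets_lf[OF lf[OF \<omega>]] sets_restrict_space_iff W_def)
    moreover have "incseq (\<lambda>n. A \<inter> W n)" using Winc by (auto simp: incseq_def)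
    ultimately have "(SUP n. emeasure (\<mu> \<omega>) (A \<inter> W n)) = emeasure (\<mu> \<omega>) (\<Union>n. A \<inter> W n)"
      by (rule SUP_emeasure_incseq)
    also have "(\<Union>n. A \<inter> W n) = A"
    proof (intro equalityI subsetI)
      fix x assume x: "x \<in> A"
      then have x0: "0 < x" using A' by auto
      obtain n where n: "max x (1 / x) < real n" using reals_Archimedean2 by blast
      then have "1 / real (Suc n) \<le> x" using x0 by (simp add: field_simps)
      then have "x \<in> W n" using n by (auto simp: W_def)
      then show "x \<in> (\<Union>n. A \<inter> W n)" using x by blast
    qed blast
    finally show "(SUP n. emeasure (\<mu> \<omega>) (A \<inter> W n)) = emeasure (\<mu> \<omega>) A" .
  qed
qed

text \<open>Campbell's formula: if \<open>\<Lambda>\<close> is the mean of the random measure \<open>\<mu>\<close> on sets, then also on nonnegative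
  functions.  Measurability of the inner integral comes out of the same induction.\<close>

lemma nn_integral_kernel:
  assumes lf: "\<And>\<omega>. \<omega> \<in> space M \<Longrightarrow> sets (\<mu> \<omega>) = sets pos_borel"
    and meas: "\<And>A. A \<in> sets pos_borel \<Longrightarrow> (\<lambda>\<omega>. emeasure (\<mu> \<omega>) A) \<in> borel_measurable M"
    and f: "f \<in> borel_measurable pos_borel"
  shows "(\<lambda>\<omega>. \<integral>\<^sup>+x. f x \<partial>\<mu> \<omega>) \<in> borel_measurable M \<and>
    (\<forall>\<Lambda>. sets \<Lambda> = sets pos_borel \<longrightarrow> (\<forall>A\<in>sets pos_borel. emeasure \<Lambda> A = (\<integral>\<^sup>+\<omega>. emeasure (\<mu> \<omega>) A \<partial>M)) \<longrightarrow>
      (\<integral>\<^sup>+x. f x \<partial>\<Lambda>) = (\<integral>\<^sup>+\<omega>. (\<integral>\<^sup>+x. f x \<partial>\<mu> \<omega>) \<partial>M))"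
proof -
  have bm: "borel_measurable (\<mu> \<omega>) = (borel_measurable pos_borel :: (real \<Rightarrow> ennreal) set)" if "\<omega> \<in> space M" for \<omega>
    by (intro measurable_cong_sets lf that refl)
  have sp: "space (\<mu> \<omega>) = {0<..}" if "\<omega> \<in> space M" for \<omega>
    using sets_eq_imp_space_eq[OF lf[OF that]] by (simp add: space_pos_borel)
  have bm': "borel_measurable \<Lambda> = (borel_measurable pos_borel :: (real \<Rightarrow> ennreal) set)" and sp': "space \<Lambda> = {0<..}"
    if "sets \<Lambda> = sets pos_borel" for \<Lambda> :: "real measure"
    using sets_eq_imp_space_eq[OF that] by (auto simp: space_pos_borel intro!: measurable_cong_sets that)
  show ?thesis
    using f
  proof (induction f rule: borel_measurable_induct)
    case (cong f g)
    have "(\<integral>\<^sup>+x. f x \<partial>\<mu> \<omega>) = (\<integral>\<^sup>+x. g x \<partial>\<mu> \<omega>)" if "\<omega> \<in> space M" for \<omega>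
      using cong(3) by (intro nn_integral_cong) (simp add: sp[OF that] space_pos_borel)
    moreover have "(\<integral>\<^sup>+x. f x \<partial>\<Lambda>) = (\<integral>\<^sup>+x. g x \<partial>\<Lambda>)" if "sets \<Lambda> = sets pos_borel" for \<Lambda> :: "real measure"
      using cong(3) by (intro nn_integral_cong) (simp add: sp'[OF that] space_pos_borel)
    ultimately show ?case using cong(4) by (simp cong: measurable_cong nn_integral_cong)
  next
    case (set A)
    have "(\<integral>\<^sup>+x. indicator A x \<partial>\<mu> \<omega>) = emeasure (\<mu> \<omega>) A" if "\<omega> \<in> space M" for \<omega>
      using set by (simp add: lf[OF that])
    then show ?case using set meas[OF set] by (simp cong: measurable_cong nn_integral_cong)
  next
    case (mult u c)
    have "(\<integral>\<^sup>+x. c * u x \<partial>\<mu> \<omega>) = c * (\<integral>\<^sup>+x. u x \<partial>\<mu> \<omega>)" if "\<omega> \<in> space M" for \<omega>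
      using mult(2) by (intro nn_integral_cmult) (simp add: bm[OF that])
    moreover have "(\<integral>\<^sup>+x. c * u x \<partial>\<Lambda>) = c * (\<integral>\<^sup>+x. u x \<partial>\<Lambda>)" if "sets \<Lambda> = sets pos_borel" for \<Lambda> :: "real measure"
      using mult(2) by (intro nn_integral_cmult) (simp add: bm'[OF that])
    moreover have "(\<lambda>\<omega>. c * (\<integral>\<^sup>+x. u x \<partial>\<mu> \<omega>)) \<in> borel_measurable M"
      using mult(4) by (intro borel_measurable_times_ennreal borel_measurable_const) blast
    ultimately show ?case using mult by (simp add: nn_integral_cmult cong: measurable_cong nn_integral_cong)
  next
    case (add u v)
    have "(\<integral>\<^sup>+x. v x + u x \<partial>\<mu> \<omega>) = (\<integral>\<^sup>+x. v x \<partial>\<mu> \<omega>) + (\<integral>\<^sup>+x. u x \<partial>\<mu> \<omega>)" if "\<omega> \<in> space M" for \<omega>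
      using add by (intro nn_integral_add) (simp_all add: bm[OF that])
    moreover have "(\<integral>\<^sup>+x. v x + u x \<partial>\<Lambda>) = (\<integral>\<^sup>+x. v x \<partial>\<Lambda>) + (\<integral>\<^sup>+x. u x \<partial>\<Lambda>)" if "sets \<Lambda> = sets pos_borel" for \<Lambda> :: "real measure"
      using add by (intro nn_integral_add) (simp_all add: bm'[OF that])
    moreover have "(\<lambda>\<omega>. (\<integral>\<^sup>+x. v x \<partial>\<mu> \<omega>) + (\<integral>\<^sup>+x. u x \<partial>\<mu> \<omega>)) \<in> borel_measurable M"
      using add by (intro borel_measurable_add) blast+
    ultimately show ?case using add by (simp add: nn_integral_add cong: measurable_cong nn_integral_cong)
  next
    case (seq U)
    have eq: "(\<integral>\<^sup>+x. (SUP i. U i) x \<partial>\<mu> \<omega>) = (SUP i. \<integral>\<^sup>+x. U i x \<partial>\<mu> \<omega>)" if "\<omega> \<in> space M" for \<omega>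
      using seq unfolding SUP_apply by (intro nn_integral_monotone_convergence_SUP) (simp_all add: bm[OF that])
    have eq': "(\<integral>\<^sup>+x. (SUP i. U i) x \<partial>\<Lambda>) = (SUP i. \<integral>\<^sup>+x. U i x \<partial>\<Lambda>)" if "sets \<Lambda> = sets pos_borel" for \<Lambda> :: "real measure"
      using seq unfolding SUP_apply by (intro nn_integral_monotone_convergence_SUP) (simp_all add: bm'[OF that])
    have inc: "incseq (\<lambda>i \<omega>. \<integral>\<^sup>+x. U i x \<partial>\<mu> \<omega>)"
      using \<open>incseq U\<close> by (auto simp: incseq_def le_fun_def intro!: nn_integral_mono)
    have "(\<integral>\<^sup>+\<omega>. (SUP i. \<integral>\<^sup>+x. U i x \<partial>\<mu> \<omega>) \<partial>M) = (SUP i. \<integral>\<^sup>+\<omega>. (\<integral>\<^sup>+x. U i x \<partial>\<mu> \<omega>) \<partial>M)"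
      using seq.IH inc by (intro nn_integral_monotone_convergence_SUP) auto
    moreover have "(\<lambda>\<omega>. SUP i. \<integral>\<^sup>+x. U i x \<partial>\<mu> \<omega>) \<in> borel_measurable M"
      using seq.IH by (intro borel_measurable_SUP) auto
    ultimately show ?case using seq.IH by (simp add: eq eq' del: SUP_apply Sup_apply cong: measurable_cong nn_integral_cong)
  qed
qed

lemma vague_test_extension:
  assumes f: "f \<in> vague_test"
  obtains F where "jump_test F" "F \<in> vague_test" "loss F \<in> vague_test" "\<And>x. 0 < x \<Longrightarrow> F x = f x"
proof -
  obtain F a b where F: "continuous_on UNIV F" "\<And>x::real. 0 \<le> F x" and ab: "0 < a" "a \<le> b"
    and F0: "\<And>x. x \<notin> {a..b} \<Longrightarrow> F x = 0" and Ff: "\<And>x. 0 < x \<Longrightarrow> F x = f x"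
    by (rule vague_testE[OF f]) (erule that; blast)
  have 1: "jump_test F" unfolding jump_test_def using F F0 ab by (auto intro!: exI[of _ a])
  have 2: "F \<in> vague_test" by (rule vague_testI[OF _ F(2) ab(1) F0]) (auto intro: continuous_on_subset[OF F(1)])
  have 3: "loss F \<in> vague_test"
  proof (rule vague_testI[OF _ _ ab(1)])
    show "continuous_on {0<..} (loss F)" unfolding loss_def
      by (intro continuous_intros continuous_on_subset[OF F(1)]) auto
    show "0 \<le> loss F x" for x using F(2)[of x] by (simp add: loss_def)
    show "loss F x = 0" if "x \<notin> {a..b}" for x using F0[OF that] by (simp add: loss_def)
  qed
  show thesis by (rule that[OF 1 2 3 Ff])
qed

lemma integral_cong_lf:
  assumes "\<mu> \<in> lf_measures" "\<And>x. 0 < x \<Longrightarrow> f x = g x"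
  shows "(\<integral>x. f x \<partial>\<mu>) = (\<integral>x. g x \<partial>\<mu>)"
  by (rule Bochner_Integration.integral_cong) (simp_all add: space_lf[OF assms(1)] assms(2))

context subordinator
begin

lemma vague_jump_integral_measurable:
  assumes f: "f \<in> vague_test" and s: "0 \<le> s" and h: "0 < h"
  shows "(\<lambda>\<omega>. \<integral>x. f x \<partial>jumps s (s + h) \<omega>) \<in> borel_measurable M"
proof -
  obtain F where F: "jump_test F" "\<And>x. 0 < x \<Longrightarrow> F x = f x" using vague_test_extension[OF f] by metis
  show ?thesis
    by (rule measurable_cong[THEN iffD1, OF _ jump_integral_measurable[OF F(1) s h]])
      (rule integral_cong_lf[OF jumps_lf[OF s] F(2)])
qed

lemma emeasure_jumps_measurable:
  assumes "0 < t" "A \<in> sets pos_borel"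
  shows "(\<lambda>\<omega>. emeasure (jumps 0 t \<omega>) A) \<in> borel_measurable M"
  using vague_jump_integral_measurable[of _ 0 t] assms
  by (intro emeasure_kernel_measurable jumps_lf) auto

lemma nn_integral_jumps_measurable:
  assumes "0 < t" "f \<in> borel_measurable pos_borel"
  shows "(\<lambda>\<omega>. \<integral>\<^sup>+x. f x \<partial>jumps 0 t \<omega>) \<in> borel_measurable M"
  using nn_integral_kernel[of M "jumps 0 t" f] emeasure_jumps_measurable[OF assms(1)] assms(2) sets_lf[OF jumps_lf]
  by auto

text \<open>By linearity in time the exponent is \<open>t\<close> times the expected loss over the time interval \<open>(0, 1]\<close>, and
  the Levy measure is by definition the mean of the jump measure of this interval.\<close>

theorem Laplace_functional_levy_measure:
  assumes \<sigma>: "levy_measure_of M Y \<sigma>" and f: "f \<in> vague_test" and t: "0 < t"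
  shows "integrable \<sigma> (\<lambda>x. 1 - exp (- f x))"
    and "expectation (\<lambda>\<omega>. exp (- (\<integral>x. f x \<partial>jumps 0 t \<omega>))) = exp (- t * (\<integral>x. 1 - exp (- f x) \<partial>\<sigma>))"
proof -
  obtain F where F: "jump_test F" "F \<in> vague_test" "loss F \<in> vague_test" "\<And>x. 0 < x \<Longrightarrow> F x = f x"
    by (rule vague_test_extension[OF f]) (erule that; blast)
  have sets: "sets \<sigma> = sets pos_borel" using \<sigma> by (simp add: levy_measure_of_def)
  then have sp: "space \<sigma> = {0<..}" using sets_eq_imp_space_eq[OF sets] by (simp add: space_pos_borel)
  have Fm: "loss F \<in> borel_measurable pos_borel" by (rule vague_test_measurable[OF F(3)])
  then have Fm\<sigma>: "loss F \<in> borel_measurable \<sigma>" using measurable_cong_sets[OF sets refl] by blast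
  have l0: "0 \<le> loss F x" for x using F(1) by (simp add: jump_test_def loss_def)
  have em: "emeasure \<sigma> A = (\<integral>\<^sup>+\<omega>. emeasure (jumps 0 1 \<omega>) A \<partial>M)" if "A \<in> sets pos_borel" for A
    using \<sigma> that by (simp add: levy_measure_of_def jumps_def jump_measure_conv_on)
  have "(\<integral>\<^sup>+x. loss F x \<partial>\<sigma>) = (\<integral>\<^sup>+\<omega>. (\<integral>\<^sup>+x. loss F x \<partial>jumps 0 1 \<omega>) \<partial>M)"
    using nn_integral_kernel[of M "jumps 0 1" "\<lambda>x. ennreal (loss F x)"] emeasure_jumps_measurable[OF zero_less_one]
      sets_lf[OF jumps_lf[OF order_refl]] Fm sets em by simp
  also have "\<dots> = (\<integral>\<^sup>+\<omega>. ennreal (\<integral>x. loss F x \<partial>jumps 0 1 \<omega>) \<partial>M)"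
    using jumps_lf[OF order_refl] l0
    by (intro nn_integral_cong nn_integral_eq_integral vague_test_integrable[OF F(3)]) auto
  also have "\<dots> = ennreal (expectation (\<lambda>\<omega>. \<integral>x. loss F x \<partial>jumps 0 1 \<omega>))"
    using integrable_loss_jumps[OF F(1) order_refl zero_less_one]
    by (intro nn_integral_eq_integral) (auto simp: l0)
  finally have nn: "(\<integral>\<^sup>+x. loss F x \<partial>\<sigma>) = ennreal (expectation (\<lambda>\<omega>. \<integral>x. loss F x \<partial>jumps 0 1 \<omega>))" .
  have E0: "0 \<le> expectation (\<lambda>\<omega>. \<integral>x. loss F x \<partial>jumps 0 1 \<omega>)" by (intro integral_nonneg_AE AE_I2) (simp add: l0)
  have int: "integrable \<sigma> (loss F)"
    using Fm\<sigma> nn by (intro integrableI_nonneg) (auto simp: l0)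
  have cong: "loss F x = 1 - exp (- f x)" if "x \<in> space \<sigma>" for x using F(4)[of x] that by (simp add: sp loss_def)
  show "integrable \<sigma> (\<lambda>x. 1 - exp (- f x))"
    using Bochner_Integration.integrable_cong[OF refl, of \<sigma> "loss F" "\<lambda>x. 1 - exp (- f x)"] cong int by blast
  have "(\<integral>x. 1 - exp (- f x) \<partial>\<sigma>) = (\<integral>x. loss F x \<partial>\<sigma>)"
    by (rule Bochner_Integration.integral_cong) (simp_all add: cong)
  also have "\<dots> = enn2real (\<integral>\<^sup>+x. loss F x \<partial>\<sigma>)"
    using Fm\<sigma> by (intro integral_eq_nn_integral) (auto simp: l0)
  also have "\<dots> = expectation (\<lambda>\<omega>. \<integral>x. loss F x \<partial>jumps 0 1 \<omega>)" using nn E0 by simp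
  finally have 1: "(\<integral>x. 1 - exp (- f x) \<partial>\<sigma>) = expectation (\<lambda>\<omega>. \<integral>x. loss F x \<partial>jumps 0 1 \<omega>)" .
  have "expectation (\<lambda>\<omega>. exp (- (\<integral>x. f x \<partial>jumps 0 t \<omega>))) = expectation (\<lambda>\<omega>. exp (- (\<integral>x. F x \<partial>jumps 0 t \<omega>)))"
    using integral_cong_lf[OF jumps_lf[OF order_refl] F(4)] by (intro Bochner_Integration.integral_cong) auto
  also have "\<dots> = exp (- t * (\<integral>x. 1 - exp (- f x) \<partial>\<sigma>))"
    unfolding 1 by (rule Laplace_functional_jumps[OF F(1) t])
  finally show "expectation (\<lambda>\<omega>. exp (- (\<integral>x. f x \<partial>jumps 0 t \<omega>))) = exp (- t * (\<integral>x. 1 - exp (- f x) \<partial>\<sigma>))" .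
qed

end

section \<open>Scaling limit of the small jumps in the Levy measure\<close>

definition small_jump_mass :: "real measure \<Rightarrow> real \<Rightarrow> real" where
  "small_jump_mass \<sigma> \<epsilon> = (LINT x:{0<..\<epsilon>}|\<sigma>. x)"

text \<open>The hypothesis on the small jumps, as a condition on the measure \<open>\<sigma>\<close> alone.\<close>

locale dickman_domain =
  fixes \<sigma> :: "real measure" and c :: real
  assumes sets_\<sigma>: "sets \<sigma> = sets pos_borel" and c: "0 < c"
    and small_jumps: "((\<lambda>\<epsilon>. (1 / \<epsilon>) * small_jump_mass \<sigma> \<epsilon>) \<longlongrightarrow> c) (at_right 0)"
begin

lemma space_\<sigma>: "space \<sigma> = {0<..}"
  using sets_eq_imp_space_eq[OF sets_\<sigma>] by (simp add: space_pos_borel)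

lemma borel_measurable_\<sigma>: "f \<in> borel_measurable borel \<Longrightarrow> f \<in> borel_measurable \<sigma>"
  using measurable_cong_sets[OF sets_\<sigma> refl] measurable_restrict_space1 by blast

lemma sets_Ioc [measurable]: "{0<..r} \<in> sets \<sigma>"
  by (auto simp: sets_\<sigma> sets_restrict_space_iff)

text \<open>The Lebesgue integral of a function that is not integrable is \<open>0\<close> by convention.  Since the limit \<open>c\<close> is
  positive, integrability near \<open>0\<close> is part of the hypothesis.\<close>

lemma threshold:
  obtains \<epsilon>0 where "0 < \<epsilon>0" "\<And>\<epsilon>. \<epsilon> \<le> \<epsilon>0 \<Longrightarrow> set_integrable \<sigma> {0<..\<epsilon>} (\<lambda>x. x)"
    "\<And>\<epsilon>. 0 < \<epsilon> \<Longrightarrow> \<epsilon> \<le> \<epsilon>0 \<Longrightarrow> 0 < small_jump_mass \<sigma> \<epsilon>"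
proof -
  have "\<forall>\<^sub>F \<epsilon> in at_right 0. 0 < (1 / \<epsilon>) * small_jump_mass \<sigma> \<epsilon>"
    using small_jumps c by (rule order_tendstoD)
  then obtain b where b: "0 < b" "\<And>\<epsilon>. 0 < \<epsilon> \<Longrightarrow> \<epsilon> < b \<Longrightarrow> 0 < (1 / \<epsilon>) * small_jump_mass \<sigma> \<epsilon>"
    unfolding eventually_at_right[OF zero_less_one] by blast
  have pos: "0 < small_jump_mass \<sigma> \<epsilon>" if "0 < \<epsilon>" "\<epsilon> \<le> b / 2" for \<epsilon>
    using b(1) b(2)[of \<epsilon>] that by (simp add: zero_less_divide_iff)
  have "0 < b / 2" using b by simp
  then have "set_integrable \<sigma> {0<..b / 2} (\<lambda>x. x)"
    using pos[of "b / 2"] not_integrable_integral_eq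
    unfolding small_jump_mass_def set_lebesgue_integral_def set_integrable_def by force
  then have int: "set_integrable \<sigma> {0<..\<epsilon>} (\<lambda>x. x)" if "\<epsilon> \<le> b / 2" for \<epsilon>
    by (rule set_integrable_subset[OF _ sets_Ioc]) (use that in auto)
  show thesis by (rule that[OF \<open>0 < b / 2\<close> int pos])
qed

lemma small_jump_mass_scaled:
  assumes "0 < r"
  shows "((\<lambda>\<epsilon>. small_jump_mass \<sigma> (r * \<epsilon>) / \<epsilon>) \<longlongrightarrow> c * r) (at_right 0)"
proof -
  have "filterlim (\<lambda>\<epsilon>. r * \<epsilon>) (at_right 0) (at_right 0)"
    unfolding filterlim_at using assms
    by (auto intro!: tendsto_eq_intros simp: eventually_at_filter)
  from filterlim_compose[OF small_jumps this]
  have "((\<lambda>\<epsilon>. r * (1 / (r * \<epsilon>) * small_jump_mass \<sigma> (r * \<epsilon>))) \<longlongrightarrow> r * c) (at_right 0)"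
    by (rule tendsto_mult_left)
  then show ?thesis using assms by (simp add: mult.commute)
qed

text \<open>The measure \<open>x \<sigma>(dx)\<close> on \<open>(0, b \<epsilon>]\<close>, normalised and rescaled to \<open>(0, b]\<close>.\<close>

definition scaled_law :: "real \<Rightarrow> real \<Rightarrow> real measure" where
  "scaled_law b \<epsilon> = distr (density \<sigma> (\<lambda>x. ennreal (indicator {0<..b * \<epsilon>} x * x / small_jump_mass \<sigma> (b * \<epsilon>)))) borel (\<lambda>x. x / \<epsilon>)"

definition uniform_law :: "real \<Rightarrow> real measure" where
  "uniform_law b = density lborel (\<lambda>x. ennreal (indicator {0<..b} x / b))"

lemma integral_scaled_law:
  assumes \<phi>: "\<phi> \<in> borel_measurable borel" and m: "0 < small_jump_mass \<sigma> (b * \<epsilon>)"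
  shows "(\<integral>x. \<phi> x \<partial>scaled_law b \<epsilon>) = (\<integral>x. indicator {0<..b * \<epsilon>} x * x * \<phi> (x / \<epsilon>) \<partial>\<sigma>) / small_jump_mass \<sigma> (b * \<epsilon>)"
proof -
  have 1: "(\<lambda>x. x / \<epsilon>) \<in> borel_measurable \<sigma>" "(\<lambda>x. \<phi> (x / \<epsilon>)) \<in> borel_measurable \<sigma>"
    "(\<lambda>x. indicator {0<..b * \<epsilon>} x * x / small_jump_mass \<sigma> (b * \<epsilon>)) \<in> borel_measurable \<sigma>"
    using \<phi> by (auto intro!: borel_measurable_\<sigma>)
  have "(\<integral>x. \<phi> x \<partial>scaled_law b \<epsilon>) = (\<integral>x. \<phi> (x / \<epsilon>) \<partial>density \<sigma> (\<lambda>x. ennreal (indicator {0<..b * \<epsilon>} x * x / small_jump_mass \<sigma> (b * \<epsilon>))))"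
    unfolding scaled_law_def using 1 \<phi> by (intro integral_distr) auto
  also have "\<dots> = (\<integral>x. indicator {0<..b * \<epsilon>} x * x / small_jump_mass \<sigma> (b * \<epsilon>) * \<phi> (x / \<epsilon>) \<partial>\<sigma>)"
    using 1 m by (subst integral_density) (auto simp: space_\<sigma> indicator_def)
  finally show ?thesis by (simp flip: Bochner_Integration.integral_divide)
qed

lemma integral_uniform_law:
  assumes "\<phi> \<in> borel_measurable borel" "0 < b"
  shows "(\<integral>x. \<phi> x \<partial>uniform_law b) = (LBINT x:{0<..b}. \<phi> x) / b"
proof -
  have "(\<integral>x. \<phi> x \<partial>uniform_law b) = (\<integral>x. indicator {0<..b} x / b * \<phi> x \<partial>lborel)"
    unfolding uniform_law_def using assms by (subst integral_density) (auto simp: indicator_def)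
  then show ?thesis unfolding set_lebesgue_integral_def by (simp flip: Bochner_Integration.integral_divide)
qed

lemma real_distribution_scaled_law:
  assumes m: "0 < small_jump_mass \<sigma> (b * \<epsilon>)"
  shows "real_distribution (scaled_law b \<epsilon>)"
proof -
  have meas: "(\<lambda>x. indicator {0<..b * \<epsilon>} x * x / small_jump_mass \<sigma> (b * \<epsilon>)) \<in> borel_measurable \<sigma>"
    by (auto intro!: borel_measurable_\<sigma>)
  have int: "integrable \<sigma> (\<lambda>x. indicator {0<..b * \<epsilon>} x * x)"
    using m not_integrable_integral_eq unfolding small_jump_mass_def set_lebesgue_integral_def by force
  have "emeasure (density \<sigma> (\<lambda>x. ennreal (indicator {0<..b * \<epsilon>} x * x / small_jump_mass \<sigma> (b * \<epsilon>)))) (space \<sigma>)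
    = (\<integral>\<^sup>+x. ennreal (indicator {0<..b * \<epsilon>} x * x / small_jump_mass \<sigma> (b * \<epsilon>)) \<partial>\<sigma>)"
    using meas by (subst emeasure_density) (auto intro!: nn_integral_cong)
  also have "\<dots> = ennreal (\<integral>x. indicator {0<..b * \<epsilon>} x * x / small_jump_mass \<sigma> (b * \<epsilon>) \<partial>\<sigma>)"
    using int m by (intro nn_integral_eq_integral) (auto simp: space_\<sigma> indicator_def)
  also have "(\<integral>x. indicator {0<..b * \<epsilon>} x * x / small_jump_mass \<sigma> (b * \<epsilon>) \<partial>\<sigma>) = 1"
    using m by (simp add: small_jump_mass_def set_lebesgue_integral_def)
  finally interpret prob_space "density \<sigma> (\<lambda>x. ennreal (indicator {0<..b * \<epsilon>} x * x / small_jump_mass \<sigma> (b * \<epsilon>)))"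
    by (intro prob_spaceI) simp
  have "(\<lambda>x. x / \<epsilon>) \<in> borel_measurable \<sigma>" by (auto intro!: borel_measurable_\<sigma>)
  then show ?thesis unfolding scaled_law_def by (intro real_distribution_distr) simp
qed

lemma real_distribution_uniform_law:
  assumes "0 < b"
  shows "real_distribution (uniform_law b)"
proof -
  have "emeasure (uniform_law b) UNIV = (\<integral>\<^sup>+x. ennreal (indicator {0<..b} x / b) \<partial>lborel)"
    unfolding uniform_law_def by (subst emeasure_density) auto
  also have "\<dots> = (\<integral>\<^sup>+x. ennreal (1 / b) * indicator {0<..b} x \<partial>lborel)"
    by (intro nn_integral_cong) (auto simp: indicator_def)
  also have "\<dots> = ennreal (1 / b) * ennreal b" using assms by (subst nn_integral_cmult_indicator) auto
  also have "\<dots> = 1" using assms by (simp flip: ennreal_mult)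
  finally show ?thesis
    by (intro real_distribution.intro prob_spaceI real_distribution_axioms.intro) (auto simp: uniform_law_def)
qed

lemma cdf_scaled_law:
  assumes m: "0 < small_jump_mass \<sigma> (b * \<epsilon>)" and \<epsilon>: "0 < \<epsilon>" and b: "0 < b"
  shows "cdf (scaled_law b \<epsilon>) x = (if x \<le> 0 then 0 else small_jump_mass \<sigma> (min b x * \<epsilon>) / small_jump_mass \<sigma> (b * \<epsilon>))"
proof -
  interpret P: real_distribution "scaled_law b \<epsilon>" by (rule real_distribution_scaled_law[OF m])
  have "cdf (scaled_law b \<epsilon>) x = (\<integral>z. indicator {..x} z \<partial>scaled_law b \<epsilon>)"
    using P.borel_UNIV by (simp add: cdf_def)
  also have "\<dots> = (\<integral>z. indicator {0<..b * \<epsilon>} z * z * indicator {..x} (z / \<epsilon>) \<partial>\<sigma>) / small_jump_mass \<sigma> (b * \<epsilon>)"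
    by (rule integral_scaled_law[OF _ m]) simp
  also have "(\<integral>z. indicator {0<..b * \<epsilon>} z * z * indicator {..x} (z / \<epsilon>) \<partial>\<sigma>) = (if x \<le> 0 then 0 else small_jump_mass \<sigma> (min b x * \<epsilon>))"
  proof (cases "x \<le> 0")
    case True
    have "indicator {0<..b * \<epsilon>} z * z * indicator {..x} (z / \<epsilon>) = (0::real)" for z
      using True \<epsilon> by (auto simp: indicator_def field_simps) (smt (verit) mult_nonneg_nonpos)
    then have "(\<integral>z. indicator {0<..b * \<epsilon>} z * z * indicator {..x} (z / \<epsilon>) \<partial>\<sigma>) = (\<integral>z. 0 \<partial>\<sigma>)"
      by (intro Bochner_Integration.integral_cong refl)
    then show ?thesis using True by simp
  next
    case False
    have "indicator {0<..b * \<epsilon>} z * z * indicator {..x} (z / \<epsilon>) = indicator {0<..min b x * \<epsilon>} z * z" for z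
      using \<epsilon> by (auto simp: indicator_def pos_divide_le_eq min_mult_distrib_right)
    then have "(\<integral>z. indicator {0<..b * \<epsilon>} z * z * indicator {..x} (z / \<epsilon>) \<partial>\<sigma>) = (\<integral>z. indicator {0<..min b x * \<epsilon>} z * z \<partial>\<sigma>)"
      by (intro Bochner_Integration.integral_cong refl)
    then show ?thesis using False by (simp add: small_jump_mass_def set_lebesgue_integral_def)
  qed
  finally show ?thesis by simp
qed

lemma cdf_uniform_law:
  assumes b: "0 < b"
  shows "cdf (uniform_law b) x = (if x \<le> 0 then 0 else min b x / b)"
proof -
  interpret P: real_distribution "uniform_law b" by (rule real_distribution_uniform_law[OF b])
  have "cdf (uniform_law b) x = (\<integral>z. indicator {..x} z \<partial>uniform_law b)"
    using P.borel_UNIV by (simp add: cdf_def)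
  also have "\<dots> = (LBINT z:{0<..b}. indicator {..x} z) / b" by (rule integral_uniform_law[OF _ b]) simp
  also have "(LBINT z:{0<..b}. indicator {..x} z) = (\<integral>z. indicator {0<..min b x} z \<partial>lborel)"
    unfolding set_lebesgue_integral_def by (intro Bochner_Integration.integral_cong) (auto simp: indicator_def)
  also have "\<dots> = (if x \<le> 0 then 0 else min b x)" using b by simp
  finally show ?thesis by simp
qed

text \<open>The distribution function of the scaled law at \<open>x \<in> (0, b]\<close> is the mass of \<open>(0, x \<epsilon>]\<close> divided by that of
  \<open>(0, b \<epsilon>]\<close>, which tends to \<open>x / b\<close>.  So the scaled laws converge weakly to the uniform law on \<open>(0, b]\<close>, and
  undoing the normalisation gives the factor \<open>c\<close>.\<close>

theorem tendsto_integral_small_jumps: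
  assumes b: "0 < b" and H: "\<And>x. isCont H x" "\<And>x. \<bar>H x\<bar> \<le> (B::real)"
  shows "((\<lambda>\<epsilon>. \<integral>x. indicator {0<..b * \<epsilon>} x * (x / \<epsilon>) * H (x / \<epsilon>) \<partial>\<sigma>) \<longlongrightarrow> c * (LBINT x:{0<..b}. H x)) (at_right 0)"
proof -
  obtain \<epsilon>0 where \<epsilon>0: "0 < \<epsilon>0" "\<And>\<epsilon>. 0 < \<epsilon> \<Longrightarrow> \<epsilon> \<le> \<epsilon>0 \<Longrightarrow> 0 < small_jump_mass \<sigma> \<epsilon>"
    by (rule threshold) (erule that; blast)
  have "0 < \<epsilon>0 / b" using \<epsilon>0 b by simp
  then show ?thesis
  proof (rule tendsto_at_right_sequentially)
    fix S :: "nat \<Rightarrow> real" assume S: "\<And>n. 0 < S n" "\<And>n. S n < \<epsilon>0 / b" "S \<longlonglongrightarrow> 0"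
    have m: "0 < small_jump_mass \<sigma> (b * S n)" for n
      using S(1,2)[of n] b by (intro \<epsilon>0(2)) (auto simp: field_simps)
    have S0: "filterlim S (at_right 0) sequentially" using S(3) S(1)[THEN less_imp_neq, THEN not_sym] S(1) by (auto simp: filterlim_at)
    have mlim: "(\<lambda>n. small_jump_mass \<sigma> (r * S n) / S n) \<longlonglongrightarrow> c * r" if "0 < r" for r
      by (rule filterlim_compose[OF small_jump_mass_scaled[OF that] S0])
    have "weak_conv_m (\<lambda>n. scaled_law b (S n)) (uniform_law b)"
      unfolding weak_conv_m_def weak_conv_def
    proof (intro allI impI)
      fix x
      show "(\<lambda>n. cdf (scaled_law b (S n)) x) \<longlonglongrightarrow> cdf (uniform_law b) x"
      proof (cases "x \<le> 0")
        case True then show ?thesis by (simp add: cdf_scaled_law[OF m S(1) b] cdf_uniform_law[OF b])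
      next
        case False
        then have "0 < min b x" using b by simp
        then have "(\<lambda>n. (small_jump_mass \<sigma> (min b x * S n) / S n) / (small_jump_mass \<sigma> (b * S n) / S n)) \<longlonglongrightarrow> (c * min b x) / (c * b)"
          using b c by (intro tendsto_divide mlim) auto
        moreover have "(c * min b x) / (c * b) = min b x / b" using c by simp
        moreover have "(u / S n) / (v / S n) = u / v" for u v n using S(1)[of n] by simp
        ultimately show ?thesis using False by (simp only: cdf_scaled_law[OF m S(1) b] cdf_uniform_law[OF b] if_False)
      qed
    qed
    then have "(\<lambda>n. \<integral>x. H x \<partial>scaled_law b (S n)) \<longlonglongrightarrow> (\<integral>x. H x \<partial>uniform_law b)"
      using real_distribution_scaled_law[OF m] real_distribution_uniform_law[OF b] H
      by (intro weak_conv_imp_integral_bdd_continuous_conv) auto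
    then have "(\<lambda>n. small_jump_mass \<sigma> (b * S n) / S n * (\<integral>x. H x \<partial>scaled_law b (S n))) \<longlonglongrightarrow> c * b * (\<integral>x. H x \<partial>uniform_law b)"
      by (intro tendsto_mult mlim b)
    moreover have "c * b * (\<integral>x. H x \<partial>uniform_law b) = c * (LBINT x:{0<..b}. H x)"
      using b H(1) by (subst integral_uniform_law) (auto intro!: borel_measurable_continuous_onI simp: continuous_on_eq_continuous_at)
    moreover have Hm: "H \<in> borel_measurable borel"
      using H(1) by (intro borel_measurable_continuous_onI) (simp add: continuous_on_eq_continuous_at)
    moreover have "small_jump_mass \<sigma> (b * S n) / S n * (\<integral>x. H x \<partial>scaled_law b (S n))
        = (\<integral>x. indicator {0<..b * S n} x * (x / S n) * H (x / S n) \<partial>\<sigma>)" for n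
    proof -
      have "small_jump_mass \<sigma> (b * S n) / S n * (\<integral>x. H x \<partial>scaled_law b (S n))
        = (\<integral>x. indicator {0<..b * S n} x * x * H (x / S n) \<partial>\<sigma>) / S n"
        unfolding integral_scaled_law[OF Hm m] using m[of n] by simp
      also have "\<dots> = (\<integral>x. indicator {0<..b * S n} x * x * H (x / S n) / S n \<partial>\<sigma>)" by simp
      finally show ?thesis by (simp add: mult.assoc)
    qed
    ultimately show "(\<lambda>n. \<integral>x. indicator {0<..b * S n} x * (x / S n) * H (x / S n) \<partial>\<sigma>) \<longlonglongrightarrow> c * (LBINT x:{0<..b}. H x)"
      by (simp only:)
  qed
qed

end

section \<open>The Laplace functional of a Poisson process\<close>

text \<open>The intensity is finite on compact subsets of the open half line, which makes the counts of such sets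
  Poisson distributed.\<close>

locale poisson_point_process =
  fixes N :: "'b measure" and \<eta> :: "'b \<Rightarrow> real measure" and \<Lambda> :: "real measure"
  assumes poisson: "poisson_process N \<eta> \<Lambda>" and sets_\<Lambda>: "sets \<Lambda> = sets pos_borel"
    and \<Lambda>_finite: "\<And>a b. 0 < a \<Longrightarrow> emeasure \<Lambda> {a..b} < \<infinity>"
begin

sublocale prob_space N
  using poisson by (simp add: poisson_process_def)

lemma \<eta>_measurable: "\<eta> \<in> N \<rightarrow>\<^sub>M borel_of vague_topology"
  using poisson by (simp add: poisson_process_def)

lemma \<eta>_lf: "\<omega> \<in> space N \<Longrightarrow> \<eta> \<omega> \<in> lf_measures"
  using measurable_space[OF \<eta>_measurable] by (simp add: space_borel_of topspace_vague_topology)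

lemma counts_indep:
  fixes n :: nat
  assumes "\<And>i. i < n \<Longrightarrow> A i \<in> sets pos_borel" "disjoint_family_on A {..<n}"
  shows "indep_vars (\<lambda>_. borel) (\<lambda>i \<omega>. emeasure (\<eta> \<omega>) (A i)) {..<n}"
proof -
  have "\<forall>(n::nat) A. (\<forall>i<n. A i \<in> sets pos_borel) \<longrightarrow> disjoint_family_on A {..<n} \<longrightarrow>
      indep_vars (\<lambda>_. borel) (\<lambda>i \<omega>. emeasure (\<eta> \<omega>) (A i)) {..<n}"
    using poisson unfolding poisson_process_def by (elim conjE)
  from this[rule_format, of n A] show ?thesis using assms by simp
qed

lemma count_measurable:
  assumes "A \<in> sets pos_borel"
  shows "(\<lambda>\<omega>. emeasure (\<eta> \<omega>) A) \<in> borel_measurable N"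
proof -
  have "indep_vars (\<lambda>_. borel) (\<lambda>i \<omega>. emeasure (\<eta> \<omega>) ((\<lambda>_. A) i)) {..<Suc 0}"
    using assms by (intro counts_indep) (auto simp: disjoint_family_on_def)
  then show ?thesis by (auto simp: indep_vars_def)
qed

lemma nn_integral_measurable:
  assumes "f \<in> borel_measurable pos_borel"
  shows "(\<lambda>\<omega>. \<integral>\<^sup>+x. f x \<partial>\<eta> \<omega>) \<in> borel_measurable N"
  using nn_integral_kernel[of N \<eta> f] count_measurable assms sets_lf[OF \<eta>_lf] by auto

text \<open>The Laplace transform of a Poisson variable.  That the count is almost surely an integer is not part of
  the definition but follows because the Poisson weights sum to \<open>1\<close>.\<close>

lemma Laplace_count:
  assumes A: "A \<in> sets pos_borel" and fin: "emeasure \<Lambda> A < \<infinity>" and \<theta>: "0 \<le> \<theta>"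
  shows "expectation (\<lambda>\<omega>. exp (- \<theta> * measure (\<eta> \<omega>) A)) = exp (- measure \<Lambda> A * (1 - exp (- \<theta>)))"
proof -
  define B where "B k = {\<omega>\<in>space N. emeasure (\<eta> \<omega>) A = of_nat k}" for k :: nat
  have [measurable]: "B k \<in> sets N" for k using count_measurable[OF A] unfolding B_def by measurable
  define m where "m = measure \<Lambda> A"
  have PB: "prob (B k) = exp (- m) * m ^ k / fact k" for k
    using poisson A fin by (simp add: poisson_process_def B_def m_def)
  have exps: "(\<lambda>k. exp (- m) * x ^ k / fact k) sums (exp (- m) * exp x)" for x :: real
    using sums_mult[OF exp_converges[of x], of "exp (- m)"] by (simp add: field_simps scaleR_conv_of_real)
  have disj: "disjoint_family B" by (auto simp: disjoint_family_on_def B_def)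
  have "(\<lambda>k. prob (B k)) sums prob (\<Union>k. B k)"
    by (rule finite_measure_UNION[OF _ disj]) auto
  then have "prob (\<Union>k. B k) = 1"
    using exps[of m] sums_unique2 unfolding PB by (fastforce simp flip: exp_add)
  then have AE_B: "AE \<omega> in N. \<omega> \<in> (\<Union>k. B k)" by (intro AE_prob_1) 
  \<comment> \<open>The terms of \<open>exp (- \<theta> * count) = (\<Sum>k. exp (- \<theta> * k) * indicator (B k))\<close>.\<close>
  define f where "f k \<omega> = exp (- \<theta> * real k) * indicator (B k) \<omega>" for k \<omega>
  have f1: "(\<lambda>k. f k \<omega>) sums exp (- \<theta> * measure (\<eta> \<omega>) A)" if "\<omega> \<in> B j" for \<omega> j
  proof -
    have em: "emeasure (\<eta> \<omega>) A = of_nat j" using that by (simp add: B_def)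
    then have mj: "measure (\<eta> \<omega>) A = real j" by (simp add: measure_def)
    have "f k \<omega> = (if k = j then exp (- \<theta> * real j) else 0)" for k
      using that em by (auto simp: f_def B_def indicator_def)
    then show ?thesis using sums_single[of j "\<lambda>_. exp (- \<theta> * real j)"] mj by simp
  qed
  have int: "integrable N (f k)" for k
    unfolding f_def[abs_def] by (intro integrable_mult_right integrable_real_indicator) (auto simp: less_top[symmetric])
  have Ef: "expectation (f k) = exp (- m) * (m * exp (- \<theta>)) ^ k / fact k" for k
    by (simp add: f_def[abs_def] PB power_mult_distrib exp_of_nat_mult[symmetric] mult_ac)
  have norm_f: "norm (f k \<omega>) = f k \<omega>" for k \<omega> by (simp add: f_def)
  have "(\<lambda>k. expectation (f k)) sums expectation (\<lambda>\<omega>. \<Sum>k. f k \<omega>)"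
  proof (rule sums_integral[OF int])
    show "AE \<omega> in N. summable (\<lambda>k. norm (f k \<omega>))"
      using AE_B
    proof eventually_elim
      case (elim \<omega>)
      then obtain j where "\<omega> \<in> B j" by blast
      from sums_summable[OF f1[OF this]] show ?case by (simp only: norm_f)
    qed
    show "summable (\<lambda>k. expectation (\<lambda>\<omega>. norm (f k \<omega>)))"
      unfolding norm_f Ef by (rule sums_summable[OF exps])
  qed
  moreover have "expectation (\<lambda>\<omega>. \<Sum>k. f k \<omega>) = expectation (\<lambda>\<omega>. exp (- \<theta> * measure (\<eta> \<omega>) A))"
  proof (rule integral_cong_AE)
    show "(\<lambda>\<omega>. \<Sum>k. f k \<omega>) \<in> borel_measurable N" using int by measurable
    show "(\<lambda>\<omega>. exp (- \<theta> * measure (\<eta> \<omega>) A)) \<in> borel_measurable N"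
      using count_measurable[OF A] unfolding measure_def by measurable
    show "AE \<omega> in N. (\<Sum>k. f k \<omega>) = exp (- \<theta> * measure (\<eta> \<omega>) A)"
      using AE_B by eventually_elim (use f1 in \<open>auto intro: sums_unique[symmetric]\<close>)
  qed
  ultimately have "(\<lambda>k. exp (- m) * (m * exp (- \<theta>)) ^ k / fact k) sums expectation (\<lambda>\<omega>. exp (- \<theta> * measure (\<eta> \<omega>) A))"
    by (simp only: Ef)
  then have "expectation (\<lambda>\<omega>. exp (- \<theta> * measure (\<eta> \<omega>) A)) = exp (- m) * exp (m * exp (- \<theta>))"
    using exps sums_unique2 by blast
  then show ?thesis by (simp add: m_def algebra_simps flip: exp_add)
qed

text \<open>The counts of disjoint sets are independent, and on disjoint sets \<open>1 - exp (- \<cdot>)\<close> may be applied term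
  by term.\<close>

lemma Laplace_simple:
  fixes \<theta> :: "nat \<Rightarrow> real"
  assumes A: "\<And>j. j < J \<Longrightarrow> A j \<in> sets pos_borel" "disjoint_family_on A {..<J}"
    and sub: "\<And>j. j < J \<Longrightarrow> A j \<subseteq> {a..b}" and a: "0 < a" and \<theta>: "\<And>j. 0 \<le> \<theta> j"
  shows "expectation (\<lambda>\<omega>. exp (- (\<integral>x. (\<Sum>j<J. \<theta> j * indicator (A j) x) \<partial>\<eta> \<omega>)))
    = exp (- (\<integral>x. (1 - exp (- (\<Sum>j<J. \<theta> j * indicator (A j) x))) \<partial>\<Lambda>))"
proof -
  have setsm: "A j \<in> sets m \<and> emeasure m (A j) < \<infinity>" if "j < J" "sets m = sets pos_borel" "emeasure m {a..b} < \<infinity>" for j m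
  proof -
    have "{a..b} \<in> sets m" using a that(2) by (auto simp: sets_restrict_space_iff)
    then have "emeasure m (A j) \<le> emeasure m {a..b}" using sub[OF that(1)] by (intro emeasure_mono) auto
    then show ?thesis using A(1)[OF that(1)] that by (auto intro: le_less_trans)
  qed
  have \<eta>int: "(\<integral>x. (\<Sum>j<J. \<theta> j * indicator (A j) x) \<partial>\<eta> \<omega>) = (\<Sum>j<J. \<theta> j * measure (\<eta> \<omega>) (A j))" if "\<omega> \<in> space N" for \<omega>
  proof -
    have "A j \<in> sets (\<eta> \<omega>) \<and> emeasure (\<eta> \<omega>) (A j) < \<infinity>" if "j < J" for j
      using setsm[OF that sets_lf[OF \<eta>_lf] emeasure_Icc_finite[OF \<eta>_lf a]] \<open>\<omega> \<in> space N\<close> by blast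
    moreover have "A j \<inter> space (\<eta> \<omega>) = A j" if "j < J" for j using calculation[OF that] sets.sets_into_space by blast
    ultimately show ?thesis by (subst Bochner_Integration.integral_sum) auto
  qed
  have pw: "(\<Sum>j<J. (1 - exp (- \<theta> j)) * indicator (A j) x) = 1 - exp (- (\<Sum>j<J. \<theta> j * indicator (A j) x))" for x
  proof (cases "\<exists>j<J. x \<in> A j")
    case True
    then obtain i where i: "i < J" "x \<in> A i" by blast
    then have "j < J \<Longrightarrow> x \<in> A j \<longleftrightarrow> j = i" for j using A(2) by (auto simp: disjoint_family_on_def)
    then have "(\<Sum>j<J. g j * indicator (A j) x) = (\<Sum>j<J. if j = i then g j else 0)" for g :: "nat \<Rightarrow> real"
      by (intro sum.cong refl) (auto simp: indicator_def)
    then show ?thesis using i by simp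
  next
    case False then show ?thesis by (simp add: indicator_def)
  qed
  have "expectation (\<lambda>\<omega>. exp (- (\<integral>x. (\<Sum>j<J. \<theta> j * indicator (A j) x) \<partial>\<eta> \<omega>)))
      = expectation (\<lambda>\<omega>. \<Prod>j<J. exp (- \<theta> j * enn2real (emeasure (\<eta> \<omega>) (A j))))"
  proof (intro Bochner_Integration.integral_cong refl)
    fix \<omega> assume "\<omega> \<in> space N"
    show "exp (- (\<integral>x. (\<Sum>j<J. \<theta> j * indicator (A j) x) \<partial>\<eta> \<omega>)) = (\<Prod>j<J. exp (- \<theta> j * enn2real (emeasure (\<eta> \<omega>) (A j))))"
      unfolding \<eta>int[OF \<open>\<omega> \<in> space N\<close>] by (simp add: measure_def exp_sum flip: sum_negf)
  qed
  also have "\<dots> = (\<Prod>j<J. expectation (\<lambda>\<omega>. exp (- \<theta> j * enn2real (emeasure (\<eta> \<omega>) (A j)))))"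
  proof (rule indep_vars_lebesgue_integral)
    show "indep_vars (\<lambda>_. borel) (\<lambda>j \<omega>. exp (- \<theta> j * enn2real (emeasure (\<eta> \<omega>) (A j)))) {..<J}"
      using counts_indep[OF A] by (rule indep_vars_compose2) measurable
    show "integrable N (\<lambda>\<omega>. exp (- \<theta> j * enn2real (emeasure (\<eta> \<omega>) (A j))))" if "j \<in> {..<J}" for j
      using count_measurable[OF A(1)] that \<theta> by (intro integrable_const_bound[of _ 1]) auto
  qed simp
  also have "\<dots> = (\<Prod>j<J. exp (- measure \<Lambda> (A j) * (1 - exp (- \<theta> j))))"
  proof (intro prod.cong refl)
    fix j assume "j \<in> {..<J}"
    then show "expectation (\<lambda>\<omega>. exp (- \<theta> j * enn2real (emeasure (\<eta> \<omega>) (A j)))) = exp (- measure \<Lambda> (A j) * (1 - exp (- \<theta> j)))"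
      using Laplace_count[OF A(1) _ \<theta>] setsm[OF _ sets_\<Lambda> \<Lambda>_finite[OF a]] by (simp add: measure_def)
  qed
  also have "\<dots> = exp (- (\<Sum>j<J. (1 - exp (- \<theta> j)) * measure \<Lambda> (A j)))"
    by (simp add: exp_sum mult.commute flip: sum_negf)
  also have "(\<Sum>j<J. (1 - exp (- \<theta> j)) * measure \<Lambda> (A j)) = (\<integral>x. (\<Sum>j<J. (1 - exp (- \<theta> j)) * indicator (A j) x) \<partial>\<Lambda>)"
  proof -
    have *: "A j \<in> sets \<Lambda> \<and> emeasure \<Lambda> (A j) < \<infinity>" if "j < J" for j
      by (rule setsm[OF that sets_\<Lambda> \<Lambda>_finite[OF a]])
    moreover have "A j \<inter> space \<Lambda> = A j" if "j < J" for j using *[OF that] sets.sets_into_space by blast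
    ultimately show ?thesis by (subst Bochner_Integration.integral_sum) auto
  qed
  finally show ?thesis unfolding pw .
qed

text \<open>Rounding \<open>f\<close> down to multiples of \<open>1 / (n + 1)\<close> gives simple functions; both sides pass to the limit by
  dominated convergence, with respect to \<open>\<Lambda>\<close> and to each realisation of the process, as all these measures
  are finite on \<open>[a, b]\<close>.\<close>

theorem Laplace_functional_poisson:
  fixes f :: "real \<Rightarrow> real"
  assumes f: "f \<in> borel_measurable pos_borel" and f0: "\<And>x. 0 \<le> f x" and fB: "\<And>x. f x \<le> B"
    and a: "0 < a" and supp: "\<And>x. 0 < x \<Longrightarrow> x \<notin> {a..b} \<Longrightarrow> f x = 0"
  shows "expectation (\<lambda>\<omega>. exp (- (\<integral>x. f x \<partial>\<eta> \<omega>))) = exp (- (\<integral>x. (1 - exp (- f x)) \<partial>\<Lambda>))"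
proof -
  define q where "q n x = real_of_int \<lfloor>real (Suc n) * f x\<rfloor> / real (Suc n)" for n x
  have q: "0 \<le> q n x" "q n x \<le> f x" "f x - 1 / real (Suc n) \<le> q n x" for n x
  proof -
    have 1: "real_of_int \<lfloor>real (Suc n) * f x\<rfloor> \<le> real (Suc n) * f x" "real (Suc n) * f x - 1 \<le> real_of_int \<lfloor>real (Suc n) * f x\<rfloor>"
      by linarith+
    have "0 \<le> \<lfloor>real (Suc n) * f x\<rfloor>" using f0[of x] by simp
    then show "0 \<le> q n x" unfolding q_def by (intro divide_nonneg_nonneg) auto
    have "q n x \<le> (real (Suc n) * f x) / real (Suc n)" unfolding q_def using 1 by (intro divide_right_mono) auto
    then show "q n x \<le> f x" by simp
    have "(real (Suc n) * f x - 1) / real (Suc n) \<le> q n x" unfolding q_def using 1 by (intro divide_right_mono) auto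
    then show "f x - 1 / real (Suc n) \<le> q n x" by (simp add: diff_divide_distrib)
  qed
  have qlim: "(\<lambda>n. q n x) \<longlonglongrightarrow> f x" for x
  proof (rule tendsto_sandwich[OF _ _ _ tendsto_const])
    have "(\<lambda>n. f x - 1 / real (Suc n)) \<longlonglongrightarrow> f x - 0"
      by (intro tendsto_diff tendsto_const LIMSEQ_Suc[OF lim_1_over_n])
    then show "(\<lambda>n. f x - 1 / real (Suc n)) \<longlonglongrightarrow> f x" by simp
  qed (use q in auto)
  have qm: "q n \<in> borel_measurable pos_borel" for n unfolding q_def using f by measurable
  have Ipos: "{a..b} \<subseteq> {0<..}" using a by auto
  have Iset: "{a..b} \<in> sets pos_borel" using Ipos by (auto simp: sets_restrict_space_iff)
  have qsupp: "q n x = 0" if "0 < x" "x \<notin> {a..b}" for n x using supp[OF that] by (simp add: q_def)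
  have qstep: "\<exists>J A \<theta>. (\<forall>j<J. A j \<in> sets pos_borel \<and> A j \<subseteq> {a..b}) \<and> disjoint_family_on A {..<J} \<and>
      (\<forall>j::nat. 0 \<le> \<theta> j) \<and> (\<forall>x>0. q n x = (\<Sum>j<J. \<theta> j * indicator (A j) x))" for n
  proof -
    obtain J where J: "real (Suc n) * B < real J" using reals_Archimedean2 by blast
    define A where "A j = {x\<in>{a..b}. \<lfloor>real (Suc n) * f x\<rfloor> = int j}" for j
    have "A j \<in> sets pos_borel" for j
    proof -
      have "{x\<in>space pos_borel. \<lfloor>real (Suc n) * f x\<rfloor> = int j} \<in> sets pos_borel" using f by measurable
      then have "{x\<in>space pos_borel. \<lfloor>real (Suc n) * f x\<rfloor> = int j} \<inter> {a..b} \<in> sets pos_borel" using Iset by blast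
      moreover have "{x\<in>space pos_borel. \<lfloor>real (Suc n) * f x\<rfloor> = int j} \<inter> {a..b} = A j"
        using Ipos by (auto simp: A_def space_pos_borel)
      ultimately show ?thesis by simp
    qed
    moreover have "q n x = (\<Sum>j<J. (real j / real (Suc n)) * indicator (A j) x)" if "0 < x" for x
    proof (cases "x \<in> {a..b}")
      case True
      define i where "i = nat \<lfloor>real (Suc n) * f x\<rfloor>"
      have i: "\<lfloor>real (Suc n) * f x\<rfloor> = int i" using f0[of x] by (simp add: i_def)
      have "real i \<le> real (Suc n) * f x" using i by linarith
      also have "\<dots> \<le> real (Suc n) * B" by (intro mult_left_mono fB) auto
      finally have iJ: "i < J" using J by linarith
      have "(\<Sum>j<J. (real j / real (Suc n)) * indicator (A j) x) = (\<Sum>j<J. if j = i then real j / real (Suc n) else 0)"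
        using True i by (intro sum.cong refl) (auto simp: A_def indicator_def)
      also have "\<dots> = q n x" using iJ i by (simp add: q_def)
      finally show ?thesis by simp
    next
      case False
      then have "(\<Sum>j<J. (real j / real (Suc n)) * indicator (A j) x) = 0"
        by (intro sum.neutral) (auto simp: A_def)
      then show ?thesis using qsupp[OF that False] by simp
    qed
    ultimately show ?thesis
      by (intro exI[of _ J] exI[of _ A] exI[of _ "\<lambda>j. real j / real (Suc n)"])
        (auto simp: A_def disjoint_family_on_def)
  qed
  have bm: "borel_measurable m = (borel_measurable pos_borel :: (real \<Rightarrow> real) set)" if "sets m = sets pos_borel" for m
    by (intro measurable_cong_sets that refl)
  have sp: "space m = {0<..}" if "sets m = sets pos_borel" for m :: "real measure"
    using sets_eq_imp_space_eq[OF that] by (simp add: space_pos_borel)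
  have conv: "(\<lambda>n. \<integral>x. g (q n x) \<partial>m) \<longlonglongrightarrow> (\<integral>x. g (f x) \<partial>m)"
    if m: "sets m = sets pos_borel" "emeasure m {a..b} < \<infinity>" and g: "continuous_on UNIV g" "g 0 = 0" "\<And>x. 0 \<le> x \<Longrightarrow> \<bar>g x\<bar> \<le> x"
    for m and g :: "real \<Rightarrow> real"
  proof (rule integral_dominated_convergence[where w="\<lambda>x. B * indicator {a..b} x"])
    have gm: "g \<in> borel_measurable borel" by (rule borel_measurable_continuous_onI[OF g(1)])
    show "(\<lambda>x. g (f x)) \<in> borel_measurable m" "\<And>n. (\<lambda>x. g (q n x)) \<in> borel_measurable m"
      unfolding bm[OF m(1)] using gm f qm by measurable
    show "integrable m (\<lambda>x. B * indicator {a..b} x)" using m Iset by (intro integrable_mult_right) auto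
    have "isCont g z" for z using g(1) by (simp add: continuous_on_eq_continuous_at)
    then have "(\<lambda>n. g (q n x)) \<longlonglongrightarrow> g (f x)" for x by (rule isCont_tendsto_compose[OF _ qlim])
    then show "AE x in m. (\<lambda>n. g (q n x)) \<longlonglongrightarrow> g (f x)" by simp
    show "AE x in m. norm (g (q n x)) \<le> B * indicator {a..b} x" for n
    proof (rule AE_I2)
      fix x assume "x \<in> space m"
      then have x: "0 < x" by (simp add: sp[OF m(1)])
      have "\<bar>g (q n x)\<bar> \<le> q n x" using g(3) q(1) by blast
      moreover have "q n x \<le> B" using q(2)[of n x] fB[of x] by linarith
      ultimately show "norm (g (q n x)) \<le> B * indicator {a..b} x"
        using qsupp[OF x, of n] g(2) by (cases "x \<in> {a..b}") auto
    qed
  qed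
  have step: "expectation (\<lambda>\<omega>. exp (- (\<integral>x. q n x \<partial>\<eta> \<omega>))) = exp (- (\<integral>x. (1 - exp (- q n x)) \<partial>\<Lambda>))
      \<and> (\<lambda>\<omega>. \<integral>x. q n x \<partial>\<eta> \<omega>) \<in> borel_measurable N" for n
  proof
    obtain J A \<theta> where JA: "\<And>j. j < J \<Longrightarrow> A j \<in> sets pos_borel" "\<And>j. j < J \<Longrightarrow> A j \<subseteq> {a..b}" "disjoint_family_on A {..<J}"
      "\<And>j::nat. 0 \<le> \<theta> j" and qe: "\<And>x. 0 < x \<Longrightarrow> q n x = (\<Sum>j<J. \<theta> j * indicator (A j) x)"
      using qstep[of n] by blast
    have 1: "(\<integral>x. q n x \<partial>\<eta> \<omega>) = (\<integral>x. (\<Sum>j<J. \<theta> j * indicator (A j) x) \<partial>\<eta> \<omega>)" if "\<omega> \<in> space N" for \<omega>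
      by (intro Bochner_Integration.integral_cong refl qe) (simp add: space_lf[OF \<eta>_lf[OF that]])
    have 2: "(\<integral>x. (1 - exp (- q n x)) \<partial>\<Lambda>) = (\<integral>x. (1 - exp (- (\<Sum>j<J. \<theta> j * indicator (A j) x))) \<partial>\<Lambda>)"
      by (intro Bochner_Integration.integral_cong refl) (simp add: sp[OF sets_\<Lambda>] qe)
    show "expectation (\<lambda>\<omega>. exp (- (\<integral>x. q n x \<partial>\<eta> \<omega>))) = exp (- (\<integral>x. (1 - exp (- q n x)) \<partial>\<Lambda>))"
    proof -
      have "expectation (\<lambda>\<omega>. exp (- (\<integral>x. q n x \<partial>\<eta> \<omega>)))
          = expectation (\<lambda>\<omega>. exp (- (\<integral>x. (\<Sum>j<J. \<theta> j * indicator (A j) x) \<partial>\<eta> \<omega>)))"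
        by (intro Bochner_Integration.integral_cong refl) (simp only: 1)
      also have "\<dots> = exp (- (\<integral>x. (1 - exp (- (\<Sum>j<J. \<theta> j * indicator (A j) x))) \<partial>\<Lambda>))"
        by (rule Laplace_simple[OF JA(1,3,2) a JA(4)])
      finally show ?thesis unfolding 2 .
    qed
    have "(\<lambda>\<omega>. enn2real (\<integral>\<^sup>+x. ennreal (q n x) \<partial>\<eta> \<omega>)) \<in> borel_measurable N"
      using qm[of n] by (intro borel_measurable_enn2real nn_integral_measurable) measurable
    then show "(\<lambda>\<omega>. \<integral>x. q n x \<partial>\<eta> \<omega>) \<in> borel_measurable N"
    proof (rule measurable_cong[THEN iffD1, rotated])
      fix \<omega> assume "\<omega> \<in> space N"
      then show "enn2real (\<integral>\<^sup>+x. ennreal (q n x) \<partial>\<eta> \<omega>) = (\<integral>x. q n x \<partial>\<eta> \<omega>)"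
        using qm[of n] q(1) by (intro integral_eq_nn_integral[symmetric]) (auto simp: measurable_lf[OF \<eta>_lf])
    qed
  qed
  have \<eta>lim: "(\<lambda>n. \<integral>x. q n x \<partial>\<eta> \<omega>) \<longlonglongrightarrow> (\<integral>x. f x \<partial>\<eta> \<omega>)" if "\<omega> \<in> space N" for \<omega>
    using conv[OF sets_lf[OF \<eta>_lf[OF that]] emeasure_Icc_finite[OF \<eta>_lf[OF that] a], of "\<lambda>x. x"] by simp
  have fm: "(\<lambda>\<omega>. \<integral>x. f x \<partial>\<eta> \<omega>) \<in> borel_measurable N"
    by (rule borel_measurable_LIMSEQ_real[OF \<eta>lim]) (use step in auto)
  have "(\<lambda>n. expectation (\<lambda>\<omega>. exp (- (\<integral>x. q n x \<partial>\<eta> \<omega>)))) \<longlonglongrightarrow> expectation (\<lambda>\<omega>. exp (- (\<integral>x. f x \<partial>\<eta> \<omega>)))"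
  proof (rule integral_dominated_convergence[where w="\<lambda>_. 1"])
    show "AE \<omega> in N. (\<lambda>n. exp (- (\<integral>x. q n x \<partial>\<eta> \<omega>))) \<longlonglongrightarrow> exp (- (\<integral>x. f x \<partial>\<eta> \<omega>))"
      by (intro AE_I2 tendsto_intros \<eta>lim)
    show "(\<lambda>\<omega>. exp (- (\<integral>x. f x \<partial>\<eta> \<omega>))) \<in> borel_measurable N" using fm by measurable
    show "(\<lambda>\<omega>. exp (- (\<integral>x. q n x \<partial>\<eta> \<omega>))) \<in> borel_measurable N" for n
    proof -
      have [measurable]: "(\<lambda>\<omega>. \<integral>x. q n x \<partial>\<eta> \<omega>) \<in> borel_measurable N" using step by blast
      show ?thesis by measurable
    qed
    show "AE \<omega> in N. norm (exp (- (\<integral>x. q n x \<partial>\<eta> \<omega>))) \<le> 1" for n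
      by (intro AE_I2) (simp add: integral_nonneg_AE q(1))
  qed simp
  moreover have "(\<lambda>n. exp (- (\<integral>x. (1 - exp (- q n x)) \<partial>\<Lambda>))) \<longlonglongrightarrow> exp (- (\<integral>x. (1 - exp (- f x)) \<partial>\<Lambda>))"
  proof (intro tendsto_intros conv[OF sets_\<Lambda> \<Lambda>_finite[OF a], of "\<lambda>x. 1 - exp (- x)"])
    show "continuous_on UNIV (\<lambda>x::real. 1 - exp (- x))" by (intro continuous_intros)
    show "\<bar>1 - exp (- x)\<bar> \<le> x" if "0 \<le> x" for x :: real using exp_ge_add_one_self[of "- x"] that by simp
  qed simp
  ultimately show ?thesis using step by (simp add: LIMSEQ_unique)
qed

end

section \<open>Vague convergence of the rescaled jumps\<close>

lemma sets_dickman_intensity: "sets (dickman_intensity c) = sets pos_borel"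
  unfolding dickman_intensity_def sets_density by (rule sets_restrict_space_cong) simp

lemma nn_integral_dickman_intensity:
  assumes [measurable]: "f \<in> borel_measurable borel"
  shows "(\<integral>\<^sup>+x. f x \<partial>dickman_intensity c) = (\<integral>\<^sup>+x. ennreal (c / x) * f x * indicator {0<..} x \<partial>lborel)"
proof -
  have [measurable]: "f \<in> borel_measurable (restrict_space lborel {0<..})"
    "(\<lambda>x. ennreal (c / x)) \<in> borel_measurable (restrict_space lborel {0<..})"
    by (auto intro!: measurable_restrict_space1)
  have "(\<integral>\<^sup>+x. f x \<partial>dickman_intensity c) = (\<integral>\<^sup>+x. ennreal (c / x) * f x \<partial>restrict_space lborel {0<..})"
    unfolding dickman_intensity_def by (rule nn_integral_density) measurable
  then show ?thesis by (simp add: nn_integral_restrict_space)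
qed

lemma integral_dickman_intensity:
  assumes [measurable]: "(f :: real \<Rightarrow> real) \<in> borel_measurable borel" and c: "0 < c"
  shows "(\<integral>x. f x \<partial>dickman_intensity c) = c * (\<integral>x. indicator {0<..} x * (f x / x) \<partial>lborel)"
proof -
  have [measurable]: "f \<in> borel_measurable (restrict_space lborel {0<..})"
    "(\<lambda>x. c / x) \<in> borel_measurable (restrict_space lborel {0<..})"
    by (auto intro!: measurable_restrict_space1)
  have "(\<integral>x. f x \<partial>dickman_intensity c) = (\<integral>x. (c / x) *\<^sub>R f x \<partial>restrict_space lborel {0<..})"
    unfolding dickman_intensity_def using c
    by (intro integral_density) (auto intro!: AE_I2 simp: space_restrict_space)
  also have "\<dots> = (\<integral>x. c * (indicator {0<..} x * (f x / x)) \<partial>lborel)"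
    by (subst integral_restrict_space) (auto simp: mult_ac intro!: Bochner_Integration.integral_cong)
  finally show ?thesis by (simp only: integral_mult_right_zero)
qed

lemma dickman_intensity_finite:
  assumes c: "0 < c" and a: "0 < a"
  shows "emeasure (dickman_intensity c) {a..b} < \<infinity>"
proof -
  have "{a..b} \<in> sets (dickman_intensity c)"
    using a by (auto simp: sets_dickman_intensity sets_restrict_space_iff)
  then have "emeasure (dickman_intensity c) {a..b} = (\<integral>\<^sup>+x. indicator {a..b} x \<partial>dickman_intensity c)" by simp
  also have "\<dots> = (\<integral>\<^sup>+x. ennreal (c / x) * indicator {a..b} x * indicator {0<..} x \<partial>lborel)"
    by (rule nn_integral_dickman_intensity) simp
  also have "\<dots> \<le> (\<integral>\<^sup>+x. ennreal (c / a) * indicator {a..b} x \<partial>lborel)"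
    using a c by (intro nn_integral_mono) (auto simp: indicator_def intro!: ennreal_leI divide_left_mono mult_pos_pos)
  also have "\<dots> < \<infinity>" by (simp add: nn_integral_cmult_indicator ennreal_mult_less_top emeasure_lborel_Icc_eq)
  finally show ?thesis .
qed

text \<open>Division by \<open>x\<close> is harmless since the loss vanishes near \<open>0\<close>; this turns an integral against \<open>\<sigma>\<close> into
  one against \<open>x \<sigma>(dx)\<close>.\<close>

lemma jump_test_quotient:
  assumes f: "jump_test f"
  shows "continuous_on UNIV (\<lambda>x. loss f x / x)" "\<exists>B. \<forall>x. \<bar>loss f x / x\<bar> \<le> B"
proof -
  obtain a where a: "a > 0" "\<And>x. x < a \<Longrightarrow> f x = 0" using f by (auto simp: jump_test_def)
  have l: "0 \<le> loss f x" "loss f x \<le> 1" for x using f by (auto simp: jump_test_def loss_def)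
  have l0: "loss f x = 0" if "x < a" for x using a(2)[OF that] by (simp add: loss_def)
  have "continuous_on ({0<..} \<union> {..<a}) (\<lambda>x. loss f x / x)"
  proof (rule continuous_on_open_Un)
    have "continuous_on {0<..} (loss f)"
      using jump_test_loss[OF f] by (auto simp: jump_test_def intro: continuous_on_subset)
    then show "continuous_on {0<..} (\<lambda>x. loss f x / x)" by (intro continuous_intros) auto
    show "continuous_on {..<a} (\<lambda>x. loss f x / x)"
      by (rule continuous_on_eq[of _ "\<lambda>_. 0"]) (auto simp: l0)
  qed auto
  moreover have "{0<..} \<union> {..<a} = UNIV" using a(1) by auto
  ultimately show "continuous_on UNIV (\<lambda>x. loss f x / x)" by simp
  have "\<bar>loss f x / x\<bar> \<le> 1 / a" for x
  proof (cases "x < a")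
    case True then show ?thesis using a(1) by (simp add: l0)
  next
    case False
    then have "loss f x / x \<le> 1 / a" using l[of x] a(1) by (intro frac_le) auto
    then show ?thesis using l[of x] False a(1) by simp
  qed
  then show "\<exists>B. \<forall>x. \<bar>loss f x / x\<bar> \<le> B" by blast
qed

lemma vague_test_rescale:
  assumes f: "f \<in> vague_test" and s: "0 < s"
  shows "(\<lambda>x. f (s * x)) \<in> vague_test"
proof -
  obtain K where K: "compact K" "K \<subseteq> {0<..}" "\<And>x. x > 0 \<Longrightarrow> x \<notin> K \<Longrightarrow> f x = 0"
    using f by (auto simp: vague_test_def)
  have img: "(\<lambda>x. s * x) ` {0<..} \<subseteq> {0<..}" using s by auto
  have "continuous_on {0<..} f" using f by (simp add: vague_test_def)
  then have "continuous_on {0<..} (\<lambda>x. f (s * x))"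
    by (rule continuous_on_compose2[OF _ _ img]) (intro continuous_intros)
  moreover have "bounded ((\<lambda>x. f (s * x)) ` {0<..})"
  proof (rule bounded_subset)
    show "bounded (f ` {0<..})" using f by (simp add: vague_test_def)
    show "(\<lambda>x. f (s * x)) ` {0<..} \<subseteq> f ` {0<..}" using img by blast
  qed
  moreover have "\<forall>x>0. 0 \<le> f (s * x)" using f s by (simp add: vague_test_def)
  moreover have "compact ((\<lambda>x. (1 / s) * x) ` K)" using K(1) by (intro compact_continuous_image continuous_intros)
  moreover have "(\<lambda>x. (1 / s) * x) ` K \<subseteq> {0<..}" using K(2) s by auto
  moreover have "f (s * x) = 0" if "x > 0" "x \<notin> (\<lambda>x. (1 / s) * x) ` K" for x
  proof (rule K(3))
    show "s * x > 0" using s that by simp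
    show "s * x \<notin> K"
    proof
      assume "s * x \<in> K"
      then have "(1 / s) * (s * x) \<in> (\<lambda>x. (1 / s) * x) ` K" by (rule imageI)
      then show False using that s by simp
    qed
  qed
  ultimately show ?thesis unfolding vague_test_def by blast
qed

lemma scale_measurable_pos_borel: "0 < s \<Longrightarrow> (\<lambda>x. s * x) \<in> pos_borel \<rightarrow>\<^sub>M pos_borel"
  by (intro measurable_restrict_space2 measurable_restrict_space1) (auto simp: space_restrict_space)

lemma integral_dilate:
  assumes \<mu>: "\<mu> \<in> lf_measures" and s: "0 < s" and f: "(f :: real \<Rightarrow> real) \<in> borel_measurable pos_borel"
  shows "(\<integral>x. f x \<partial>dilate s \<mu>) = (\<integral>x. f (s * x) \<partial>\<mu>)"
proof -
  have "(\<lambda>x. s * x) \<in> \<mu> \<rightarrow>\<^sub>M pos_borel"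
    using scale_measurable_pos_borel[OF s] measurable_cong_sets[OF sets_lf[OF \<mu>] refl] by blast
  then show ?thesis unfolding dilate_def using f by (rule integral_distr)
qed

lemma dilate_lf:
  assumes \<mu>: "\<mu> \<in> lf_measures" and s: "0 < s"
  shows "dilate s \<mu> \<in> lf_measures"
  unfolding lf_measures_def
proof (intro CollectI conjI allI impI)
  show "sets (dilate s \<mu>) = sets pos_borel" by (simp add: dilate_def)
  fix K :: "real set" assume K: "compact K \<and> K \<subseteq> {0<..}"
  have m: "(\<lambda>x. s * x) \<in> \<mu> \<rightarrow>\<^sub>M pos_borel"
    using scale_measurable_pos_borel[OF s] measurable_cong_sets[OF sets_lf[OF \<mu>] refl] by blast
  have "(\<lambda>x. s * x) -` K \<inter> space \<mu> = (\<lambda>x. (1 / s) * x) ` K"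
  proof (intro equalityI subsetI)
    fix x assume "x \<in> (\<lambda>x. s * x) -` K \<inter> space \<mu>"
    then have "(1 / s) * (s * x) \<in> (\<lambda>x. (1 / s) * x) ` K" by (intro imageI) simp
    then show "x \<in> (\<lambda>x. (1 / s) * x) ` K" using s by simp
  qed (use s K in \<open>auto simp: space_lf[OF \<mu>]\<close>)
  moreover have "compact ((\<lambda>x. (1 / s) * x) ` K)" using K by (intro compact_continuous_image continuous_intros) auto
  moreover have "(\<lambda>x. (1 / s) * x) ` K \<subseteq> {0<..}" using K s by auto
  ultimately have "emeasure \<mu> ((\<lambda>x. s * x) -` K \<inter> space \<mu>) < \<infinity>" using \<mu> by (simp add: lf_measures_def)
  then show "emeasure (dilate s \<mu>) K < \<infinity>"
    unfolding dilate_def using m K compact_pos_sets by (subst emeasure_distr) auto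
qed

locale scaled_subordinator = subordinator M Y + dickman_domain \<sigma> c
  for M :: "'a measure" and Y \<sigma> c +
  fixes t :: real
  assumes levy_measure: "levy_measure_of M Y \<sigma>" and t: "0 < t"
begin

text \<open>The Laplace functional of the jumps at \<open>f (x / \<epsilon>)\<close>, with \<open>loss f (x / \<epsilon>)\<close> written as
  \<open>(x / \<epsilon>) * H (x / \<epsilon>)\<close>.  The support of \<open>f\<close> lies below \<open>b\<close>, so that only jumps up to \<open>b \<epsilon>\<close> matter.\<close>

lemma Laplace_rescaled_jumps_tendsto:
  assumes f: "f \<in> vague_test"
  shows "((\<lambda>\<epsilon>. expectation (\<lambda>\<omega>. exp (- (\<integral>x. f (1 / \<epsilon> * x) \<partial>jumps 0 t \<omega>))))
    \<longlongrightarrow> exp (- (\<integral>x. (1 - exp (- f x)) \<partial>dickman_intensity (c * t)))) (at_right 0)"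
proof -
  obtain F a b where F: "continuous_on UNIV F" "\<And>x::real. 0 \<le> F x" and ab: "0 < a" "a \<le> b"
    and F0: "\<And>x. x \<notin> {a..b} \<Longrightarrow> F x = 0" and Ff: "\<And>x. 0 < x \<Longrightarrow> F x = f x"
    by (rule vague_testE[OF f]) (erule that; blast)
  have jt: "jump_test F" unfolding jump_test_def using F F0 ab by (auto intro!: exI[of _ a])
  have b: "0 < b" using ab by simp
  define H where "H x = loss F x / x" for x
  obtain B where B: "\<And>x. \<bar>H x\<bar> \<le> B" using jump_test_quotient(2)[OF jt] unfolding H_def by blast
  have Hc: "isCont H x" for x
    using jump_test_quotient(1)[OF jt] by (simp add: H_def[abs_def] continuous_on_eq_continuous_at)
  have l0: "loss F x = 0" if "x \<notin> {a..b}" for x using F0[OF that] by (simp add: loss_def)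
  have lm: "loss F \<in> borel_measurable borel" by (rule jump_test_measurable[OF jump_test_loss[OF jt]])
  have "(\<integral>x. (1 - exp (- f x)) \<partial>dickman_intensity (c * t)) = (\<integral>x. loss F x \<partial>dickman_intensity (c * t))"
    by (intro Bochner_Integration.integral_cong refl)
      (simp add: loss_def Ff dickman_intensity_def space_restrict_space)
  also have "\<dots> = c * t * (\<integral>x. indicator {0<..} x * H x \<partial>lborel)"
    unfolding H_def using c t by (intro integral_dickman_intensity lm) auto
  also have "(\<integral>x. indicator {0<..} x * H x \<partial>lborel) = (LBINT x:{0<..b}. H x)"
    unfolding set_lebesgue_integral_def
    by (intro Bochner_Integration.integral_cong refl) (auto simp: indicator_def H_def l0)
  finally have lim: "(\<integral>x. (1 - exp (- f x)) \<partial>dickman_intensity (c * t)) = t * (c * (LBINT x:{0<..b}. H x))" by simp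
  have eq: "exp (- t * (\<integral>x. indicator {0<..b * \<epsilon>} x * (x / \<epsilon>) * H (x / \<epsilon>) \<partial>\<sigma>))
      = expectation (\<lambda>\<omega>. exp (- (\<integral>x. f (1 / \<epsilon> * x) \<partial>jumps 0 t \<omega>)))" if \<epsilon>: "0 < \<epsilon>" for \<epsilon>
  proof -
    have v: "(\<lambda>x. f (1 / \<epsilon> * x)) \<in> vague_test" using \<epsilon> by (intro vague_test_rescale f) simp
    have "(\<integral>x. indicator {0<..b * \<epsilon>} x * (x / \<epsilon>) * H (x / \<epsilon>) \<partial>\<sigma>) = (\<integral>x. 1 - exp (- f (1 / \<epsilon> * x)) \<partial>\<sigma>)"
    proof (intro Bochner_Integration.integral_cong refl)
      fix x assume "x \<in> space \<sigma>"
      then have x: "0 < x" by (simp add: space_\<sigma>)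
      have le: "x \<le> b * \<epsilon> \<longleftrightarrow> x / \<epsilon> \<le> b" using \<epsilon> by (simp add: pos_divide_le_eq)
      have "1 - exp (- f (1 / \<epsilon> * x)) = loss F (x / \<epsilon>)" using Ff[of "x / \<epsilon>"] x \<epsilon> by (simp add: loss_def)
      then show "indicator {0<..b * \<epsilon>} x * (x / \<epsilon>) * H (x / \<epsilon>) = 1 - exp (- f (1 / \<epsilon> * x))"
        using x \<epsilon> l0[of "x / \<epsilon>"] by (auto simp: indicator_def le H_def)
    qed
    then show ?thesis using Laplace_functional_levy_measure(2)[OF levy_measure v t] by simp
  qed
  have "((\<lambda>\<epsilon>. exp (- t * (\<integral>x. indicator {0<..b * \<epsilon>} x * (x / \<epsilon>) * H (x / \<epsilon>) \<partial>\<sigma>)))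
      \<longlongrightarrow> exp (- t * (c * (LBINT x:{0<..b}. H x)))) (at_right 0)"
    by (intro tendsto_intros tendsto_integral_small_jumps[OF b Hc B])
  then have "((\<lambda>\<epsilon>. exp (- t * (\<integral>x. indicator {0<..b * \<epsilon>} x * (x / \<epsilon>) * H (x / \<epsilon>) \<partial>\<sigma>)))
      \<longlongrightarrow> exp (- (\<integral>x. (1 - exp (- f x)) \<partial>dickman_intensity (c * t)))) (at_right 0)"
    by (simp add: lim)
  then show ?thesis
    by (rule Lim_transform_eventually) (use eventually_at_right_less[of "0::real"] eq in \<open>auto elim: eventually_mono\<close>)
qed

lemma jump_measure_eq_jumps: "jump_measure (\<lambda>s. Y s \<omega>) t = jumps 0 t \<omega>"
  by (simp add: jump_measure_conv_on jumps_def)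

theorem rescaled_jumps_converge:
  assumes eta: "poisson_process N \<eta> (dickman_intensity (c * t))"
  shows "converges_in_distribution vague_topology
    M (\<lambda>\<epsilon> \<omega>. dilate (1 / \<epsilon>) (jump_measure (\<lambda>s. Y s \<omega>) t)) N \<eta> (at_right 0)"
proof -
  have ct: "0 < c * t" using c t by simp
  interpret P: poisson_point_process N \<eta> "dickman_intensity (c * t)"
    by unfold_locales (use eta sets_dickman_intensity dickman_intensity_finite[OF ct] in auto)
  have int: "(\<integral>x. f x \<partial>dilate (1 / \<epsilon>) (jumps 0 t \<omega>)) = (\<integral>x. f (1 / \<epsilon> * x) \<partial>jumps 0 t \<omega>)"
    if "0 < \<epsilon>" "\<omega> \<in> space M" "f \<in> vague_test" for \<epsilon> \<omega> f
    using that by (intro integral_dilate jumps_lf vague_test_measurable) auto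
  show ?thesis
    unfolding jump_measure_eq_jumps
  proof (rule vague_convergence_by_Laplace_functionals[OF prob_space_axioms P.prob_space_axioms _ P.\<eta>_measurable])
    show "\<forall>\<^sub>F \<epsilon> in at_right 0. (\<forall>\<omega>\<in>space M. dilate (1 / \<epsilon>) (jumps 0 t \<omega>) \<in> lf_measures) \<and>
      (\<forall>f\<in>vague_test. (\<lambda>\<omega>. \<integral>x. f x \<partial>dilate (1 / \<epsilon>) (jumps 0 t \<omega>)) \<in> borel_measurable M)"
      using eventually_at_right_less[of "0::real"]
    proof eventually_elim
      case (elim \<epsilon>)
      have "(\<lambda>\<omega>. \<integral>x. f x \<partial>dilate (1 / \<epsilon>) (jumps 0 t \<omega>)) \<in> borel_measurable M" if f: "f \<in> vague_test" for f
      proof (rule measurable_cong[THEN iffD2])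
        have "(\<lambda>x. f (1 / \<epsilon> * x)) \<in> vague_test" using elim by (intro vague_test_rescale f) simp
        from vague_jump_integral_measurable[OF this order_refl t]
        show "(\<lambda>\<omega>. \<integral>x. f (1 / \<epsilon> * x) \<partial>jumps 0 t \<omega>) \<in> borel_measurable M" by simp
      qed (rule int[OF elim _ f])
      then show ?case using elim by (auto intro!: dilate_lf jumps_lf)
    qed
    show "((\<lambda>\<epsilon>. \<integral>\<omega>. exp (- (\<integral>x. f x \<partial>dilate (1 / \<epsilon>) (jumps 0 t \<omega>))) \<partial>M) \<longlongrightarrow> (\<integral>\<omega>. exp (- (\<integral>x. f x \<partial>\<eta> \<omega>)) \<partial>N)) (at_right 0)"
      if f: "f \<in> vague_test" for f
    proof -
      obtain F a b where F: "continuous_on UNIV F" "\<And>x::real. 0 \<le> F x" and ab: "0 < a" "a \<le> b"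
        and F0: "\<And>x. x \<notin> {a..b} \<Longrightarrow> F x = 0" and Ff: "\<And>x. 0 < x \<Longrightarrow> F x = f x"
        by (rule vague_testE[OF f]) (erule that; blast)
      have "compact (F ` {a..b})" using F(1) by (intro compact_continuous_image) (auto intro: continuous_on_subset)
      then obtain B where "\<forall>y\<in>F ` {a..b}. norm y \<le> B" using compact_imp_bounded bounded_iff by metis
      have FB: "F x \<le> max 0 B" for x
      proof (cases "x \<in> {a..b}")
        case True
        then have "norm (F x) \<le> B" using \<open>\<forall>y\<in>F ` {a..b}. norm y \<le> B\<close> by blast
        then show ?thesis by simp
      qed (simp add: F0)
      have "(\<integral>\<omega>. exp (- (\<integral>x. F x \<partial>\<eta> \<omega>)) \<partial>N) = exp (- (\<integral>x. (1 - exp (- F x)) \<partial>dickman_intensity (c * t)))"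
        using F0 by (intro P.Laplace_functional_poisson[OF _ F(2) FB ab(1)] measurable_restrict_space1
            borel_measurable_continuous_onI F(1)) auto
      moreover have "(\<integral>\<omega>. exp (- (\<integral>x. f x \<partial>\<eta> \<omega>)) \<partial>N) = (\<integral>\<omega>. exp (- (\<integral>x. F x \<partial>\<eta> \<omega>)) \<partial>N)"
        using integral_cong_lf[OF P.\<eta>_lf Ff] by (intro Bochner_Integration.integral_cong) auto
      moreover have "(\<integral>x. (1 - exp (- F x)) \<partial>dickman_intensity (c * t)) = (\<integral>x. (1 - exp (- f x)) \<partial>dickman_intensity (c * t))"
        by (intro Bochner_Integration.integral_cong refl) (simp add: Ff dickman_intensity_def space_restrict_space)
      ultimately have lim: "(\<integral>\<omega>. exp (- (\<integral>x. f x \<partial>\<eta> \<omega>)) \<partial>N) = exp (- (\<integral>x. (1 - exp (- f x)) \<partial>dickman_intensity (c * t)))"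
        by simp
      have "\<forall>\<^sub>F \<epsilon> in at_right 0. expectation (\<lambda>\<omega>. exp (- (\<integral>x. f (1 / \<epsilon> * x) \<partial>jumps 0 t \<omega>)))
          = expectation (\<lambda>\<omega>. exp (- (\<integral>x. f x \<partial>dilate (1 / \<epsilon>) (jumps 0 t \<omega>))))"
        using eventually_at_right_less[of "0::real"]
        by eventually_elim (intro Bochner_Integration.integral_cong refl, simp only: int[OF _ _ f])
      then show ?thesis unfolding lim by (rule Lim_transform_eventually[OF Laplace_rescaled_jumps_tendsto[OF f]])
    qed
  qed
qed

end

section \<open>The sum of the points in the unit interval\<close>

text \<open>The loss of \<open>\<kappa> y\<close> divided by \<open>y\<close>, extended continuously by its value \<open>\<kappa>\<close> at \<open>0\<close> to the
  negative half line.\<close>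

definition dickman_kernel :: "real \<Rightarrow> real \<Rightarrow> real" where
  "dickman_kernel \<kappa> y = (if y \<le> 0 then \<kappa> else (1 - exp (- \<kappa> * y)) / y)"

lemma isCont_dickman_kernel: "isCont (dickman_kernel \<kappa>) y"
proof -
  define q where "q y = (if y = 0 then \<kappa> else (1 - exp (- \<kappa> * y)) / y)" for y :: real
  have "((\<lambda>h. 1 - exp (- \<kappa> * h)) has_field_derivative \<kappa>) (at 0)"
    by (auto intro!: derivative_eq_intros)
  then have "((\<lambda>h. (1 - exp (- \<kappa> * h)) / h) \<longlongrightarrow> \<kappa>) (at 0)" by (simp add: DERIV_def)
  moreover have "\<forall>\<^sub>F h in at 0. (1 - exp (- \<kappa> * h)) / h = q h" by (simp add: eventually_at_filter q_def)
  ultimately have "(q \<longlongrightarrow> \<kappa>) (at 0)" by (rule Lim_transform_eventually)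
  then have q0: "isCont q 0" by (simp add: isCont_def q_def)
  have "continuous_on (- {0}) (\<lambda>y. (1 - exp (- \<kappa> * y)) / y)" by (intro continuous_intros) auto
  then have "continuous_on (- {0}) q" by (rule continuous_on_eq) (simp add: q_def)
  then have q1: "isCont q y" if "y \<noteq> 0" for y
    using that by (auto simp: continuous_on_eq_continuous_at open_Compl)
  have "isCont q y" for y using q0 q1 by (cases "y = 0") auto
  moreover have "isCont (\<lambda>y::real. max 0 y) y" by (intro continuous_intros)
  ultimately have "isCont (\<lambda>y. q (max 0 y)) y" by (intro isCont_o2[where f="\<lambda>y. max 0 y" and g=q])
  moreover have "(\<lambda>y. q (max 0 y)) = dickman_kernel \<kappa>" by (auto simp: fun_eq_iff q_def dickman_kernel_def)
  ultimately show ?thesis by simp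
qed

lemma dickman_kernel_bounds:
  assumes "0 \<le> \<kappa>"
  shows "0 \<le> dickman_kernel \<kappa> y" "dickman_kernel \<kappa> y \<le> \<kappa>"
proof -
  have "1 - exp (- \<kappa> * y) \<le> \<kappa> * y" using exp_ge_add_one_self[of "- \<kappa> * y"] by simp
  then show "0 \<le> dickman_kernel \<kappa> y" "dickman_kernel \<kappa> y \<le> \<kappa>"
    using assms by (auto simp: dickman_kernel_def field_simps)
qed

lemma borel_measurable_dickman_kernel [measurable]: "dickman_kernel \<kappa> \<in> borel_measurable borel"
  using isCont_dickman_kernel by (intro borel_measurable_continuous_onI) (simp add: continuous_on_eq_continuous_at)

definition point_sum :: "real measure \<Rightarrow> real" where
  "point_sum \<mu> = (LINT x:{0<..<1}|\<mu>. x)"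

context poisson_point_process
begin

lemma point_sum_eq:
  assumes "\<omega> \<in> space N"
  shows "point_sum (\<eta> \<omega>) = enn2real (\<integral>\<^sup>+x. ennreal (x * indicator {0<..<1} x) \<partial>\<eta> \<omega>)"
proof -
  have "point_sum (\<eta> \<omega>) = (\<integral>x. x * indicator {0<..<1} x \<partial>\<eta> \<omega>)"
    unfolding point_sum_def set_lebesgue_integral_def by (simp add: mult.commute)
  also have "\<dots> = enn2real (\<integral>\<^sup>+x. ennreal (x * indicator {0<..<1} x) \<partial>\<eta> \<omega>)"
    by (intro integral_eq_nn_integral)
      (auto simp: measurable_lf[OF \<eta>_lf[OF assms]] indicator_def intro!: measurable_restrict_space1)
  finally show ?thesis .
qed

lemma point_sum_measurable: "(\<lambda>\<omega>. point_sum (\<eta> \<omega>)) \<in> borel_measurable N"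
proof (rule measurable_cong[THEN iffD2, OF point_sum_eq])
  show "(\<lambda>\<omega>. enn2real (\<integral>\<^sup>+x. ennreal (x * indicator {0<..<1} x) \<partial>\<eta> \<omega>)) \<in> borel_measurable N"
    by (intro borel_measurable_enn2real nn_integral_measurable measurable_restrict_space1) measurable
qed

lemma point_sum_nonneg: "0 \<le> point_sum (\<eta> \<omega>)"
  unfolding point_sum_def set_lebesgue_integral_def by (intro integral_nonneg_AE AE_I2) (auto simp: indicator_def)

end

text \<open>The integrand \<open>x\<close> on \<open>(0, 1)\<close> is the increasing limit of its restrictions to \<open>[1 / (n + 1), 1)\<close>, for which
  the Laplace functional is available.  The limit \<open>T\<close> might be infinite on some event, where the
  integral defining the point sum would be \<open>0\<close> by convention.  This event has probability \<open>0\<close>: the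
  Laplace transform bounds the probability of finiteness from below by \<open>exp (- C \<kappa>)\<close> for every \<open>\<kappa> > 0\<close>.\<close>

lemma Laplace_point_sum:
  assumes eta: "poisson_process N \<eta> (dickman_intensity C)" and C: "0 < C" and \<kappa>: "0 < \<kappa>"
  shows "(\<integral>\<omega>. exp (- \<kappa> * point_sum (\<eta> \<omega>)) \<partial>N) = exp (- C * (LBINT x:{0<..1}. dickman_kernel \<kappa> x))"
proof -
  interpret P: poisson_point_process N \<eta> "dickman_intensity C"
    by unfold_locales (use eta sets_dickman_intensity dickman_intensity_finite[OF C] in auto)
  define W :: "nat \<Rightarrow> real set" where "W n = {1 / real (Suc n)..<1}" for n
  define u where "u n x = x * indicator (W n) x" for n and x :: real
  define J where "J n \<omega> = (\<integral>x. u n x \<partial>\<eta> \<omega>)" for n \<omega>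
  define T where "T \<omega> = (\<integral>\<^sup>+x. ennreal (x * indicator {0<..<1} x) \<partial>\<eta> \<omega>)" for \<omega>
  define I where "I \<kappa> n = (\<integral>x. indicator (W n) x * dickman_kernel \<kappa> x \<partial>lborel)" for \<kappa> n
  have [measurable]: "W n \<in> sets borel" for n by (simp add: W_def)
  have W_pos: "0 < x" "x < 1" if "x \<in> W n" for x n
  proof -
    have "0 < 1 / real (Suc n)" by simp
    also have "\<dots> \<le> x" using that by (simp add: W_def)
    finally show "0 < x" "x < 1" using that by (auto simp: W_def)
  qed
  have u: "0 \<le> u n x" "u n x \<le> 1" for n x using W_pos[of x n] by (auto simp: u_def indicator_def)
  have um [measurable]: "u n \<in> borel_measurable borel" for n unfolding u_def by measurable
  have W_mono: "W m \<subseteq> W n" if "m \<le> n" for m n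
  proof -
    have "1 / real (Suc n) \<le> 1 / real (Suc m)" using that by (intro frac_le) auto
    then show ?thesis by (auto simp: W_def)
  qed
  have W_ev: "\<forall>\<^sub>F n in sequentially. x \<in> W n \<longleftrightarrow> x \<in> {0<..<1}" for x
  proof (cases "x \<in> {0<..<1}")
    case True
    obtain m where "1 / x < real m" using reals_Archimedean2 by blast
    then have "1 / real (Suc m) \<le> x" using True by (simp add: field_simps)
    then have "x \<in> W m" using True by (simp add: W_def)
    then show ?thesis using W_mono True unfolding eventually_sequentially by blast
  next
    case False
    have "x \<notin> W n" for n using W_pos[of x n] False by auto
    then show ?thesis using False by simp
  qed
  have u_int: "integrable (\<eta> \<omega>) (u n)" if \<omega>: "\<omega> \<in> space N" for n \<omega>
  proof (rule integrableI_bounded_set[of "{1 / real (Suc n)..1}"])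
    show "{1 / real (Suc n)..1} \<in> sets (\<eta> \<omega>)"
      unfolding sets_lf[OF P.\<eta>_lf[OF \<omega>]] by (rule compact_pos_sets) (auto intro: less_le_trans[rotated])
    show "u n \<in> borel_measurable (\<eta> \<omega>)" unfolding measurable_lf[OF P.\<eta>_lf[OF \<omega>]] by (intro measurable_restrict_space1 um)
    show "emeasure (\<eta> \<omega>) {1 / real (Suc n)..1} < \<infinity>" by (intro emeasure_Icc_finite P.\<eta>_lf \<omega>) simp
    show "AE x in \<eta> \<omega>. x \<in> {1 / real (Suc n)..1} \<longrightarrow> norm (u n x) \<le> 1" using u by (auto intro!: AE_I2)
    show "AE x in \<eta> \<omega>. x \<notin> {1 / real (Suc n)..1} \<longrightarrow> u n x = 0" by (intro AE_I2) (auto simp: u_def W_def indicator_def)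
  qed
  have JT: "(\<lambda>n. ennreal (J n \<omega>)) \<longlonglongrightarrow> T \<omega>" if \<omega>: "\<omega> \<in> space N" for \<omega>
  proof -
    have "(\<lambda>n. \<integral>\<^sup>+x. ennreal (u n x) \<partial>\<eta> \<omega>) \<longlonglongrightarrow> (\<integral>\<^sup>+x. ennreal (x * indicator {0<..<1} x) \<partial>\<eta> \<omega>)"
    proof (rule nn_integral_LIMSEQ)
      show "incseq (\<lambda>n x. ennreal (u n x))"
        using W_mono W_pos by (fastforce simp: incseq_def le_fun_def u_def indicator_def intro!: ennreal_leI)
      show "(\<lambda>x. ennreal (u n x)) \<in> borel_measurable (\<eta> \<omega>)" for n
        using borel_measurable_integrable[OF u_int[OF \<omega>]] by simp
      show "(\<lambda>n. ennreal (u n x)) \<longlonglongrightarrow> ennreal (x * indicator {0<..<1} x)" for x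
        by (rule tendsto_eventually) (use W_ev[of x] in \<open>eventually_elim, auto simp: u_def indicator_def\<close>)
    qed
    moreover have "(\<integral>\<^sup>+x. ennreal (u n x) \<partial>\<eta> \<omega>) = ennreal (J n \<omega>)" for n
      unfolding J_def using u_int[OF \<omega>] u by (intro nn_integral_eq_integral) auto
    ultimately show ?thesis by (simp add: T_def)
  qed
  have J0: "0 \<le> J n \<omega>" for n \<omega> unfolding J_def by (intro integral_nonneg_AE) (simp add: u)
  have Tm [measurable]: "T \<in> borel_measurable N"
    unfolding T_def by (intro P.nn_integral_measurable measurable_restrict_space1) measurable
  have Jm [measurable]: "J n \<in> borel_measurable N" for n
  proof (rule measurable_cong[THEN iffD2])
    show "J n \<omega> = enn2real (\<integral>\<^sup>+x. ennreal (u n x) \<partial>\<eta> \<omega>)" if "\<omega> \<in> space N" for \<omega>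
      unfolding J_def using borel_measurable_integrable[OF u_int[OF that]] u by (intro integral_eq_nn_integral) auto
    show "(\<lambda>\<omega>. enn2real (\<integral>\<^sup>+x. ennreal (u n x) \<partial>\<eta> \<omega>)) \<in> borel_measurable N"
      by (intro borel_measurable_enn2real P.nn_integral_measurable measurable_restrict_space1) measurable
  qed
  have lim_finite: "(\<lambda>n. J n \<omega>) \<longlonglongrightarrow> point_sum (\<eta> \<omega>)" if "\<omega> \<in> space N" "T \<omega> \<noteq> \<infinity>" for \<omega>
  proof -
    have "T \<omega> = ennreal (point_sum (\<eta> \<omega>))"
      unfolding P.point_sum_eq[OF that(1)] T_def[symmetric] using that(2) by (simp add: less_top)
    then show ?thesis using JT[OF that(1)] J0 P.point_sum_nonneg by (auto intro: tendsto_ennrealD)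
  qed
  \<comment> \<open>The limit of \<open>exp (- \<kappa> * J n)\<close>, that is \<open>exp (- \<kappa> * T)\<close> with \<open>exp (- \<infinity>) = 0\<close>.\<close>
  define e where "e \<kappa> \<omega> = (if T \<omega> = \<infinity> then 0 else exp (- \<kappa> * point_sum (\<eta> \<omega>)))" for \<kappa> :: real and \<omega>
  have em [measurable]: "e \<kappa> \<in> borel_measurable N" for \<kappa>
    using P.point_sum_measurable unfolding e_def by measurable
  have e_lim: "(\<lambda>n. exp (- \<kappa> * J n \<omega>)) \<longlonglongrightarrow> e \<kappa> \<omega>" if \<omega>: "\<omega> \<in> space N" and \<kappa>: "0 < \<kappa>" for \<kappa> \<omega>
  proof (cases "T \<omega> = \<infinity>")
    case True
    then have "filterlim (\<lambda>n. J n \<omega>) at_top sequentially"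
      using JT[OF \<omega>] by (simp add: ennreal_tendsto_top_eq_at_top)
    then have "filterlim (\<lambda>n. \<kappa> * J n \<omega>) at_top sequentially"
      using \<kappa> by (intro filterlim_tendsto_pos_mult_at_top[OF tendsto_const])
    then have "filterlim (\<lambda>n. - (\<kappa> * J n \<omega>)) at_bot sequentially" by (simp add: filterlim_uminus_at_top)
    then have "(\<lambda>n. exp (- (\<kappa> * J n \<omega>))) \<longlonglongrightarrow> 0" by (rule filterlim_compose[OF exp_at_bot])
    then show ?thesis using True by (simp add: e_def)
  next
    case False
    then show ?thesis unfolding e_def using lim_finite[OF \<omega> False] by (auto intro!: tendsto_intros)
  qed
  have EJ: "(\<integral>\<omega>. exp (- \<kappa> * J n \<omega>) \<partial>N) = exp (- C * I \<kappa> n)" if \<kappa>: "0 < \<kappa>" for \<kappa> n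
  proof -
    have "(\<integral>\<omega>. exp (- (\<integral>x. \<kappa> * u n x \<partial>\<eta> \<omega>)) \<partial>N) = exp (- (\<integral>x. (1 - exp (- (\<kappa> * u n x))) \<partial>dickman_intensity C))"
    proof (rule P.Laplace_functional_poisson[where B=\<kappa> and a="1 / real (Suc n)" and b=1])
      show "(\<lambda>x. \<kappa> * u n x) \<in> borel_measurable pos_borel" by (intro measurable_restrict_space1) measurable
      show "0 \<le> \<kappa> * u n x" "\<kappa> * u n x \<le> \<kappa>" for x using u[of n x] \<kappa> by (auto intro: mult_left_le)
      show "\<kappa> * u n x = 0" if "0 < x" "x \<notin> {1 / real (Suc n)..1}" for x
        using that by (auto simp: u_def W_def indicator_def)
    qed simp
    also have "(\<integral>x. (1 - exp (- (\<kappa> * u n x))) \<partial>dickman_intensity C) = C * (\<integral>x. indicator {0<..} x * ((1 - exp (- (\<kappa> * u n x))) / x) \<partial>lborel)"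
      using C by (intro integral_dickman_intensity) measurable
    also have "(\<integral>x. indicator {0<..} x * ((1 - exp (- (\<kappa> * u n x))) / x) \<partial>lborel) = I \<kappa> n"
      unfolding I_def
    proof (intro Bochner_Integration.integral_cong refl)
      fix x :: real
      show "indicator {0<..} x * ((1 - exp (- (\<kappa> * u n x))) / x) = indicator (W n) x * dickman_kernel \<kappa> x"
        using W_pos[of x n] by (cases "x \<in> W n") (auto simp: u_def indicator_def dickman_kernel_def)
    qed
    finally show ?thesis by (simp add: J_def)
  qed
  have e_int: "(\<lambda>n. exp (- C * I \<kappa> n)) \<longlonglongrightarrow> (\<integral>\<omega>. e \<kappa> \<omega> \<partial>N)" if \<kappa>: "0 < \<kappa>" for \<kappa>
  proof -
    have "(\<lambda>n. \<integral>\<omega>. exp (- \<kappa> * J n \<omega>) \<partial>N) \<longlonglongrightarrow> (\<integral>\<omega>. e \<kappa> \<omega> \<partial>N)"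
    proof (rule integral_dominated_convergence[where w="\<lambda>_. 1"])
      show "AE \<omega> in N. (\<lambda>n. exp (- \<kappa> * J n \<omega>)) \<longlonglongrightarrow> e \<kappa> \<omega>" using e_lim[OF _ \<kappa>] by (intro AE_I2)
      show "AE \<omega> in N. norm (exp (- \<kappa> * J n \<omega>)) \<le> 1" for n using J0 \<kappa> by (intro AE_I2) simp
    qed auto
    then show ?thesis by (simp only: EJ[OF \<kappa>])
  qed
  have I_lim: "I \<kappa> \<longlonglongrightarrow> (LBINT x:{0<..1}. dickman_kernel \<kappa> x)" if \<kappa>: "0 < \<kappa>" for \<kappa>
    unfolding I_def set_lebesgue_integral_def
  proof (rule integral_dominated_convergence[where w="\<lambda>x. \<kappa> * indicator {0<..1} x"])
    show "integrable lborel (\<lambda>x. \<kappa> * indicator {0<..1::real} x)" by (intro integrable_mult_right integrable_real_indicator) auto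
    show "AE x in lborel. (\<lambda>n. indicator (W n) x * dickman_kernel \<kappa> x) \<longlonglongrightarrow> indicator {0<..1} x *\<^sub>R dickman_kernel \<kappa> x"
      using AE_lborel_singleton[of 1]
    proof eventually_elim
      case (elim x)
      show ?case by (rule tendsto_eventually) (use elim in \<open>intro eventually_mono[OF W_ev[of x]], auto simp: indicator_def\<close>)
    qed
    show "AE x in lborel. norm (indicator (W n) x * dickman_kernel \<kappa> x) \<le> \<kappa> * indicator {0<..1} x" for n
      using dickman_kernel_bounds[of \<kappa>] W_pos[of _ n] \<kappa> by (intro AE_I2) (auto simp: indicator_def less_imp_le)
  qed auto
  have I_le: "(LBINT x:{0<..1}. dickman_kernel \<kappa> x) \<le> \<kappa>" if \<kappa>: "0 < \<kappa>" for \<kappa>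
  proof (rule LIMSEQ_le_const2[OF I_lim[OF \<kappa>]], intro exI[of _ 0] allI impI)
    fix n
    have "I \<kappa> n \<le> (\<integral>x. \<kappa> * indicator {0<..1::real} x \<partial>lborel)"
      unfolding I_def
    proof (rule integral_mono')
      show "integrable lborel (\<lambda>x. \<kappa> * indicator {0<..1::real} x)" by (intro integrable_mult_right integrable_real_indicator) auto
    qed (use dickman_kernel_bounds[of \<kappa>] W_pos[of _ n] \<kappa> in \<open>auto simp: indicator_def less_imp_le\<close>)
    also have "\<dots> = \<kappa>" by simp
    finally show "I \<kappa> n \<le> \<kappa>" .
  qed
  have e_val: "(\<integral>\<omega>. e \<kappa> \<omega> \<partial>N) = exp (- C * (LBINT x:{0<..1}. dickman_kernel \<kappa> x))" if \<kappa>: "0 < \<kappa>" for \<kappa>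
    by (rule LIMSEQ_unique[OF e_int[OF \<kappa>]]) (intro tendsto_intros I_lim \<kappa>)
  define Fin where "Fin = {\<omega>\<in>space N. T \<omega> \<noteq> \<infinity>}"
  have Fin_sets [measurable]: "Fin \<in> sets N" unfolding Fin_def by measurable
  have prob_ge: "exp (- C * \<kappa>) \<le> P.prob Fin" if \<kappa>: "0 < \<kappa>" for \<kappa>
  proof -
    have "exp (- C * \<kappa>) \<le> (\<integral>\<omega>. e \<kappa> \<omega> \<partial>N)" unfolding e_val[OF \<kappa>] using I_le[OF \<kappa>] C by simp
    also have "\<dots> \<le> (\<integral>\<omega>. indicator Fin \<omega> \<partial>N)"
    proof (rule integral_mono')
      show "integrable N (indicator Fin :: _ \<Rightarrow> real)" by (intro integrable_real_indicator) (auto simp: less_top[symmetric])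
    qed (use P.point_sum_nonneg \<kappa> in \<open>auto simp: e_def Fin_def indicator_def\<close>)
    finally show ?thesis by simp
  qed
  have bound: "exp (- C * (1 / real (Suc n))) \<le> P.prob Fin" for n
    by (rule prob_ge) simp
  have "(\<lambda>n. exp (- C * (1 / real (Suc n)))) \<longlonglongrightarrow> exp (- C * 0)"
    by (intro tendsto_intros LIMSEQ_Suc[OF lim_1_over_n])
  then have "exp (- C * 0) \<le> P.prob Fin" by (rule LIMSEQ_le_const2) (use bound in auto)
  then have "P.prob Fin = 1" using P.prob_le_1[of Fin] by simp
  then have "AE \<omega> in N. \<omega> \<in> Fin" by (rule P.AE_prob_1)
  then have "AE \<omega> in N. exp (- \<kappa> * point_sum (\<eta> \<omega>)) = e \<kappa> \<omega>"
    by eventually_elim (simp add: e_def Fin_def)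
  moreover have "(\<lambda>\<omega>. exp (- \<kappa> * point_sum (\<eta> \<omega>))) \<in> borel_measurable N"
    using P.point_sum_measurable by measurable
  ultimately have "(\<integral>\<omega>. exp (- \<kappa> * point_sum (\<eta> \<omega>)) \<partial>N) = (\<integral>\<omega>. e \<kappa> \<omega> \<partial>N)"
    using em by (intro integral_cong_AE)
  then show ?thesis using e_val[OF \<kappa>] by simp
qed

context nondecreasing_path
begin

lemma remove_jumps_eq:
  assumes "0 < \<epsilon>"
  shows "remove_jumps \<epsilon> y t = y t - (\<integral>x. x * indicator {\<epsilon><..} x \<partial>jump_measure_on y 0 t)"
proof -
  have "(\<integral>x. x * indicator {\<epsilon><..} x \<partial>jump_measure_on y 0 t)
      = (\<Sum>u | 0 < u \<and> u \<le> t \<and> \<epsilon> \<le> jump y u. jump y u * indicator {\<epsilon><..} (jump y u))"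
    using assms by (intro integral_jump_measure_on measurable_restrict_space1) auto
  also have "\<dots> = (\<Sum>u | 0 < u \<and> u \<le> t \<and> \<epsilon> < jump y u. jump y u)"
    using finite_large_jumps[OF assms order_refl, of t]
    by (intro sum.mono_neutral_cong_right) (auto simp: indicator_def)
  finally show ?thesis by (simp add: remove_jumps_def)
qed

text \<open>An unordered sum of nonnegative terms is an integral with respect to counting measure.\<close>

lemma jump_sum_integral:
  assumes "(jump y has_sum y t) {0<..t}"
  shows "integrable (jump_measure_on y 0 t) (\<lambda>x. x)" "(\<integral>x. x \<partial>jump_measure_on y 0 t) = y t"
proof -
  let ?A = "{u. 0 < u \<and> u \<le> t \<and> 0 < jump y u}"
  have hs: "(jump y has_sum y t) ?A"
    using assms by (rule has_sum_cong_neutral[THEN iffD1, rotated -1]) (use jump_nonneg in \<open>force+\<close>)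
  then have "jump y summable_on ?A" by (auto simp: summable_on_def)
  then have "Infinite_Sum.abs_summable_on (jump y) ?A"
    by (rule summable_on_cong[THEN iffD1, rotated]) auto
  then have abs: "Infinite_Set_Sum.abs_summable_on (jump y) ?A" by (rule abs_summable_equivalent[THEN iffD1])
  then have int: "integrable (count_space ?A) (jump y)" by (simp add: Infinite_Set_Sum.abs_summable_on_def)
  have "(\<integral>u. jump y u \<partial>count_space ?A) = infsetsum (jump y) ?A" by (simp add: infsetsum_def)
  also have "\<dots> = infsum (jump y) ?A" by (rule infsetsum_infsum[OF abs])
  also have "\<dots> = y t" by (rule infsumI[OF hs])
  finally have val: "(\<integral>u. jump y u \<partial>count_space ?A) = y t" .
  have id: "(\<lambda>x::real. x) \<in> borel_measurable pos_borel" by (intro measurable_restrict_space1) simp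
  show "integrable (jump_measure_on y 0 t) (\<lambda>x. x)"
    unfolding jump_measure_on_def using int by (subst integrable_distr_eq[OF _ id]) auto
  show "(\<integral>x. x \<partial>jump_measure_on y 0 t) = y t"
    unfolding jump_measure_on_def using val by (subst integral_distr[OF _ id]) auto
qed

text \<open>For a path that is the sum of its jumps, removing the large jumps leaves the sum of the small ones.\<close>

lemma remove_jumps_small:
  assumes hs: "(jump y has_sum y t) {0<..t}" and \<epsilon>: "0 < \<epsilon>"
  shows "remove_jumps \<epsilon> y t = (\<integral>x. x * indicator {..\<epsilon>} x \<partial>jump_measure_on y 0 t)"
proof -
  let ?\<mu> = "jump_measure_on y 0 t"
  note int = jump_sum_integral(1)[OF hs]
  have sets: "sets ?\<mu> = sets pos_borel" by (simp add: jump_measure_on_def)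
  have m: "(\<lambda>x. x * indicator A x) \<in> borel_measurable ?\<mu>" if "A \<in> sets borel" for A :: "real set"
    unfolding measurable_cong_sets[OF sets refl]
    using that by (intro measurable_restrict_space1 borel_measurable_times borel_measurable_indicator) auto
  have i: "integrable ?\<mu> (\<lambda>x. x * indicator A x)" if "A \<in> sets borel" for A :: "real set"
    by (rule Bochner_Integration.integrable_bound[OF int m[OF that]]) (auto simp: indicator_def)
  have "y t = (\<integral>x. x * indicator {..\<epsilon>} x + x * indicator {\<epsilon><..} x \<partial>?\<mu>)"
    unfolding jump_sum_integral(2)[OF hs, symmetric]
    by (intro Bochner_Integration.integral_cong refl) (auto simp: indicator_def)
  also have "\<dots> = (\<integral>x. x * indicator {..\<epsilon>} x \<partial>?\<mu>) + (\<integral>x. x * indicator {\<epsilon><..} x \<partial>?\<mu>)"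
    by (intro Bochner_Integration.integral_add i) auto
  finally show ?thesis by (simp add: remove_jumps_eq[OF \<epsilon>])
qed

end

section \<open>Convergence of the sum of the small jumps\<close>

text \<open>Test functions converging pointwise to \<open>\<kappa> x\<close> on \<open>(0, 1]\<close> and \<open>0\<close> beyond: the first cutoff
  removes a neighbourhood of \<open>0\<close>, the second descends from \<open>1\<close> to \<open>0\<close> just above \<open>1\<close>.\<close>

definition small_jump_test :: "real \<Rightarrow> nat \<Rightarrow> real \<Rightarrow> real" where
  "small_jump_test \<kappa> n x = \<kappa> * x * min 1 (max 0 (real (Suc n) * x - 1)) * max 0 (1 - real (Suc n) * max 0 (x - 1))"

lemma small_jump_test:
  assumes \<kappa>: "0 \<le> \<kappa>"
  shows small_jump_test_vague: "small_jump_test \<kappa> n \<in> vague_test"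
    and small_jump_test_nonneg: "0 \<le> small_jump_test \<kappa> n x"
    and small_jump_test_le: "0 < x \<Longrightarrow> small_jump_test \<kappa> n x \<le> \<kappa> * (x * indicator {..2} x)"
    and small_jump_test_LIMSEQ: "0 < x \<Longrightarrow> (\<lambda>n. small_jump_test \<kappa> n x) \<longlonglongrightarrow> \<kappa> * (x * indicator {..1} x)"
proof -
  have zero: "small_jump_test \<kappa> n x = 0" if "x \<le> 1 / real (Suc n) \<or> 1 + 1 / real (Suc n) \<le> x" for n x
    using that
  proof
    assume "x \<le> 1 / real (Suc n)"
    then have "real (Suc n) * x \<le> 1" by (simp add: field_simps)
    then show ?thesis by (simp add: small_jump_test_def del: of_nat_Suc)
  next
    assume x: "1 + 1 / real (Suc n) \<le> x"
    then have "real (Suc n) * (1 / real (Suc n)) \<le> real (Suc n) * (x - 1)" by (intro mult_left_mono) auto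
    moreover have "1 < x" using x by (smt (verit) divide_pos_pos of_nat_0_less_iff zero_less_Suc)
    ultimately show ?thesis by (simp add: small_jump_test_def del: of_nat_Suc)
  qed
  have n1: "1 / real (Suc n) \<le> 1" for n by simp
  show nonneg: "0 \<le> small_jump_test \<kappa> n x" for n x
  proof (cases "x \<le> 1 / real (Suc n)")
    case False
    then have "0 \<le> x" by (smt (verit) divide_pos_pos of_nat_0_less_iff zero_less_Suc)
    then show ?thesis unfolding small_jump_test_def using \<kappa> by (intro mult_nonneg_nonneg) auto
  qed (simp add: zero)
  show "small_jump_test \<kappa> n \<in> vague_test"
  proof (rule vague_testI[of _ "1 / real (Suc n)" 2])
    show "continuous_on {0<..} (small_jump_test \<kappa> n)" unfolding small_jump_test_def by (intro continuous_intros)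
    show "small_jump_test \<kappa> n x = 0" if "x \<notin> {1 / real (Suc n)..2}" for x
    proof -
      have "x < 1 / real (Suc n) \<or> 2 < x" using that by (simp only: atLeastAtMost_iff) linarith
      then show ?thesis using n1[of n] by (intro zero) linarith
    qed
  qed (auto simp: nonneg)
  show "small_jump_test \<kappa> n x \<le> \<kappa> * (x * indicator {..2} x)" if x: "0 < x" for x
  proof (cases "x \<le> 2")
    case True
    have a: "min 1 (max 0 (real (Suc n) * x - 1)) \<le> 1" "0 \<le> min 1 (max 0 (real (Suc n) * x - 1))"
      "max 0 (1 - real (Suc n) * max 0 (x - 1)) \<le> 1" "0 \<le> max 0 (1 - real (Suc n) * max 0 (x - 1))" by auto
    have "small_jump_test \<kappa> n x \<le> (\<kappa> * x * 1) * 1"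
      unfolding small_jump_test_def using a x \<kappa> by (intro mult_mono) auto
    then show ?thesis using True by simp
  next
    case False
    then have "small_jump_test \<kappa> n x = 0" using n1[of n] by (intro zero) linarith
    then show ?thesis using False by simp
  qed
  show "(\<lambda>n. small_jump_test \<kappa> n x) \<longlonglongrightarrow> \<kappa> * (x * indicator {..1} x)" if x: "0 < x" for x
  proof (rule tendsto_eventually)
    show "\<forall>\<^sub>F n in sequentially. small_jump_test \<kappa> n x = \<kappa> * (x * indicator {..1} x)"
    proof (cases "x \<le> 1")
      case True
      obtain m where m: "2 / x < real m" using reals_Archimedean2 by blast
      have "small_jump_test \<kappa> n x = \<kappa> * (x * indicator {..1} x)" if "m \<le> n" for n
      proof -
        have "2 / x \<le> real (Suc n)" using m that by simp
        then have "2 \<le> real (Suc n) * x" using x by (simp add: field_simps)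
        then have "min 1 (max 0 (real (Suc n) * x - 1)) = 1" by simp
        then show ?thesis using True by (simp add: small_jump_test_def del: of_nat_Suc)
      qed
      then show ?thesis unfolding eventually_sequentially by blast
    next
      case False
      obtain m where m: "1 / (x - 1) < real m" using reals_Archimedean2 by blast
      have "small_jump_test \<kappa> n x = \<kappa> * (x * indicator {..1} x)" if "m \<le> n" for n
      proof -
        have "1 / (x - 1) \<le> real (Suc n)" using m that by simp
        then have "1 + 1 / real (Suc n) \<le> x" using False by (simp add: field_simps)
        then show ?thesis using zero[of x n] False by simp
      qed
      then show ?thesis unfolding eventually_sequentially by blast
    qed
  qed
qed

context scaled_subordinator
begin

lemma AE_jump_sum:
  "AE \<omega> in M. (jump (\<lambda>s. Y s \<omega>) has_sum Y t \<omega>) {0<..t}"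
proof -
  have "AE \<omega> in M. \<forall>t\<ge>0. (jump (\<lambda>s. Y s \<omega>) has_sum Y t \<omega>) {0<..t}"
    using subordinator by (simp add: pure_jump_subordinator_def)
  then show ?thesis by eventually_elim (use t in auto)
qed

text \<open>The formula with the large jumps holds for every path, in contrast to the one with the small jumps.\<close>

lemma remove_jumps_measurable:
  assumes \<epsilon>: "0 < \<epsilon>"
  shows "(\<lambda>\<omega>. remove_jumps \<epsilon> (\<lambda>s. Y s \<omega>) t) \<in> borel_measurable M"
proof (rule measurable_cong[THEN iffD2])
  have f: "(\<lambda>x. ennreal (x * indicator {\<epsilon><..} x)) \<in> borel_measurable pos_borel"
    by (intro measurable_restrict_space1) measurable
  show "(\<lambda>\<omega>. Y t \<omega> - enn2real (\<integral>\<^sup>+x. ennreal (x * indicator {\<epsilon><..} x) \<partial>jumps 0 t \<omega>)) \<in> borel_measurable M"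
    using Y_measurable[of t] t nn_integral_jumps_measurable[OF t f]
    by (intro borel_measurable_diff borel_measurable_enn2real) auto
  fix \<omega> assume \<omega>: "\<omega> \<in> space M"
  interpret nondecreasing_path "\<lambda>s. Y s \<omega>" by (rule nondecreasing_path[OF \<omega>])
  have "(\<integral>x. x * indicator {\<epsilon><..} x \<partial>jumps 0 t \<omega>) = enn2real (\<integral>\<^sup>+x. ennreal (x * indicator {\<epsilon><..} x) \<partial>jumps 0 t \<omega>)"
    using \<epsilon> jumps_lf[OF order_refl \<omega>, of t]
    by (intro integral_eq_nn_integral)
      (auto simp: measurable_lf indicator_def intro!: measurable_restrict_space1)
  then show "remove_jumps \<epsilon> (\<lambda>s. Y s \<omega>) t = Y t \<omega> - enn2real (\<integral>\<^sup>+x. ennreal (x * indicator {\<epsilon><..} x) \<partial>jumps 0 t \<omega>)"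
    using remove_jumps_eq[OF \<epsilon>, of t] by (simp add: jumps_def)
qed

lemma AE_remove_jumps_nonneg:
  assumes \<epsilon>: "0 < \<epsilon>"
  shows "AE \<omega> in M. 0 \<le> remove_jumps \<epsilon> (\<lambda>s. Y s \<omega>) t"
  using AE_jump_sum AE_space
proof eventually_elim
  case (elim \<omega>)
  interpret nondecreasing_path "\<lambda>s. Y s \<omega>" by (rule nondecreasing_path[OF elim(2)])
  have "space (jump_measure_on (\<lambda>s. Y s \<omega>) 0 t) = {0<..}" by (simp add: jump_measure_on_def space_pos_borel)
  then show ?case unfolding remove_jumps_small[OF elim(1) \<epsilon>]
    by (intro integral_nonneg_AE AE_I2) (auto simp: indicator_def)
qed

text \<open>Dominated convergence along the test functions: on the side of the path the bound is a multiple of the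
  sum of all jumps, which is finite almost surely; on the side of the Levy measure it is a multiple of
  \<open>x\<close> on \<open>(0, 2 \<epsilon>]\<close>.\<close>

lemma Laplace_small_jumps:
  assumes \<kappa>: "0 \<le> \<kappa>" and \<epsilon>: "0 < \<epsilon>" and int: "set_integrable \<sigma> {0<..2 * \<epsilon>} (\<lambda>x. x)"
  shows "expectation (\<lambda>\<omega>. exp (- \<kappa> * ((1 / \<epsilon>) * remove_jumps \<epsilon> (\<lambda>s. Y s \<omega>) t)))
    = exp (- t * (\<integral>x. indicator {0<..1 * \<epsilon>} x * (x / \<epsilon>) * dickman_kernel \<kappa> (x / \<epsilon>) \<partial>\<sigma>))"
proof -
  define f where "f n x = small_jump_test \<kappa> n (1 / \<epsilon> * x)" for n x
  have fv: "f n \<in> vague_test" for n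
    unfolding f_def using \<epsilon> by (intro vague_test_rescale small_jump_test_vague \<kappa>) auto
  have f0: "0 \<le> f n x" for n x unfolding f_def by (rule small_jump_test_nonneg[OF \<kappa>])
  have f_le: "f n x \<le> \<kappa> / \<epsilon> * (indicator {0<..2 * \<epsilon>} x * x)" if x: "0 < x" for n x
    using small_jump_test_le[OF \<kappa>, of "1 / \<epsilon> * x" n] x \<epsilon> by (auto simp: f_def indicator_def field_simps split: if_splits)
  have f_lim: "(\<lambda>n. f n x) \<longlonglongrightarrow> \<kappa> / \<epsilon> * (x * indicator {..\<epsilon>} x)" if x: "0 < x" for x
  proof -
    have "(\<lambda>n. f n x) \<longlonglongrightarrow> \<kappa> * (1 / \<epsilon> * x * indicator {..1} (1 / \<epsilon> * x))"
      unfolding f_def using x \<epsilon> by (intro small_jump_test_LIMSEQ \<kappa>) auto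
    moreover have "indicator {..1} (1 / \<epsilon> * x) = (indicator {..\<epsilon>} x :: real)" using \<epsilon> by (auto simp: indicator_def field_simps)
    ultimately show ?thesis by (simp add: mult.assoc)
  qed
  have path_lim: "AE \<omega> in M. (\<lambda>n. exp (- (\<integral>x. f n x \<partial>jumps 0 t \<omega>))) \<longlonglongrightarrow> exp (- \<kappa> * ((1 / \<epsilon>) * remove_jumps \<epsilon> (\<lambda>s. Y s \<omega>) t))"
    using AE_jump_sum AE_space
  proof eventually_elim
    case (elim \<omega>)
    interpret nondecreasing_path "\<lambda>s. Y s \<omega>" by (rule nondecreasing_path[OF elim(2)])
    note lf = jumps_lf[OF order_refl elim(2), of t]
    have m: "(\<lambda>x. \<kappa> / \<epsilon> * (x * indicator {..\<epsilon>} x)) \<in> borel_measurable (jumps 0 t \<omega>)"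
      unfolding measurable_lf[OF lf] by (intro measurable_restrict_space1) measurable
    have "(\<lambda>n. \<integral>x. f n x \<partial>jumps 0 t \<omega>) \<longlonglongrightarrow> (\<integral>x. \<kappa> / \<epsilon> * (x * indicator {..\<epsilon>} x) \<partial>jumps 0 t \<omega>)"
    proof (rule integral_dominated_convergence[where w="\<lambda>x. \<kappa> / \<epsilon> * x"])
      show "integrable (jumps 0 t \<omega>) (\<lambda>x. \<kappa> / \<epsilon> * x)"
        unfolding jumps_def by (intro integrable_mult_right jump_sum_integral(1)[OF elim(1)])
      show "f n \<in> borel_measurable (jumps 0 t \<omega>)" for n
        unfolding measurable_lf[OF lf] by (rule vague_test_measurable[OF fv])
      show "AE x in jumps 0 t \<omega>. (\<lambda>n. f n x) \<longlonglongrightarrow> \<kappa> / \<epsilon> * (x * indicator {..\<epsilon>} x)"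
        using f_lim by (intro AE_I2) (simp add: space_lf[OF lf])
      show "AE x in jumps 0 t \<omega>. norm (f n x) \<le> \<kappa> / \<epsilon> * x" for n
      proof (rule AE_I2)
        fix x assume "x \<in> space (jumps 0 t \<omega>)"
        then have x: "0 < x" by (simp add: space_lf[OF lf])
        have "\<kappa> / \<epsilon> * (indicator {0<..2 * \<epsilon>} x * x) \<le> \<kappa> / \<epsilon> * x"
          using x \<kappa> \<epsilon> by (intro mult_left_mono) (auto simp: indicator_def)
        then show "norm (f n x) \<le> \<kappa> / \<epsilon> * x" using f_le[OF x, of n] f0[of n x] by simp
      qed
    qed (rule m)
    also have "(\<integral>x. \<kappa> / \<epsilon> * (x * indicator {..\<epsilon>} x) \<partial>jumps 0 t \<omega>) = \<kappa> / \<epsilon> * remove_jumps \<epsilon> (\<lambda>s. Y s \<omega>) t"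
      unfolding remove_jumps_small[OF elim(1) \<epsilon>] jumps_def by (rule integral_mult_right_zero)
    finally have "(\<lambda>n. exp (- (\<integral>x. f n x \<partial>jumps 0 t \<omega>))) \<longlonglongrightarrow> exp (- (\<kappa> / \<epsilon> * remove_jumps \<epsilon> (\<lambda>s. Y s \<omega>) t))"
      by (intro tendsto_intros)
    then show ?case by simp
  qed
  have left: "(\<lambda>n. expectation (\<lambda>\<omega>. exp (- (\<integral>x. f n x \<partial>jumps 0 t \<omega>))))
      \<longlonglongrightarrow> expectation (\<lambda>\<omega>. exp (- \<kappa> * ((1 / \<epsilon>) * remove_jumps \<epsilon> (\<lambda>s. Y s \<omega>) t)))"
  proof (rule integral_dominated_convergence[where w="\<lambda>_. 1"])
    show "(\<lambda>\<omega>. exp (- \<kappa> * ((1 / \<epsilon>) * remove_jumps \<epsilon> (\<lambda>s. Y s \<omega>) t))) \<in> borel_measurable M"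
      using remove_jumps_measurable[OF \<epsilon>] by measurable
    show "(\<lambda>\<omega>. exp (- (\<integral>x. f n x \<partial>jumps 0 t \<omega>))) \<in> borel_measurable M" for n
    proof -
      have [measurable]: "(\<lambda>\<omega>. \<integral>x. f n x \<partial>jumps 0 t \<omega>) \<in> borel_measurable M"
        using vague_jump_integral_measurable[OF fv order_refl t] by simp
      show ?thesis by measurable
    qed
    show "AE \<omega> in M. norm (exp (- (\<integral>x. f n x \<partial>jumps 0 t \<omega>))) \<le> 1" for n
      by (intro AE_I2) (simp add: integral_nonneg_AE f0)
  qed (use path_lim in auto)
  have "(\<lambda>n. \<integral>x. 1 - exp (- f n x) \<partial>\<sigma>) \<longlonglongrightarrow> (\<integral>x. 1 - exp (- (\<kappa> / \<epsilon> * (x * indicator {..\<epsilon>} x))) \<partial>\<sigma>)"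
  proof (rule integral_dominated_convergence[where w="\<lambda>x. \<kappa> / \<epsilon> * (indicator {0<..2 * \<epsilon>} x * x)"])
    show "integrable \<sigma> (\<lambda>x. \<kappa> / \<epsilon> * (indicator {0<..2 * \<epsilon>} x * x))"
      using int by (intro integrable_mult_right) (simp add: set_integrable_def)
    show "(\<lambda>x. 1 - exp (- (\<kappa> / \<epsilon> * (x * indicator {..\<epsilon>} x)))) \<in> borel_measurable \<sigma>"
      by (intro borel_measurable_\<sigma>) measurable
    show "(\<lambda>x. 1 - exp (- f n x)) \<in> borel_measurable \<sigma>" for n
      using Laplace_functional_levy_measure(1)[OF levy_measure fv t] by (rule borel_measurable_integrable)
    show "AE x in \<sigma>. (\<lambda>n. 1 - exp (- f n x)) \<longlonglongrightarrow> 1 - exp (- (\<kappa> / \<epsilon> * (x * indicator {..\<epsilon>} x)))"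
      by (intro AE_I2 tendsto_intros f_lim) (simp add: space_\<sigma>)
    show "AE x in \<sigma>. norm (1 - exp (- f n x)) \<le> \<kappa> / \<epsilon> * (indicator {0<..2 * \<epsilon>} x * x)" for n
    proof (rule AE_I2)
      fix x assume "x \<in> space \<sigma>"
      then have "f n x \<le> \<kappa> / \<epsilon> * (indicator {0<..2 * \<epsilon>} x * x)" by (intro f_le) (simp add: space_\<sigma>)
      then show "norm (1 - exp (- f n x)) \<le> \<kappa> / \<epsilon> * (indicator {0<..2 * \<epsilon>} x * x)"
        using exp_ge_add_one_self[of "- f n x"] f0[of n x] by simp
    qed
  qed
  also have "(\<integral>x. 1 - exp (- (\<kappa> / \<epsilon> * (x * indicator {..\<epsilon>} x))) \<partial>\<sigma>)
      = (\<integral>x. indicator {0<..1 * \<epsilon>} x * (x / \<epsilon>) * dickman_kernel \<kappa> (x / \<epsilon>) \<partial>\<sigma>)"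
    using \<epsilon> by (intro Bochner_Integration.integral_cong refl)
      (auto simp: space_\<sigma> indicator_def dickman_kernel_def field_simps)
  finally have "(\<lambda>n. exp (- t * (\<integral>x. 1 - exp (- f n x) \<partial>\<sigma>)))
      \<longlonglongrightarrow> exp (- t * (\<integral>x. indicator {0<..1 * \<epsilon>} x * (x / \<epsilon>) * dickman_kernel \<kappa> (x / \<epsilon>) \<partial>\<sigma>))"
    by (intro tendsto_intros)
  then show ?thesis
    using left unfolding Laplace_functional_levy_measure(2)[OF levy_measure fv t] by (rule LIMSEQ_unique[rotated])
qed

end

text \<open>Already \<open>k = 1\<close> suffices, since \<open>exp (- x)\<close> is a homeomorphism of the half line onto its image; the other
  powers make the family closed under products.\<close>

lemma generates_topology_exp:
  "generates_topology (top_of_set {0..}) (\<lambda>k (x::real). exp (- real k * x))"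
  unfolding generates_topology_def
proof (intro allI impI ballI)
  fix U and x :: real assume U: "openin (top_of_set {0..}) U" and x: "x \<in> U"
  obtain V where V: "open V" "U = {0..} \<inter> V" using U by (auto simp: openin_open)
  obtain r where r: "r > 0" "ball x r \<subseteq> V" using V x open_contains_ball by blast
  have "isCont ln (exp (- x))" by (intro isCont_ln) simp
  then obtain d where d: "d > 0" "\<And>z. \<bar>z - exp (- x)\<bar> < d \<Longrightarrow> \<bar>ln z - ln (exp (- x))\<bar> < r"
    using r(1) by (auto simp only: continuous_at_eps_delta dist_real_def)
  show "\<exists>n. \<exists>\<delta>>0. \<forall>y\<in>topspace (top_of_set {0..}). (\<forall>k<n. \<bar>exp (- real k * y) - exp (- real k * x)\<bar> < \<delta>) \<longrightarrow> y \<in> U"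
  proof (intro exI[of _ "2::nat"] exI[of _ d] conjI ballI impI)
    fix y assume y: "y \<in> topspace (top_of_set {0..})" and close: "\<forall>k<2. \<bar>exp (- real k * y) - exp (- real k * x)\<bar> < d"
    have "\<bar>exp (- real 1 * y) - exp (- real 1 * x)\<bar> < d" by (rule close[THEN spec, THEN mp]) simp
    then have "\<bar>ln (exp (- y)) - ln (exp (- x))\<bar> < r" by (intro d(2)) simp
    then have "y \<in> ball x r" by (simp add: dist_real_def)
    then show "y \<in> U" using r(2) V y by auto
  qed fact
qed

lemma borel_of_euclideanreal: "borel_of euclideanreal = borel"
  by (simp add: borel_of_def borel_def)

text \<open>Laplace transforms at the natural numbers suffice, because they are the moments of \<open>exp (- X)\<close>.  The
  functions \<open>exp (- k x)\<close> are bounded only on the half line, so the argument takes place there, and \<open>X\<close> is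
  replaced by the almost surely equal variable \<open>max 0 X\<close>.\<close>

theorem real_convergence_by_Laplace_transforms:
  fixes X :: "'i \<Rightarrow> 'a \<Rightarrow> real"
  assumes M: "prob_space M" and N: "prob_space N"
    and X: "\<forall>\<^sub>F i in F. X i \<in> borel_measurable M \<and> (AE \<omega> in M. 0 \<le> X i \<omega>)"
    and S: "S \<in> borel_measurable N" "\<And>\<omega>. 0 \<le> S \<omega>"
    and lim: "\<And>k::nat. ((\<lambda>i. \<integral>\<omega>. exp (- real k * X i \<omega>) \<partial>M) \<longlongrightarrow> (\<integral>\<omega>. exp (- real k * S \<omega>) \<partial>N)) F"
  shows "converges_in_distribution euclideanreal M X N S F"
proof -
  let ?H = "top_of_set {0::real..}"
  define E where "E = {f. \<exists>k::nat. \<forall>x\<ge>0. f x = exp (- real k * x)}"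
  have Em: "(\<lambda>\<omega>. exp (- real k * max 0 (X i \<omega>))) \<in> borel_measurable M"
    if [measurable]: "X i \<in> borel_measurable M" for i k
    by measurable
  have X': "\<forall>\<^sub>F i in F. \<forall>f\<in>(borel_measurable borel :: (real \<Rightarrow> real) set). (\<integral>\<omega>. f (max 0 (X i \<omega>)) \<partial>M) = (\<integral>\<omega>. f (X i \<omega>) \<partial>M)"
    using X
  proof eventually_elim
    case (elim i)
    show ?case
    proof
      fix f :: "real \<Rightarrow> real" assume [measurable]: "f \<in> borel_measurable borel"
      have [measurable]: "X i \<in> borel_measurable M" and AE: "AE \<omega> in M. 0 \<le> X i \<omega>" using elim by auto
      show "(\<integral>\<omega>. f (max 0 (X i \<omega>)) \<partial>M) = (\<integral>\<omega>. f (X i \<omega>) \<partial>M)"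
      proof (rule integral_cong_AE)
        show "AE \<omega> in M. f (max 0 (X i \<omega>)) = f (X i \<omega>)" using AE by eventually_elim (simp add: max_def)
      qed measurable
    qed
  qed
  have conv: "converges_in_distribution ?H M (\<lambda>i \<omega>. max 0 (X i \<omega>)) N S F"
  proof (rule converges_in_distribution_by_test_functions[OF M N _ _ _ _ generates_topology_exp])
    show "mult_closed E"
      unfolding mult_closed_def
    proof (intro conjI ballI)
      show "(\<lambda>_. 1) \<in> E" by (auto simp: E_def intro!: exI[of _ 0])
      fix f g assume "f \<in> E" "g \<in> E"
      then obtain k l :: nat where "\<forall>x\<ge>0. f x = exp (- real k * x)" "\<forall>x\<ge>0. g x = exp (- real l * x)" by (auto simp: E_def)
      then have "\<forall>x\<ge>0. f x * g x = exp (- real (k + l) * x)" by (simp add: algebra_simps flip: exp_add)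
      then show "(\<lambda>x. f x * g x) \<in> E" unfolding E_def by blast
    qed
    show "\<forall>f\<in>E. \<forall>x\<in>topspace ?H. \<bar>f x\<bar> \<le> 1" by (auto simp: E_def)
    show "continuous_map ?H euclideanreal f" if fE: "f \<in> E" for f
    proof -
      obtain k :: nat where k: "\<And>x. 0 \<le> x \<Longrightarrow> f x = exp (- real k * x)" using fE unfolding E_def by blast
      have "continuous_on {0..} (\<lambda>x. exp (- real k * x))" by (intro continuous_intros)
      then have "continuous_on {0..} f" by (rule continuous_on_eq) (simp add: k)
      then show ?thesis by simp
    qed
    show "(\<lambda>x. exp (- real k * x)) \<in> E" for k by (auto simp: E_def)
    show "\<forall>\<^sub>F i in F. (\<forall>\<omega>\<in>space M. max 0 (X i \<omega>) \<in> topspace ?H) \<and> (\<forall>k. (\<lambda>\<omega>. exp (- real k * max 0 (X i \<omega>))) \<in> borel_measurable M)"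
      using X by eventually_elim (auto intro: Em)
    show "S \<in> N \<rightarrow>\<^sub>M borel_of ?H"
      by (rule measurable_borel_of[OF generates_topology_exp]) (use S in auto)
    show "((\<lambda>i. \<integral>\<omega>. f (max 0 (X i \<omega>)) \<partial>M) \<longlongrightarrow> (\<integral>\<omega>. f (S \<omega>) \<partial>N)) F" if fE: "f \<in> E" for f
    proof -
      obtain k :: nat where k: "\<And>x. 0 \<le> x \<Longrightarrow> f x = exp (- real k * x)" using fE unfolding E_def by blast
      have em: "(\<lambda>x. exp (- real k * x)) \<in> borel_measurable borel" by measurable
      have "\<forall>\<^sub>F i in F. (\<integral>\<omega>. exp (- real k * X i \<omega>) \<partial>M) = (\<integral>\<omega>. f (max 0 (X i \<omega>)) \<partial>M)"
        using X'
      proof eventually_elim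
        case (elim i)
        from bspec[OF this em] show ?case by (simp add: k)
      qed
      moreover have "(\<integral>\<omega>. f (S \<omega>) \<partial>N) = (\<integral>\<omega>. exp (- real k * S \<omega>) \<partial>N)" using S by (simp add: k)
      ultimately show ?thesis using Lim_transform_eventually[OF lim] by simp
    qed
  qed
  show ?thesis
    unfolding converges_in_distribution_def borel_of_euclideanreal
  proof (intro conjI allI impI)
    show "\<forall>\<^sub>F i in F. X i \<in> borel_measurable M" using X by eventually_elim simp
    show "S \<in> borel_measurable N" by fact
    fix g :: "real \<Rightarrow> real" assume g: "continuous_map euclideanreal euclideanreal g \<and> bounded (g ` topspace euclideanreal)"
    then have gc: "continuous_on UNIV g" and gb: "bounded (g ` UNIV)" by auto
    have "continuous_map ?H euclideanreal g" using gc by (auto intro: continuous_on_subset)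
    moreover have "bounded (g ` topspace ?H)" using gb by (rule bounded_subset) auto
    ultimately have "((\<lambda>i. \<integral>\<omega>. g (max 0 (X i \<omega>)) \<partial>M) \<longlongrightarrow> (\<integral>\<omega>. g (S \<omega>) \<partial>N)) F"
      using conv unfolding converges_in_distribution_def by blast
    then show "((\<lambda>i. \<integral>\<omega>. g (X i \<omega>) \<partial>M) \<longlongrightarrow> (\<integral>\<omega>. g (S \<omega>) \<partial>N)) F"
      by (rule Lim_transform_eventually)
        (use X' borel_measurable_continuous_onI[OF gc] in \<open>auto elim!: eventually_mono\<close>)
  qed
qed

context scaled_subordinator
begin

text \<open>The limit is first identified on the probability space of the Poisson process and then transferred to
  \<open>D\<close>, which has the same law as the point sum.\<close>

theorem small_jumps_converge:
  assumes eta: "poisson_process N \<eta> (dickman_intensity (c * t))" and dickman: "has_law_of_point_sum N' D N \<eta>"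
  shows "converges_in_distribution euclideanreal
    M (\<lambda>\<epsilon> \<omega>. (1 / \<epsilon>) * remove_jumps \<epsilon> (\<lambda>s. Y s \<omega>) t) N' D (at_right 0)"
proof -
  have ct: "0 < c * t" using c t by simp
  interpret P: poisson_point_process N \<eta> "dickman_intensity (c * t)"
    by unfold_locales (use eta sets_dickman_intensity dickman_intensity_finite[OF ct] in auto)
  obtain \<epsilon>0 where \<epsilon>0: "0 < \<epsilon>0" "\<And>\<epsilon>. \<epsilon> \<le> \<epsilon>0 \<Longrightarrow> set_integrable \<sigma> {0<..\<epsilon>} (\<lambda>x. x)"
    by (rule threshold) (erule that; blast)
  have ev: "\<forall>\<^sub>F \<epsilon> in at_right 0. 0 < \<epsilon> \<and> 2 * \<epsilon> \<le> \<epsilon>0"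
    unfolding eventually_at_right[OF zero_less_one] using \<epsilon>0(1) by (intro exI[of _ "\<epsilon>0 / 2"]) auto
  have "converges_in_distribution euclideanreal
    M (\<lambda>\<epsilon> \<omega>. (1 / \<epsilon>) * remove_jumps \<epsilon> (\<lambda>s. Y s \<omega>) t) N (\<lambda>\<omega>. point_sum (\<eta> \<omega>)) (at_right 0)"
  proof (rule real_convergence_by_Laplace_transforms[OF prob_space_axioms P.prob_space_axioms _ P.point_sum_measurable P.point_sum_nonneg])
    show "\<forall>\<^sub>F \<epsilon> in at_right 0. (\<lambda>\<omega>. (1 / \<epsilon>) * remove_jumps \<epsilon> (\<lambda>s. Y s \<omega>) t) \<in> borel_measurable M \<and>
      (AE \<omega> in M. 0 \<le> (1 / \<epsilon>) * remove_jumps \<epsilon> (\<lambda>s. Y s \<omega>) t)"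
      using eventually_at_right_less[of "0::real"]
    proof eventually_elim
      case (elim \<epsilon>)
      have "AE \<omega> in M. 0 \<le> (1 / \<epsilon>) * remove_jumps \<epsilon> (\<lambda>s. Y s \<omega>) t"
        using AE_remove_jumps_nonneg[OF elim] by eventually_elim (use elim in simp)
      then show ?case using remove_jumps_measurable[OF elim] by simp
    qed
    show "((\<lambda>\<epsilon>. \<integral>\<omega>. exp (- real k * ((1 / \<epsilon>) * remove_jumps \<epsilon> (\<lambda>s. Y s \<omega>) t)) \<partial>M)
        \<longlongrightarrow> (\<integral>\<omega>. exp (- real k * point_sum (\<eta> \<omega>)) \<partial>N)) (at_right 0)" for k :: nat
    proof (cases "k = 0")
      case True then show ?thesis by (simp add: prob_space P.prob_space)
    next
      case False
      then have k: "0 < real k" by simp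
      have b: "\<bar>dickman_kernel (real k) x\<bar> \<le> real k" for x
        using dickman_kernel_bounds[of "real k" x] by simp
      have "((\<lambda>\<epsilon>. exp (- t * (\<integral>x. indicator {0<..1 * \<epsilon>} x * (x / \<epsilon>) * dickman_kernel (real k) (x / \<epsilon>) \<partial>\<sigma>)))
          \<longlongrightarrow> exp (- t * (c * (LBINT x:{0<..1}. dickman_kernel (real k) x)))) (at_right 0)"
        by (intro tendsto_intros tendsto_integral_small_jumps[OF zero_less_one isCont_dickman_kernel b])
      moreover have "exp (- t * (c * (LBINT x:{0<..1}. dickman_kernel (real k) x))) = (\<integral>\<omega>. exp (- real k * point_sum (\<eta> \<omega>)) \<partial>N)"
        unfolding Laplace_point_sum[OF eta ct k] by (simp add: mult_ac)
      moreover have "\<forall>\<^sub>F \<epsilon> in at_right 0. exp (- t * (\<integral>x. indicator {0<..1 * \<epsilon>} x * (x / \<epsilon>) * dickman_kernel (real k) (x / \<epsilon>) \<partial>\<sigma>))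
          = (\<integral>\<omega>. exp (- real k * ((1 / \<epsilon>) * remove_jumps \<epsilon> (\<lambda>s. Y s \<omega>) t)) \<partial>M)"
        using ev by eventually_elim (rule Laplace_small_jumps[symmetric], auto intro: \<epsilon>0(2))
      ultimately show ?thesis using Lim_transform_eventually by fastforce
    qed
  qed
  moreover have "(\<integral>\<omega>. g (point_sum (\<eta> \<omega>)) \<partial>N) = (\<integral>\<omega>. g (D \<omega>) \<partial>N')" if "continuous_map euclideanreal euclideanreal g" for g
  proof -
    have gm: "g \<in> borel_measurable borel" using that by (intro borel_measurable_continuous_onI) simp
    have D: "D \<in> borel_measurable N'" "distr N' borel D = distr N borel (\<lambda>\<omega>. point_sum (\<eta> \<omega>))"
      using dickman by (auto simp: has_law_of_point_sum_def point_sum_def)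
    show ?thesis using integral_distr[OF D(1) gm] integral_distr[OF P.point_sum_measurable gm] D(2) by simp
  qed
  moreover have "D \<in> borel_measurable N'" using dickman by (simp add: has_law_of_point_sum_def)
  ultimately show ?thesis
    unfolding converges_in_distribution_def borel_of_euclideanreal by auto
qed

end

section \<open>Dickman limit of a pure-jump subordinator\<close>

theorem theorem2p2:
  fixes M :: "'a measure" and Y :: "real \<Rightarrow> 'a \<Rightarrow> real" and \<sigma> :: "real measure"
    and c t :: real
    and N :: "'b measure" and \<eta> :: "'b \<Rightarrow> real measure"
    and N' :: "'d measure" and D :: "'d \<Rightarrow> real"
  assumes subordinator: "pure_jump_subordinator M Y"
    and levy_measure: "levy_measure_of M Y \<sigma>"
    and infinite: "emeasure \<sigma> {0<..} = \<infinity>"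
    and c: "c > 0"
    and small_jumps: "((\<lambda>\<epsilon>. (1 / \<epsilon>) * (LINT x:{0<..\<epsilon>}|\<sigma>. x)) \<longlongrightarrow> c) (at_right 0)"
    and t: "t > 0"
    and eta: "poisson_process N \<eta> (dickman_intensity (c * t))"
    and dickman: "has_law_of_point_sum N' D N \<eta>"
  shows "converges_in_distribution vague_topology
           M (\<lambda>\<epsilon> \<omega>. dilate (1 / \<epsilon>) (jump_measure (\<lambda>s. Y s \<omega>) t)) N \<eta> (at_right 0)
       \<and> converges_in_distribution euclideanreal
           M (\<lambda>\<epsilon> \<omega>. (1 / \<epsilon>) * remove_jumps \<epsilon> (\<lambda>s. Y s \<omega>) t) N' D (at_right 0)"
proof -
  interpret scaled_subordinator M Y \<sigma> c t
    using subordinator levy_measure c small_jumps t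
    by unfold_locales (auto simp: levy_measure_of_def small_jump_mass_def)
  show ?thesis using rescaled_jumps_converge[OF eta] small_jumps_converge[OF eta dickman] by simp
qed

end
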